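(* Let $p\neq 2$ be a prime and $K=\mathbb{Q}_p$. The function $\Gamma_p^0(T)$ (the Taylor expansion at $T=0$ of Morita's $p$-adic Gamma function $\Gamma_p$) is the Taylor solution at $T=0$ of a rank one differential equation $Y'=g_0(T)\cdot Y$ with $g_0(T)\in\mathcal{O}(D^-(0,1))\subset\mathbb{Q}_p[[T]]$. Put $\omega=|p|^{\frac1{p-1}}$, $r_0=|p|^{1/p}$, and $r_n=\omega^{\frac{1}{p^{n-1}(p-1)}}$ for all $n\geq 1$. If $\mathscr{F}$ is the associated differential module, and $D^-(0,1)$ has the empty weak triangulation, then $$\mathcal{R}^{\mathscr{F}}(x_{0,\rho})=\begin{cases}\omega|p|^{1/p}&\text{if }0\leq\rho\leq r_0,\\[2pt] \dfrac{\omega|p|^n}{\rho^{p^{n-1}(p-1)}}&\text{if }r_{n-1}\leq\rho\leq r_n,\ n\geq 1.\end{cases}$$ Moreover $|g_0(T)|(x_{0,\rho})\leq\rho^{-1}$ if $0\leq\rho\leq r_0$, and $|g_0(T)|(x_{0,\rho})=\rho^{p^{n-1}(p-1)}/|p|^n$ if $r_{n-1}\leq\rho\leq r_n$, $n\geq 1$.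
   Context: $\Gamma_p:\mathbb{Z}_p\to\mathbb{Z}_p$ is the unique continuous function with $\Gamma_p(0)=1$, $\Gamma_p(x+1)=-x\Gamma_p(x)$ if $|x|=1$ and $\Gamma_p(x+1)=-\Gamma_p(x)$ if $|x|<1$. It is locally analytic, and $\Gamma_p^0(T)=1+\sum_{n\ge1}\gamma_n^0T^n\in\mathbb{Q}_p[[T]]$ denotes its Taylor expansion at $0$. $D^-(0,1)$ is the open unit disc over $\mathbb{Q}_p$. For $0\le\rho<1$, $x_{0,\rho}$ is the point of $D^-(0,1)$ given by the seminorm $|\sum a_nT^n|(x_{0,\rho})=\sup_n|a_n|\rho^n$. Let $\Omega/\mathbb{Q}_p$ be a complete valued field, algebraically closed, spherically complete, with $|\Omega|=\mathbb{R}_{\ge0}$, containing isometrically all completed residue fields of points of $D^-(0,1)$; for $x\in D^-(0,1)$ let $t_x\in D^-(0,1)_\Omega$ be an $\Omega$-rational point above $x$. $\mathcal{R}^{\mathscr{F}}(x)$ is the radius (in the coordinate $T$) of the largest open disc centered at $t_x$ and contained in $D^-(0,1)_\Omega$ on which $\mathscr{F}_\Omega$ is trivial, i.e. on which $Y'=g_0Y$ has a non-zero analytic solution. (For $\rho=0$, $\rho^{-1}=+\infty$.) *)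

theory Defs
  imports
    "HOL-Analysis.Abstract_Metric_Spaces"
    "HOL-Computational_Algebra.Computational_Algebra"
    "HOL-Library.Extended_Real"
begin

locale valued_field =
  fixes nv :: "'a::field \<Rightarrow> real"
  assumes nv_nonneg: "0 \<le> nv x"
    and nv_eq_0_iff: "nv x = 0 \<longleftrightarrow> x = 0"
    and nv_mult: "nv (x * y) = nv x * nv y"
    and nv_add: "nv (x + y) \<le> max (nv x) (nv y)"

definition val_dist :: "('a::field \<Rightarrow> real) \<Rightarrow> 'a \<Rightarrow> 'a \<Rightarrow> real" where
  "val_dist nv x y = nv (x - y)"

definition val_topology :: "('a::field \<Rightarrow> real) \<Rightarrow> 'a topology" where
  "val_topology nv = Metric_space.mtopology UNIV (val_dist nv)"

context valued_field
begin

lemma nv_1: "nv 1 = 1"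
  using nv_mult[of 1 1] nv_eq_0_iff[of 1] by simp

lemma nv_minus: "nv (- x) = nv x"
proof -
  have "nv (- 1) * nv (- 1) = 1"
    using nv_mult[of "- 1" "- 1"] nv_1 by simp
  then have "nv (- 1) = 1"
    using nv_nonneg[of "- 1"] by (metis abs_of_nonneg abs_1 real_sqrt_abs2 real_sqrt_one)
  then show ?thesis
    using nv_mult[of "- 1" x] by simp
qed

lemma Metric_space_val_dist: "Metric_space UNIV (val_dist nv)"
proof
  show "val_dist nv x y = val_dist nv y x" for x y
    unfolding val_dist_def by (metis minus_diff_eq nv_minus)
  show "val_dist nv x z \<le> val_dist nv x y + val_dist nv y z" for x y z
    using nv_add[of "x - y" "y - z"] nv_nonneg[of "x - y"] nv_nonneg[of "y - z"]
    by (simp add: val_dist_def)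
qed (auto simp: val_dist_def nv_nonneg nv_eq_0_iff)

end

locale complete_valued_field = valued_field +
  assumes complete: "Metric_space.mcomplete UNIV (val_dist nv)"

text \<open>
  The field of p-adic numbers, given (uniquely up to a unique isometric isomorphism) as the
  completion of the rationals for the p-adic absolute value, normalised by \<open>|p| = 1/p\<close>.
\<close>

locale padic_numbers = complete_valued_field nv
  for nv :: "'k::field_char_0 \<Rightarrow> real" and p :: nat +
  assumes prime_p: "prime p"
    and nv_of_int: "m \<noteq> 0 \<Longrightarrow> nv (of_int m) = (1 / real p) ^ multiplicity (int p) m"
    and dense_rat: "val_topology nv closure_of (range of_rat) = UNIV"

definition spherically_complete :: "('w::field \<Rightarrow> real) \<Rightarrow> bool" where
  "spherically_complete nv \<longleftrightarrow>
     (\<forall>(c :: nat \<Rightarrow> 'w) r. (\<forall>n. 0 \<le> r n) \<and>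
        (\<forall>n. {x. nv (x - c (Suc n)) \<le> r (Suc n)} \<subseteq> {x. nv (x - c n) \<le> r n}) \<longrightarrow>
        (\<Inter>n. {x. nv (x - c n) \<le> r n}) \<noteq> {})"

definition field_embedding :: "('k::field \<Rightarrow> 'w::field) \<Rightarrow> bool" where
  "field_embedding \<iota> \<longleftrightarrow>
     \<iota> 1 = 1 \<and> (\<forall>a b. \<iota> (a + b) = \<iota> a + \<iota> b) \<and> (\<forall>a b. \<iota> (a * b) = \<iota> a * \<iota> b)"

definition fps_sums_to :: "('a::field \<Rightarrow> real) \<Rightarrow> 'a fps \<Rightarrow> 'a \<Rightarrow> 'a \<Rightarrow> bool" where
  "fps_sums_to nv f x s \<longleftrightarrow>
     limitin (val_topology nv) (\<lambda>n. \<Sum>k<n. fps_nth f k * x ^ k) s sequentially"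

definition fps_value :: "('a::field \<Rightarrow> real) \<Rightarrow> 'a fps \<Rightarrow> 'a \<Rightarrow> 'a" where
  "fps_value nv f x = (THE s. fps_sums_to nv f x s)"

text \<open>
  The ring of analytic functions on the open disc of radius \<open>R\<close>, in terms of a coordinate
  centred at the centre of the disc. Over a field that is not algebraically closed,
  convergence at the rational points would not be enough.
\<close>

definition disc_functions :: "('a::field \<Rightarrow> real) \<Rightarrow> real \<Rightarrow> 'a fps set" where
  "disc_functions nv R =
     {f. \<forall>\<rho>. 0 \<le> \<rho> \<and> \<rho> < R \<longrightarrow> (\<lambda>n. nv (fps_nth f n) * \<rho> ^ n) \<longlonglongrightarrow> 0}"

definition base_change :: "('k::field \<Rightarrow> 'w::field) \<Rightarrow> 'k fps \<Rightarrow> 'w fps" where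
  "base_change \<iota> f = Abs_fps (\<lambda>n. \<iota> (fps_nth f n))"

definition gauss_norm :: "('k::field \<Rightarrow> real) \<Rightarrow> real \<Rightarrow> 'k fps \<Rightarrow> real" where
  "gauss_norm nv \<rho> f = (SUP n. nv (fps_nth f n) * \<rho> ^ n)"

text \<open>
  The Berkovich open unit disc, as an open subset of the analytic affine line: its points
  are the multiplicative seminorms on the polynomial ring that extend the absolute value and
  satisfy \<open>|T|(x) < 1\<close>.
\<close>

definition open_unit_disc :: "('k::field \<Rightarrow> real) \<Rightarrow> ('k poly \<Rightarrow> real) set" where
  "open_unit_disc nv =
     {x. (\<forall>P. 0 \<le> x P) \<and> (\<forall>a. x [:a:] = nv a) \<and>
         (\<forall>P Q. x (P * Q) = x P * x Q) \<and> (\<forall>P Q. x (P + Q) \<le> max (x P) (x Q)) \<and>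
         x [:0, 1:] < 1}"

definition gauss_point :: "('k::field \<Rightarrow> real) \<Rightarrow> real \<Rightarrow> 'k poly \<Rightarrow> real" where
  "gauss_point nv \<rho> P = gauss_norm nv \<rho> (fps_of_poly P)"

text \<open>
  The residue field of a point \<open>x\<close> is the fraction field of the polynomial ring modulo the kernel
  of \<open>x\<close>. A ring homomorphism \<open>\<phi>\<close> as below is the same as an isometric embedding over the base
  field of that residue field; as the target is required to be complete wherever this is used,
  it is also the same as an isometric embedding of the completed residue field, whose image
  is the closure of the set of quotients \<open>\<phi> P / \<phi> Q\<close>.
\<close>

definition contains_residue_field ::
  "('w::field \<Rightarrow> real) \<Rightarrow> ('k::field \<Rightarrow> 'w) \<Rightarrow> ('k poly \<Rightarrow> real) \<Rightarrow> bool" where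
  "contains_residue_field nvW \<iota> x \<longleftrightarrow>
     (\<exists>\<phi> :: 'k poly \<Rightarrow> 'w.
        (\<forall>a. \<phi> [:a:] = \<iota> a) \<and> (\<forall>P Q. \<phi> (P + Q) = \<phi> P + \<phi> Q) \<and>
        (\<forall>P Q. \<phi> (P * Q) = \<phi> P * \<phi> Q) \<and> (\<forall>P. nvW (\<phi> P) = x P))"

locale big_field_extension =
  base: valued_field nv + complete_valued_field nvW
  for nv :: "'k::field \<Rightarrow> real" and nvW :: "'w::alg_closed_field \<Rightarrow> real" +
  fixes \<iota> :: "'k \<Rightarrow> 'w"
  assumes embedding: "field_embedding \<iota>"
    and isometric: "nvW (\<iota> a) = nv a"
    and spherically_complete: "spherically_complete nvW"
    and full_value_group: "range nvW = {0..}"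
    and residue_fields: "x \<in> open_unit_disc nv \<Longrightarrow> contains_residue_field nvW \<iota> x"

definition lies_above ::
  "('w::field \<Rightarrow> real) \<Rightarrow> ('k::field \<Rightarrow> 'w) \<Rightarrow> 'w \<Rightarrow> ('k poly \<Rightarrow> real) \<Rightarrow> bool" where
  "lies_above nvW \<iota> t x \<longleftrightarrow>
     nvW t < 1 \<and> (\<lambda>P. nvW (poly (map_poly \<iota> P) t)) = x"

text \<open>
  \<open>y\<close> below is a power series in \<open>T - t\<close>, so that its formal derivative is its derivative
  with respect to \<open>T\<close>, whereas \<open>g\<close> is a power series in \<open>T\<close>.
\<close>

definition trivial_on_disc ::
  "('w::field \<Rightarrow> real) \<Rightarrow> 'w fps \<Rightarrow> 'w \<Rightarrow> real \<Rightarrow> bool" where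
  "trivial_on_disc nvW g t R \<longleftrightarrow>
     (\<exists>y \<in> disc_functions nvW R. y \<noteq> 0 \<and>
        (\<forall>z. nvW (z - t) < R \<longrightarrow>
           fps_value nvW (fps_deriv y) (z - t) = fps_value nvW g z * fps_value nvW y (z - t)))"

definition solution_radius ::
  "('w::field \<Rightarrow> real) \<Rightarrow> 'w fps \<Rightarrow> 'w \<Rightarrow> real" where
  "solution_radius nvW g t =
     (GREATEST R. 0 < R \<and> {z. nvW (z - t) < R} \<subseteq> {z. nvW z < 1} \<and> trivial_on_disc nvW g t R)"

definition valuation_ring :: "('k::field \<Rightarrow> real) \<Rightarrow> 'k set" where
  "valuation_ring nv = {x. nv x \<le> 1}"

text \<open>The values of \<open>\<Gamma>\<close> outside the valuation ring are irrelevant.\<close>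

definition is_morita_gamma :: "('k::field \<Rightarrow> real) \<Rightarrow> ('k \<Rightarrow> 'k) \<Rightarrow> bool" where
  "is_morita_gamma nv \<Gamma> \<longleftrightarrow>
     continuous_map (subtopology (val_topology nv) (valuation_ring nv))
                    (subtopology (val_topology nv) (valuation_ring nv)) \<Gamma> \<and>
     \<Gamma> 0 = 1 \<and>
     (\<forall>x. nv x = 1 \<longrightarrow> \<Gamma> (x + 1) = - x * \<Gamma> x) \<and>
     (\<forall>x. nv x < 1 \<longrightarrow> \<Gamma> (x + 1) = - \<Gamma> x)"

definition is_taylor_expansion_at_0 ::
  "('k::field \<Rightarrow> real) \<Rightarrow> ('k \<Rightarrow> 'k) \<Rightarrow> 'k fps \<Rightarrow> bool" where
  "is_taylor_expansion_at_0 nv f F \<longleftrightarrow>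
     (\<exists>r>0. \<forall>x \<in> valuation_ring nv. nv x < r \<longrightarrow> fps_sums_to nv F x (f x))"

end

theory Submission
  imports Defs "HOL-Number_Theory.Number_Theory"
begin

text \<open>
  Put \<open>g = F'/F\<close> for the Taylor expansion \<open>F\<close> of \<open>\<Gamma>\<close> at \<open>0\<close>, and \<open>h = p ^ N\<close>. The functional equation reads
  \<open>F(x + h) = P(x) F(x)\<close> with \<open>P(x) = - \<Prod> (x + j)\<close>, the product running over the \<open>j < h\<close> prime to
  \<open>p\<close>. Hence \<open>(P - 1) / h\<close> tends to \<open>g\<close> coefficientwise, and so does \<open>P' / (h P) = (1/h) \<Sum> 1 / (x + j)\<close> to
  \<open>g'\<close>. Modulo integral elements \<open>p ^ -N\<close> times the sum of the \<open>j ^ -k\<close> does not depend on \<open>N\<close>, so the case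
  \<open>N = 1\<close> shows \<open>|k g\<^sub>k| = p\<close> if \<open>p - 1\<close> divides \<open>k \<ge> 1\<close> and \<open>|k g\<^sub>k| \<le> 1\<close> otherwise; moreover
  \<open>|g\<^sub>0| \<le> 1\<close> by Wilson's theorem modulo \<open>p ^ N\<close>. The Gauss norms of \<open>g\<close> follow.

  If \<open>|g|(x) > 1 / \<rho>\<close> at the Gauss point \<open>x\<close> of radius \<open>\<rho>\<close>, then the \<open>n\<close>-th Taylor coefficient of the solution
  at \<open>x\<close> has absolute value exactly \<open>|g|(x) ^ n / |n!|\<close>, which gives the radius \<open>\<omega> / |g|(x)\<close>. For
  \<open>\<rho> \<le> |p| ^ (1/p)\<close> the same recurrence bounds the radius below by \<open>\<omega> |p| ^ (1/p)\<close>. These coefficients are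
  power series over the base field evaluated at a Gauss point, so they dominate their values at \<open>0\<close>;
  hence the radius is at most that of \<open>F\<close>, which is governed by the term of degree \<open>p\<close> of the primitive of \<open>g\<close>.
\<close>

section \<open>Power series over a complete valued field\<close>

text \<open>The threshold |g|(x) > 1/rho is where the leading coefficient wins. Cauchy's estimates
  bound the i-th Taylor coefficient of g at t by A / rho^i with A = |g|(x), and A rho > 1 makes this
  smaller than A^(i+1); in the recurrence for the solution the term i = 0 then strictly dominates
  and nothing can cancel. For rho <= r_0 this fails and the recurrence only bounds the coefficients
  from above. The missing upper bound on the radius comes from the centre: the primitive of g is c
  T^p plus a series whose exponential is bounded on the disc of radius omega, and |c| = p^2. So F
  converges on no larger disc than exp(c T^p), whose radius R satisfies p^2 R^p = omega; with
  omega^(p-1) = |p| this is R = omega |p|^(1/p). The constant omega enters through |n!| >= omega^n,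
  together with |n!| = omega^(n-1) when n is a power of p: along these degrees the terms on the
  boundary circle have constant absolute value, which excludes every larger disc.\<close>

definition hasse_deriv :: "nat \<Rightarrow> 'a::field fps \<Rightarrow> 'a fps" where
  "hasse_deriv i f = Abs_fps (\<lambda>k. of_nat ((k + i) choose i) * fps_nth f (k + i))"

lemma hasse_deriv_0 [simp]: "hasse_deriv 0 f = f"
  by (rule fps_ext) (simp add: hasse_deriv_def)

context valued_field
begin

lemma nv_0 [simp]: "nv 0 = 0"
  by (simp add: nv_eq_0_iff)

lemma nv_pos_iff: "0 < nv x \<longleftrightarrow> x \<noteq> 0"
  using nv_nonneg[of x] nv_eq_0_iff[of x] by linarith

lemma nv_diff: "nv (x - y) \<le> max (nv x) (nv y)"
  using nv_add[of x "- y"] by (simp add: nv_minus)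

lemma nv_minus_commute: "nv (x - y) = nv (y - x)"
  by (metis minus_diff_eq nv_minus)

lemma nv_power: "nv (x ^ n) = nv x ^ n"
  by (induction n) (auto simp: nv_1 nv_mult)

lemma nv_inverse: "nv (inverse x) = inverse (nv x)"
proof (cases "x = 0")
  case False
  then have "nv x * nv (inverse x) = 1"
    by (metis nv_1 nv_mult right_inverse)
  then show ?thesis
    by (metis inverse_unique)
qed simp

lemma nv_divide: "nv (x / y) = nv x / nv y"
  by (simp add: divide_inverse nv_mult nv_inverse)

lemma nv_triangle: "nv (x + y) \<le> nv x + nv y"
  using nv_add[of x y] nv_nonneg[of x] nv_nonneg[of y] by linarith

lemma nv_triangle_diff: "nv (x - y) \<le> nv x + nv y"
  using nv_diff[of x y] nv_nonneg[of x] nv_nonneg[of y] by linarith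

lemma nv_add_le: "nv x \<le> B \<Longrightarrow> nv y \<le> B \<Longrightarrow> nv (x + y) \<le> B"
  using nv_add[of x y] by linarith

lemma nv_dist_trans: "nv (x - y) \<le> B \<Longrightarrow> nv (y - z) \<le> B \<Longrightarrow> nv (x - z) \<le> B"
  using nv_add_le[of "x - y" B "y - z"] by simp

lemma nv_sum_le:
  assumes "0 \<le> B" "\<And>i. i \<in> A \<Longrightarrow> nv (f i) \<le> B"
  shows "nv (sum f A) \<le> B"
  using assms by (induction A rule: infinite_finite_induct) (auto intro: nv_add_le)

lemma nv_sum_less:
  assumes "0 < B" "\<And>i. i \<in> A \<Longrightarrow> nv (f i) < B"
  shows "nv (sum f A) < B"
  using assms
proof (induction A rule: infinite_finite_induct)
  case (insert a A)
  then have "nv (f a) < B" "nv (sum f A) < B"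
    by auto
  then show ?case
    using insert.hyps nv_add[of "f a" "sum f A"] by auto
qed auto

lemma nv_add_eq_right:
  assumes "nv x < nv y"
  shows "nv (x + y) = nv y"
proof -
  have "nv y \<le> max (nv (x + y)) (nv x)"
    using nv_diff[of "x + y" x] by simp
  then show ?thesis
    using assms nv_add[of x y] by linarith
qed

lemma nv_eq_if_close:
  assumes "nv (x - y) < nv y"
  shows "nv x = nv y"
  using nv_add_eq_right[OF assms] by simp

lemma nv_of_nat_le_1: "nv (of_nat n) \<le> 1"
  by (induction n) (auto simp: nv_1 intro: nv_add_le)

lemma nv_of_nat_mult_le: "nv x \<le> B \<Longrightarrow> nv (of_nat n * x) \<le> B"
  using nv_of_nat_le_1[of n] nv_nonneg[of x]
  by (metis mult_left_le_one_le nv_mult nv_nonneg order_trans)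

lemma nv_of_nat_dvd_le: "m dvd n \<Longrightarrow> nv (of_nat n) \<le> nv (of_nat m)"
  using nv_of_nat_mult_le[OF order_refl] by (metis dvd_def mult.commute of_nat_mult)

lemma limitin_val_topology_iff:
  "limitin (val_topology nv) u s sequentially \<longleftrightarrow> (\<lambda>n. nv (u n - s)) \<longlonglongrightarrow> 0"
proof -
  interpret M: Metric_space UNIV "val_dist nv"
    by (rule Metric_space_val_dist)
  show ?thesis
    unfolding val_topology_def M.limit_metric_sequentially
    by (auto simp: val_dist_def LIMSEQ_iff nv_nonneg)
qed

text \<open>The absolute value is locally constant away from 0: a term closer to \<open>s\<close>
  than \<open>nv s\<close> has the same absolute value as \<open>s\<close>.\<close>

lemma nv_limit_le:
  assumes "(\<lambda>n. nv (u n - s)) \<longlonglongrightarrow> 0" and "\<forall>\<^sub>F n in sequentially. nv (u n) \<le> B"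
  shows "nv s \<le> B"
proof (rule ccontr)
  assume *: "\<not> nv s \<le> B"
  obtain m where "nv (u m) \<le> B"
    using eventually_happens'[OF sequentially_bot assms(2)] by blast
  then have "0 < nv s"
    using * nv_nonneg[of "u m"] by linarith
  from order_tendstoD(2)[OF assms(1) this] assms(2)
  have "\<forall>\<^sub>F n in sequentially. nv (u n - s) < nv s \<and> nv (u n) \<le> B"
    by eventually_elim simp
  then obtain n where "nv (u n - s) < nv s" "nv (u n) \<le> B"
    using eventually_happens'[OF sequentially_bot] by blast
  then show False
    using nv_eq_if_close[of "u n" s] * by simp
qed

lemma nv_limit_unique:
  assumes "(\<lambda>n. nv (u n - s)) \<longlonglongrightarrow> 0" "(\<lambda>n. nv (u n - s')) \<longlonglongrightarrow> 0"
  shows "s = s'"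
proof -
  have "(\<lambda>n. nv ((u n - s) - (u n - s'))) \<longlonglongrightarrow> 0"
  proof (rule Lim_null_comparison)
    show "\<forall>\<^sub>F n in sequentially. norm (nv ((u n - s) - (u n - s'))) \<le> nv (u n - s) + nv (u n - s')"
    proof (intro always_eventually allI)
      fix n
      show "norm (nv ((u n - s) - (u n - s'))) \<le> nv (u n - s) + nv (u n - s')"
        using nv_triangle_diff[of "u n - s" "u n - s'"] by (simp add: nv_nonneg)
    qed
    show "(\<lambda>n. nv (u n - s) + nv (u n - s')) \<longlonglongrightarrow> 0"
      using tendsto_add[OF assms] by simp
  qed
  then have "nv (s' - s) = 0"
    by (simp add: LIMSEQ_const_iff)
  then show ?thesis
    by (simp add: nv_eq_0_iff)
qed

lemma nv_limit_add:
  assumes "(\<lambda>n. nv (u n - s)) \<longlonglongrightarrow> 0" "(\<lambda>n. nv (v n - s')) \<longlonglongrightarrow> 0"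
  shows "(\<lambda>n. nv ((u n + v n) - (s + s'))) \<longlonglongrightarrow> 0"
proof (rule Lim_null_comparison)
  show "\<forall>\<^sub>F n in sequentially. norm (nv ((u n + v n) - (s + s'))) \<le> nv (u n - s) + nv (v n - s')"
  proof (intro always_eventually allI)
    fix n
    have "(u n + v n) - (s + s') = (u n - s) + (v n - s')"
      by simp
    then show "norm (nv ((u n + v n) - (s + s'))) \<le> nv (u n - s) + nv (v n - s')"
      using nv_triangle[of "u n - s" "v n - s'"] by (simp only: real_norm_def abs_of_nonneg[OF nv_nonneg])
  qed
  show "(\<lambda>n. nv (u n - s) + nv (v n - s')) \<longlonglongrightarrow> 0"
    using tendsto_add[OF assms] by simp
qed

lemma nv_limit_mult:
  assumes "(\<lambda>n. nv (u n - s)) \<longlonglongrightarrow> 0" "(\<lambda>n. nv (v n - s')) \<longlonglongrightarrow> 0"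
  shows "(\<lambda>n. nv (u n * v n - s * s')) \<longlonglongrightarrow> 0"
proof (rule Lim_null_comparison)
  let ?B = "\<lambda>n. nv (u n - s) * nv (v n - s') + nv (u n - s) * nv s' + nv s * nv (v n - s')"
  show "\<forall>\<^sub>F n in sequentially. norm (nv (u n * v n - s * s')) \<le> ?B n"
  proof (intro always_eventually allI)
    fix n
    have "u n * v n - s * s' = ((u n - s) * (v n - s') + (u n - s) * s') + s * (v n - s')"
      by (simp add: algebra_simps)
    then have "nv (u n * v n - s * s') \<le> nv ((u n - s) * (v n - s') + (u n - s) * s') + nv (s * (v n - s'))"
      using nv_triangle by simp
    also have "\<dots> \<le> ?B n"
      using nv_triangle[of "(u n - s) * (v n - s')" "(u n - s) * s'"] by (simp add: nv_mult)
    finally show "norm (nv (u n * v n - s * s')) \<le> ?B n"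
      by (simp add: nv_nonneg)
  qed
  show "?B \<longlonglongrightarrow> 0"
    using tendsto_add[OF tendsto_add[OF tendsto_mult[OF assms] tendsto_mult_left_zero[OF assms(1)]]
        tendsto_mult_right_zero[OF assms(2)]] by simp
qed

lemma nv_limit_sum:
  assumes "\<And>i. i \<in> A \<Longrightarrow> (\<lambda>n. nv (u i n - s i)) \<longlonglongrightarrow> 0"
  shows "(\<lambda>n. nv ((\<Sum>i\<in>A. u i n) - (\<Sum>i\<in>A. s i))) \<longlonglongrightarrow> 0"
  using assms
proof (induction A rule: infinite_finite_induct)
  case (insert a A)
  have "(\<lambda>n. nv ((u a n + (\<Sum>i\<in>A. u i n)) - (s a + (\<Sum>i\<in>A. s i)))) \<longlonglongrightarrow> 0"
    by (rule nv_limit_add) (use insert in auto)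
  then show ?case
    using insert.hyps by simp
qed auto

section \<open>Values of power series\<close>

lemma fps_sums_to_iff:
  "fps_sums_to nv f x s \<longleftrightarrow> (\<lambda>n. nv ((\<Sum>k<n. fps_nth f k * x ^ k) - s)) \<longlonglongrightarrow> 0"
  unfolding fps_sums_to_def by (rule limitin_val_topology_iff)

lemma fps_value_eqI: "fps_sums_to nv f x s \<Longrightarrow> fps_value nv f x = s"
  unfolding fps_value_def
  by (rule the_equality) (use nv_limit_unique in \<open>unfold fps_sums_to_iff, blast+\<close>)

lemma fps_sums_to_0: "fps_sums_to nv f 0 (fps_nth f 0)"
  unfolding fps_sums_to_iff
proof (rule tendsto_eventually)
  show "\<forall>\<^sub>F n in sequentially. nv ((\<Sum>k<n. fps_nth f k * 0 ^ k) - fps_nth f 0) = 0"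
  proof (rule eventually_sequentiallyI[of 1])
    fix n :: nat
    assume "1 \<le> n"
    then have "(\<Sum>k<n. fps_nth f k * 0 ^ k) = (\<Sum>k\<in>{0}. fps_nth f k * 0 ^ k)"
      by (intro sum.mono_neutral_right) auto
    then show "nv ((\<Sum>k<n. fps_nth f k * 0 ^ k) - fps_nth f 0) = 0"
      by simp
  qed
qed

text \<open>By the ultrametric inequality a bound on the single terms is a bound on every finite
  piece of the tail, and it survives in the limit.\<close>

lemma fps_sums_to_tail_le:
  assumes "fps_sums_to nv f x s" "\<And>k. k \<ge> n \<Longrightarrow> nv (fps_nth f k) * nv x ^ k \<le> B" "0 \<le> B"
  shows "nv (s - (\<Sum>k<n. fps_nth f k * x ^ k)) \<le> B"
proof (rule nv_limit_le)
  let ?S = "\<lambda>n. \<Sum>k<n. fps_nth f k * x ^ k"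
  show "(\<lambda>m. nv ((?S m - ?S n) - (s - ?S n))) \<longlonglongrightarrow> 0"
    using assms(1) unfolding fps_sums_to_iff by simp
  show "\<forall>\<^sub>F m in sequentially. nv (?S m - ?S n) \<le> B"
  proof (rule eventually_sequentiallyI[of n])
    fix m assume "n \<le> m"
    then have "?S m - ?S n = (\<Sum>k\<in>{n..<m}. fps_nth f k * x ^ k)"
      by (simp add: lessThan_atLeast0 sum_diff_nat_ivl)
    then show "nv (?S m - ?S n) \<le> B"
      using assms by (auto intro!: nv_sum_le simp: nv_mult nv_power)
  qed
qed

lemma fps_sums_to_le:
  assumes "fps_sums_to nv f x s" "\<And>k. nv (fps_nth f k) * nv x ^ k \<le> B"
  shows "nv s \<le> B"
proof -
  have "0 \<le> B"
    using assms(2)[of 0] nv_nonneg[of "fps_nth f 0"] by simp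
  then show ?thesis
    using fps_sums_to_tail_le[OF assms(1), where n = 0, OF assms(2)] by simp
qed

lemma fps_sums_to_terms:
  assumes "fps_sums_to nv f x s"
  shows "(\<lambda>k. nv (fps_nth f k) * nv x ^ k) \<longlonglongrightarrow> 0"
proof -
  let ?S = "\<lambda>n. \<Sum>k<n. fps_nth f k * x ^ k"
  have lim: "(\<lambda>n. nv (?S n - s)) \<longlonglongrightarrow> 0"
    using assms unfolding fps_sums_to_iff .
  have "(\<lambda>n. nv ((?S (Suc n) + (- 1) * ?S n) - (s + (- 1) * s))) \<longlonglongrightarrow> 0"
    by (intro nv_limit_add nv_limit_mult LIMSEQ_Suc[OF lim] lim) simp
  then show ?thesis
    by (simp add: nv_mult nv_power)
qed

lemma fps_sums_to_add:
  assumes "fps_sums_to nv f x s" "fps_sums_to nv g x s'"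
  shows "fps_sums_to nv (f + g) x (s + s')"
  using nv_limit_add[OF assms[unfolded fps_sums_to_iff]]
  unfolding fps_sums_to_iff by (simp add: sum.distrib algebra_simps)

lemma fps_sums_to_const_mult:
  assumes "fps_sums_to nv f x s"
  shows "fps_sums_to nv (fps_const c * f) x (c * s)"
  using nv_limit_mult[of "\<lambda>_. c" c, OF _ assms[unfolded fps_sums_to_iff]]
  unfolding fps_sums_to_iff by (simp add: sum_distrib_left mult.assoc)

lemma fps_sums_to_diff:
  assumes "fps_sums_to nv f x s" "fps_sums_to nv g x s'"
  shows "fps_sums_to nv (f - g) x (s - s')"
proof -
  have "f - g = f + fps_const (- 1) * g"
    by (metis diff_conv_add_uminus fps_const_neg fps_const_1_eq_1 mult_minus1)
  then show ?thesis
    using fps_sums_to_add[OF assms(1) fps_sums_to_const_mult[OF assms(2), of "- 1"]]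
    by (simp only: mult_minus1 diff_conv_add_uminus)
qed

lemma fps_sums_to_poly:
  "fps_sums_to nv (fps_of_poly P) x (poly P x)"
  unfolding fps_sums_to_iff
proof (rule tendsto_eventually)
  show "\<forall>\<^sub>F n in sequentially. nv ((\<Sum>k<n. fps_nth (fps_of_poly P) k * x ^ k) - poly P x) = 0"
  proof (rule eventually_sequentiallyI[of "Suc (degree P)"])
    fix n assume "Suc (degree P) \<le> n"
    then have "(\<Sum>k<n. Polynomial.coeff P k * x ^ k) = (\<Sum>k\<le>degree P. Polynomial.coeff P k * x ^ k)"
      by (intro sum.mono_neutral_right) (auto simp: coeff_eq_0)
    then show "nv ((\<Sum>k<n. fps_nth (fps_of_poly P) k * x ^ k) - poly P x) = 0"
      by (simp add: poly_altdef)
  qed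
qed

lemma bounded_of_tendsto_0:
  assumes "(\<lambda>k. u k :: real) \<longlonglongrightarrow> 0"
  obtains B where "0 < B" "\<And>k. u k \<le> B"
proof -
  obtain B where "0 < B" "\<And>k. norm (u k) \<le> B"
    using convergent_imp_Bseq[OF convergentI[OF assms]] by (auto elim: BseqE)
  then show ?thesis
    using that by (metis abs_ge_self order_trans real_norm_def)
qed

section \<open>The ring of functions on a disc\<close>

lemma disc_functions_mono: "f \<in> disc_functions nv R \<Longrightarrow> R' \<le> R \<Longrightarrow> f \<in> disc_functions nv R'"
  by (auto simp: disc_functions_def)

lemma disc_functions_add:
  assumes "f \<in> disc_functions nv R" "g \<in> disc_functions nv R"
  shows "f + g \<in> disc_functions nv R"
  unfolding disc_functions_def
proof (intro CollectI allI impI)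
  fix \<rho> :: real assume \<rho>: "0 \<le> \<rho> \<and> \<rho> < R"
  have lim: "(\<lambda>n. nv (fps_nth f n) * \<rho> ^ n + nv (fps_nth g n) * \<rho> ^ n) \<longlonglongrightarrow> 0"
    using assms \<rho> by (auto simp: disc_functions_def intro: tendsto_add_zero)
  show "(\<lambda>n. nv (fps_nth (f + g) n) * \<rho> ^ n) \<longlonglongrightarrow> 0"
  proof (rule Lim_null_comparison[OF _ lim], intro always_eventually allI)
    fix n
    have "nv (fps_nth (f + g) n) \<le> nv (fps_nth f n) + nv (fps_nth g n)"
      using nv_add[of "fps_nth f n" "fps_nth g n"] nv_nonneg[of "fps_nth f n"]
        nv_nonneg[of "fps_nth g n"] by simp
    then have "nv (fps_nth (f + g) n) * \<rho> ^ n \<le> (nv (fps_nth f n) + nv (fps_nth g n)) * \<rho> ^ n"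
      using \<rho> by (intro mult_right_mono) auto
    then show "norm (nv (fps_nth (f + g) n) * \<rho> ^ n)
        \<le> nv (fps_nth f n) * \<rho> ^ n + nv (fps_nth g n) * \<rho> ^ n"
      using \<rho> by (simp add: nv_nonneg algebra_simps)
  qed
qed

text \<open>In degree at least \<open>2 * N\<close> each summand of the Cauchy product has one
  factor of index at least \<open>N\<close>, which is small, while the other factor is
  bounded.\<close>

lemma terms_mult_tendsto_0:
  assumes "(\<lambda>n. nv (fps_nth f n) * \<rho> ^ n) \<longlonglongrightarrow> 0" "(\<lambda>n. nv (fps_nth g n) * \<rho> ^ n) \<longlonglongrightarrow> 0" "0 \<le> \<rho>"
  shows "(\<lambda>n. nv (fps_nth (f * g) n) * \<rho> ^ n) \<longlonglongrightarrow> 0"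
proof (rule LIMSEQ_I)
  fix \<epsilon> :: real assume \<epsilon>: "0 < \<epsilon>"
  obtain A where A: "0 < A" "\<And>k. nv (fps_nth f k) * \<rho> ^ k \<le> A"
    using bounded_of_tendsto_0[OF assms(1)] by blast
  obtain B where B: "0 < B" "\<And>k. nv (fps_nth g k) * \<rho> ^ k \<le> B"
    using bounded_of_tendsto_0[OF assms(2)] by blast
  have "\<forall>\<^sub>F n in sequentially. nv (fps_nth f n) * \<rho> ^ n < \<epsilon> / B"
    using order_tendstoD(2)[OF assms(1)] \<epsilon> B by simp
  moreover have "\<forall>\<^sub>F n in sequentially. nv (fps_nth g n) * \<rho> ^ n < \<epsilon> / A"
    using order_tendstoD(2)[OF assms(2)] \<epsilon> A by simp
  ultimately have "\<forall>\<^sub>F n in sequentially. nv (fps_nth f n) * \<rho> ^ n < \<epsilon> / B \<and> nv (fps_nth g n) * \<rho> ^ n < \<epsilon> / A"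
    by eventually_elim simp
  then obtain N where N: "\<And>n. n \<ge> N \<Longrightarrow> nv (fps_nth f n) * \<rho> ^ n < \<epsilon> / B"
      "\<And>n. n \<ge> N \<Longrightarrow> nv (fps_nth g n) * \<rho> ^ n < \<epsilon> / A"
    unfolding eventually_sequentially by blast
  show "\<exists>no. \<forall>n\<ge>no. norm (nv (fps_nth (f * g) n) * \<rho> ^ n - 0) < \<epsilon>"
  proof (intro exI allI impI)
    fix n assume n: "n \<ge> 2 * N"
    have step: "nv (fps_nth f i * fps_nth g (n - i)) * \<rho> ^ n < \<epsilon>" if "i \<le> n" for i
    proof -
      have eq: "nv (fps_nth f i * fps_nth g (n - i)) * \<rho> ^ n =
          (nv (fps_nth f i) * \<rho> ^ i) * (nv (fps_nth g (n - i)) * \<rho> ^ (n - i))"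
        using that by (simp add: nv_mult mult_ac flip: power_add)
      show ?thesis
      proof (cases "i \<ge> N")
        case True
        have "(nv (fps_nth f i) * \<rho> ^ i) * (nv (fps_nth g (n - i)) * \<rho> ^ (n - i))
            \<le> (nv (fps_nth f i) * \<rho> ^ i) * B"
          using assms(3) by (intro mult_left_mono B) (simp add: nv_nonneg)
        also have "\<dots> < \<epsilon>"
          using N(1)[OF True] B by (simp add: field_simps)
        finally show ?thesis unfolding eq .
      next
        case False
        have "(nv (fps_nth f i) * \<rho> ^ i) * (nv (fps_nth g (n - i)) * \<rho> ^ (n - i))
            \<le> A * (nv (fps_nth g (n - i)) * \<rho> ^ (n - i))"
          using assms(3) by (intro mult_right_mono A) (simp add: nv_nonneg)
        also have "\<dots> < \<epsilon>"
          using N(2)[of "n - i"] False n A by (simp add: field_simps)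
        finally show ?thesis unfolding eq .
      qed
    qed
    have "nv (fps_nth (f * g) n) * \<rho> ^ n < \<epsilon>"
    proof (cases "\<rho> ^ n = 0")
      case False
      then have pos: "\<rho> ^ n > 0"
        using zero_le_power[OF assms(3), of n] by linarith
      have "nv (fps_nth (f * g) n) < \<epsilon> / \<rho> ^ n"
        unfolding fps_mult_nth using step pos \<epsilon>
        by (intro nv_sum_less) (auto simp: field_simps)
      then show ?thesis
        using pos by (simp add: field_simps)
    qed (use \<epsilon> in \<open>simp only: mult_zero_right\<close>)
    then show "norm (nv (fps_nth (f * g) n) * \<rho> ^ n - 0) < \<epsilon>"
      using assms(3) by (simp add: nv_nonneg)
  qed
qed

lemma disc_functions_mult:
  assumes "f \<in> disc_functions nv R" "g \<in> disc_functions nv R"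
  shows "f * g \<in> disc_functions nv R"
  using assms terms_mult_tendsto_0 by (auto simp: disc_functions_def)

text \<open>The partial sums of the Cauchy product run over a triangle, the products of partial sums
  over a square. On the difference \<open>?S - ?T\<close> one of the two indices is at least
  \<open>N\<close>, so every term there is small.\<close>

lemma fps_sums_to_mult:
  assumes f: "fps_sums_to nv f x s" and g: "fps_sums_to nv g x s'"
  shows "fps_sums_to nv (f * g) x (s * s')"
proof -
  define a where "a k = fps_nth f k * x ^ k" for k
  define b where "b k = fps_nth g k * x ^ k" for k
  have a0: "(\<lambda>k. nv (a k)) \<longlonglongrightarrow> 0" and b0: "(\<lambda>k. nv (b k)) \<longlonglongrightarrow> 0"
    using fps_sums_to_terms[OF f] fps_sums_to_terms[OF g] by (simp_all add: a_def b_def nv_mult nv_power)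
  obtain A where A: "0 < A" "\<And>k. nv (a k) \<le> A"
    using bounded_of_tendsto_0[OF a0] by blast
  obtain B where B: "0 < B" "\<And>k. nv (b k) \<le> B"
    using bounded_of_tendsto_0[OF b0] by blast
  have part: "(\<Sum>k<n. fps_nth (f * g) k * x ^ k) = (\<Sum>(i, j)\<in>{(i, j). i + j < n}. a i * b j)" for n
    unfolding sum.triangle_reindex fps_mult_nth sum_distrib_right a_def b_def
    by (intro sum.cong refl) (auto simp: mult_ac atMost_atLeast0 simp flip: power_add)
  have diff: "(\<lambda>n. nv ((\<Sum>k<n. fps_nth (f * g) k * x ^ k) - (\<Sum>i<n. a i) * (\<Sum>j<n. b j))) \<longlonglongrightarrow> 0"
  proof (rule LIMSEQ_I)
    fix \<epsilon> :: real assume \<epsilon>: "0 < \<epsilon>"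
    have "\<forall>\<^sub>F n in sequentially. nv (a n) < \<epsilon> / B" "\<forall>\<^sub>F n in sequentially. nv (b n) < \<epsilon> / A"
      using order_tendstoD(2)[OF a0] order_tendstoD(2)[OF b0] \<epsilon> A B by auto
    then have "\<forall>\<^sub>F n in sequentially. nv (a n) < \<epsilon> / B \<and> nv (b n) < \<epsilon> / A"
      by eventually_elim simp
    then obtain N where N: "\<And>n. n \<ge> N \<Longrightarrow> nv (a n) < \<epsilon> / B" "\<And>n. n \<ge> N \<Longrightarrow> nv (b n) < \<epsilon> / A"
      unfolding eventually_sequentially by blast
    show "\<exists>no. \<forall>n\<ge>no. norm (nv ((\<Sum>k<n. fps_nth (f * g) k * x ^ k) - (\<Sum>i<n. a i) * (\<Sum>j<n. b j)) - 0) < \<epsilon>"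
    proof (intro exI allI impI)
      fix n assume n: "n \<ge> 2 * N"
      let ?S = "{..<n} \<times> {..<n}" and ?T = "{(i, j). i + j < n}"
      have "(\<Sum>i<n. a i) * (\<Sum>j<n. b j) = (\<Sum>(i, j)\<in>?S. a i * b j)"
        by (simp add: sum_product sum.cartesian_product)
      also have "\<dots> = (\<Sum>(i, j)\<in>?S - ?T. a i * b j) + (\<Sum>(i, j)\<in>?T. a i * b j)"
        by (intro sum.subset_diff) auto
      finally have "(\<Sum>i<n. a i) * (\<Sum>j<n. b j) - (\<Sum>k<n. fps_nth (f * g) k * x ^ k)
          = (\<Sum>(i, j)\<in>?S - ?T. a i * b j)"
        unfolding part by simp
      moreover have "nv (\<Sum>(i, j)\<in>?S - ?T. a i * b j) < \<epsilon>"
      proof (rule nv_sum_less[OF \<epsilon>], clarsimp simp only: mem_Collect_eq Diff_iff mem_Sigma_iff case_prod_conv)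
        fix i j assume "\<not> i + j < n"
        then consider "i \<ge> N" | "j \<ge> N"
          using n by linarith
        then show "nv (a i * b j) < \<epsilon>"
        proof cases
          case 1
          have "nv (a i * b j) \<le> nv (a i) * B"
            unfolding nv_mult by (intro mult_left_mono B nv_nonneg)
          also have "\<dots> < \<epsilon>"
            using N(1)[OF 1] B by (simp add: field_simps)
          finally show ?thesis .
        next
          case 2
          have "nv (a i * b j) \<le> A * nv (b j)"
            unfolding nv_mult by (intro mult_right_mono A nv_nonneg)
          also have "\<dots> < \<epsilon>"
            using N(2)[OF 2] A by (simp add: field_simps)
          finally show ?thesis .
        qed
      qed
      ultimately show "norm (nv ((\<Sum>k<n. fps_nth (f * g) k * x ^ k) - (\<Sum>i<n. a i) * (\<Sum>j<n. b j)) - 0) < \<epsilon>"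
        using nv_minus_commute by (simp add: nv_nonneg)
    qed
  qed
  have "(\<lambda>n. nv (((\<Sum>k<n. fps_nth (f * g) k * x ^ k) - (\<Sum>i<n. a i) * (\<Sum>j<n. b j)
       + (\<Sum>i<n. a i) * (\<Sum>j<n. b j)) - (0 + s * s'))) \<longlonglongrightarrow> 0"
    using diff f g by (intro nv_limit_add nv_limit_mult) (simp_all add: fps_sums_to_iff a_def b_def)
  then show ?thesis
    unfolding fps_sums_to_iff by simp
qed

section \<open>Expansion at another centre\<close>

definition taylor_shift :: "'a \<Rightarrow> 'a fps \<Rightarrow> 'a fps" where
  "taylor_shift t f = Abs_fps (\<lambda>i. fps_value nv (hasse_deriv i f) t)"

text \<open>Binomial coefficients are integers, hence of absolute value at most 1; the shift of
  degree costs only the factor \<open>\<rho> ^ i\<close>. Dividing an ordinary derivative by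
  \<open>i!\<close> termwise would hide this.\<close>

lemma hasse_deriv_term_le:
  assumes "0 \<le> \<rho>" "nv (fps_nth f (k + i)) * \<rho> ^ (k + i) \<le> B"
  shows "nv (fps_nth (hasse_deriv i f) k) * \<rho> ^ k * \<rho> ^ i \<le> B"
proof -
  have "nv (fps_nth (hasse_deriv i f) k) * \<rho> ^ k * \<rho> ^ i
      \<le> nv (fps_nth f (k + i)) * (\<rho> ^ k * \<rho> ^ i)"
    unfolding mult.assoc hasse_deriv_def fps_nth_Abs_fps
    using assms(1) by (intro mult_right_mono nv_of_nat_mult_le) auto
  then show ?thesis
    using assms(2) by (simp add: power_add)
qed

lemma hasse_deriv_terms:
  assumes "(\<lambda>k. nv (fps_nth f k) * \<rho> ^ k) \<longlonglongrightarrow> 0" "0 \<le> \<rho>"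
  shows "(\<lambda>k. nv (fps_nth (hasse_deriv i f) k) * \<rho> ^ k) \<longlonglongrightarrow> 0"
proof (cases "\<rho> = 0")
  case True
  then show ?thesis
    by (intro tendsto_eventually eventually_sequentiallyI[of 1]) simp
next
  case False
  have "(\<lambda>k. nv (fps_nth f (k + i)) * \<rho> ^ (k + i) / \<rho> ^ i) \<longlonglongrightarrow> 0"
    using LIMSEQ_ignore_initial_segment[OF assms(1), of i] by (rule tendsto_divide_zero)
  then show ?thesis
  proof (rule Lim_null_comparison[rotated], intro always_eventually allI)
    fix k
    show "norm (nv (fps_nth (hasse_deriv i f) k) * \<rho> ^ k) \<le> nv (fps_nth f (k + i)) * \<rho> ^ (k + i) / \<rho> ^ i"
      using hasse_deriv_term_le[OF assms(2), of f k i] False assms(2) by (simp add: nv_nonneg field_simps)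
  qed
qed

lemma disc_functions_hasse_deriv:
  "f \<in> disc_functions nv R \<Longrightarrow> hasse_deriv i f \<in> disc_functions nv R"
  using hasse_deriv_terms by (auto simp: disc_functions_def)

end

context complete_valued_field
begin

lemma fps_sums_to_exists:
  assumes "(\<lambda>k. nv (fps_nth f k) * nv x ^ k) \<longlonglongrightarrow> 0"
  shows "\<exists>s. fps_sums_to nv f x s"
proof -
  interpret M: Metric_space UNIV "val_dist nv"
    by (rule Metric_space_val_dist)
  let ?S = "\<lambda>n. \<Sum>k<n. fps_nth f k * x ^ k"
  have "M.MCauchy ?S"
    unfolding M.MCauchy_def
  proof (intro conjI allI impI)
    fix \<epsilon> :: real assume \<epsilon>: "0 < \<epsilon>"
    obtain N where N: "\<And>k. k \<ge> N \<Longrightarrow> nv (fps_nth f k) * nv x ^ k < \<epsilon>"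
      using order_tendstoD(2)[OF assms \<epsilon>] unfolding eventually_sequentially by blast
    have *: "nv (?S m - ?S n) < \<epsilon>" if "N \<le> n" "n \<le> m" for m n
    proof -
      have "?S m - ?S n = (\<Sum>k\<in>{n..<m}. fps_nth f k * x ^ k)"
        using that by (simp add: lessThan_atLeast0 sum_diff_nat_ivl)
      then show ?thesis
        using N \<epsilon> that by (auto intro!: nv_sum_less simp: nv_mult nv_power)
    qed
    show "\<exists>N. \<forall>n n'. N \<le> n \<longrightarrow> N \<le> n' \<longrightarrow> val_dist nv (?S n) (?S n') < \<epsilon>"
      unfolding val_dist_def by (intro exI[of _ N]) (metis * nv_minus_commute nle_le)
  qed auto
  then obtain s where "limitin M.mtopology ?S s sequentially"
    using complete unfolding M.mcomplete_def by blast
  then show ?thesis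
    unfolding fps_sums_to_def val_topology_def by blast
qed

lemma fps_sums_to_value:
  assumes "(\<lambda>k. nv (fps_nth f k) * nv x ^ k) \<longlonglongrightarrow> 0"
  shows "fps_sums_to nv f x (fps_value nv f x)"
  using fps_sums_to_exists[OF assms] fps_value_eqI by metis

lemma disc_functions_sums:
  "f \<in> disc_functions nv R \<Longrightarrow> nv x < R \<Longrightarrow> fps_sums_to nv f x (fps_value nv f x)"
  by (rule fps_sums_to_value) (auto simp: disc_functions_def nv_nonneg)

text \<open>Cauchy's estimate on the closed disc of radius \<open>\<rho>\<close>, which has
  \<open>t\<close> as one of its centres. Only coefficients of index at least \<open>i\<close>
  contribute to the \<open>i\<close>-th divided derivative.\<close>

lemma taylor_shift_le:
  assumes "(\<lambda>k. nv (fps_nth f k) * \<rho> ^ k) \<longlonglongrightarrow> 0" "nv t \<le> \<rho>" 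
    "\<And>k. k \<ge> i \<Longrightarrow> nv (fps_nth f k) * \<rho> ^ k \<le> B"
  shows "nv (fps_nth (taylor_shift t f) i) * \<rho> ^ i \<le> B"
proof -
  have \<rho>: "0 \<le> \<rho>"
    using assms(2) nv_nonneg order_trans by blast
  have B: "0 \<le> B"
    using assms(3)[of i] \<rho> nv_nonneg[of "fps_nth f i"] by (meson mult_nonneg_nonneg order_refl order_trans zero_le_power)
  have le: "nv (fps_nth (hasse_deriv i f) k) * nv t ^ k \<le> nv (fps_nth (hasse_deriv i f) k) * \<rho> ^ k" for k
    using assms(2) by (intro mult_left_mono power_mono nv_nonneg)
  have sums: "fps_sums_to nv (hasse_deriv i f) t (fps_nth (taylor_shift t f) i)"
    unfolding taylor_shift_def fps_nth_Abs_fps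
    by (rule fps_sums_to_value, rule Lim_null_comparison[OF _ hasse_deriv_terms[OF assms(1) \<rho>, of i]])
      (use le in \<open>auto simp: nv_nonneg\<close>)
  show ?thesis
  proof (cases "\<rho> ^ i = 0")
    case False
    then have pos: "0 < \<rho> ^ i"
      using zero_le_power[OF \<rho>, of i] by linarith
    have "nv (fps_nth (hasse_deriv i f) k) * nv t ^ k \<le> B / \<rho> ^ i" for k
      using order_trans[OF mult_right_mono[OF le] hasse_deriv_term_le[OF \<rho>, of f k i B]] pos assms(3) 
      by (simp add: field_simps)
    from fps_sums_to_le[OF sums this] show ?thesis
      using pos by (simp add: field_simps)
  qed (use B in \<open>simp only: mult_zero_right\<close>)
qed

text \<open>Expanding \<open>(t + s) ^ k\<close> turns the \<open>n\<close>-th partial sum of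
  \<open>f\<close> into a triangular double sum. It differs from the partial sum of the new series,
  for each \<open>i\<close>, by a tail starting at index \<open>n - i\<close> of the divided
  derivative, hence only by terms built from coefficients of \<open>f\<close> of index at least
  \<open>n\<close>.\<close>

lemma fps_sums_to_taylor_shift:
  assumes f: "(\<lambda>k. nv (fps_nth f k) * \<rho> ^ k) \<longlonglongrightarrow> 0" and t: "nv t \<le> \<rho>" and s: "nv s \<le> \<rho>"
    and S: "fps_sums_to nv f (t + s) S"
  shows "fps_sums_to nv (taylor_shift t f) s S"
proof -
  have \<rho>: "0 \<le> \<rho>"
    using t nv_nonneg order_trans by blast
  define c where "c i j = of_nat ((j + i) choose i) * fps_nth f (j + i) * t ^ j * s ^ i" for i j
  have part: "(\<Sum>k<n. fps_nth f k * (t + s) ^ k) = (\<Sum>i<n. \<Sum>j<n - i. c i j)" for n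
  proof -
    have "(\<Sum>k<n. fps_nth f k * (t + s) ^ k) = (\<Sum>k<n. \<Sum>i\<le>k. c i (k - i))"
    proof (intro sum.cong refl)
      fix k
      have "(t + s) ^ k = (\<Sum>i\<le>k. of_nat (k choose i) * s ^ i * t ^ (k - i))"
        using binomial_ring[of s t k] by (simp add: add.commute)
      then show "fps_nth f k * (t + s) ^ k = (\<Sum>i\<le>k. c i (k - i))"
        by (simp only: sum_distrib_left, intro sum.cong refl) (simp add: c_def mult_ac)
    qed
    also have "\<dots> = (\<Sum>(i, j)\<in>{(i, j). i + j < n}. c i j)"
      by (rule sum.triangle_reindex[symmetric])
    also have "{(i, j). i + j < n} = Sigma {..<n} (\<lambda>i. {..<n - i})"
      by auto
    also have "(\<Sum>(i, j)\<in>\<dots>. c i j) = (\<Sum>i<n. \<Sum>j<n - i. c i j)"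
      by (rule sum.Sigma[symmetric]) auto
    finally show ?thesis .
  qed
  have diff: "(\<lambda>n. nv ((\<Sum>i<n. fps_nth (taylor_shift t f) i * s ^ i) - (\<Sum>k<n. fps_nth f k * (t + s) ^ k))) \<longlonglongrightarrow> 0"
  proof (rule LIMSEQ_I)
    fix \<epsilon> :: real assume \<epsilon>: "0 < \<epsilon>"
    obtain N where N: "\<And>k. k \<ge> N \<Longrightarrow> nv (fps_nth f k) * \<rho> ^ k < \<epsilon> / 2"
      using order_tendstoD(2)[OF f, of "\<epsilon> / 2"] \<epsilon> unfolding eventually_sequentially by auto
    show "\<exists>no. \<forall>n\<ge>no. norm (nv ((\<Sum>i<n. fps_nth (taylor_shift t f) i * s ^ i) - (\<Sum>k<n. fps_nth f k * (t + s) ^ k)) - 0) < \<epsilon>"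
    proof (intro exI allI impI)
      fix n assume n: "N \<le> n"
      have step: "nv (fps_nth (taylor_shift t f) i * s ^ i - (\<Sum>j<n - i. c i j)) \<le> \<epsilon> / 2" if "i < n" for i
      proof -
        let ?h = "hasse_deriv i f"
        have le: "nv (fps_nth ?h k) * nv t ^ k \<le> nv (fps_nth ?h k) * \<rho> ^ k" for k
          using t by (intro mult_left_mono power_mono nv_nonneg)
        have sums: "fps_sums_to nv ?h t (fps_nth (taylor_shift t f) i)"
          unfolding taylor_shift_def fps_nth_Abs_fps
          by (rule fps_sums_to_value, rule Lim_null_comparison[OF _ hasse_deriv_terms[OF f \<rho>, of i]])
            (use le in \<open>auto simp: nv_nonneg\<close>)
        have eq: "fps_nth (taylor_shift t f) i * s ^ i - (\<Sum>j<n - i. c i j)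
            = (fps_nth (taylor_shift t f) i - (\<Sum>j<n - i. fps_nth ?h j * t ^ j)) * s ^ i"
          by (simp add: left_diff_distrib sum_distrib_right c_def hasse_deriv_def)
        show ?thesis
        proof (cases "\<rho> ^ i = 0")
          case True
          then have "s ^ i = 0"
            using s nv_nonneg[of s] by (metis nv_eq_0_iff order_antisym power_eq_0_iff)
          then show ?thesis
            unfolding eq using \<epsilon> by (simp only: mult_zero_right nv_0)
        next
          case False
          then have pos: "0 < \<rho> ^ i"
            using zero_le_power[OF \<rho>, of i] by linarith
          have "nv (fps_nth (taylor_shift t f) i - (\<Sum>j<n - i. fps_nth ?h j * t ^ j)) \<le> \<epsilon> / 2 / \<rho> ^ i"
          proof (rule fps_sums_to_tail_le[OF sums])
            fix k assume "n - i \<le> k"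
            then have "N \<le> k + i"
              using n by simp
            then have "nv (fps_nth ?h k) * \<rho> ^ k * \<rho> ^ i \<le> \<epsilon> / 2"
              using N[of "k + i"] by (intro hasse_deriv_term_le \<rho>) simp
            from order_trans[OF mult_right_mono[OF le[of k] less_imp_le[OF pos]] this]
            show "nv (fps_nth ?h k) * nv t ^ k \<le> \<epsilon> / 2 / \<rho> ^ i"
              using pos by (simp add: field_simps)
          qed (use \<epsilon> pos in simp)
          then have "nv (fps_nth (taylor_shift t f) i - (\<Sum>j<n - i. fps_nth ?h j * t ^ j)) * nv s ^ i
              \<le> \<epsilon> / 2 / \<rho> ^ i * \<rho> ^ i"
            using s pos \<epsilon> by (intro mult_mono power_mono) (auto simp: nv_nonneg)
          then show ?thesis
            unfolding eq nv_mult nv_power by (metis False nonzero_divide_eq_eq)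
        qed
      qed
      have "nv (\<Sum>i<n. fps_nth (taylor_shift t f) i * s ^ i - (\<Sum>j<n - i. c i j)) \<le> \<epsilon> / 2"
        using step \<epsilon> by (intro nv_sum_le) auto
      then have "nv ((\<Sum>i<n. fps_nth (taylor_shift t f) i * s ^ i) - (\<Sum>k<n. fps_nth f k * (t + s) ^ k)) \<le> \<epsilon> / 2"
        unfolding part sum_subtractf .
      then show "norm (nv ((\<Sum>i<n. fps_nth (taylor_shift t f) i * s ^ i) - (\<Sum>k<n. fps_nth f k * (t + s) ^ k)) - 0) < \<epsilon>"
        using \<epsilon> by (simp add: nv_nonneg)
    qed
  qed
  show ?thesis
    using nv_limit_add[OF _ S[unfolded fps_sums_to_iff], of _ 0] diff
    unfolding fps_sums_to_iff by fastforce
qed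

text \<open>Identity theorem: close to 0 the lowest nonzero term dominates all others. The powers of
  \<open>\<pi>\<close> supply nonzero points arbitrarily close to 0, and convergence at
  \<open>x\<close> bounds the coefficients.\<close>

lemma fps_eq_0_if_sums_to_0:
  assumes conv: "fps_sums_to nv f x s" and "x \<noteq> 0" and small: "0 < nv \<pi>" "nv \<pi> < 1" and "0 < r"
    and zero: "\<And>y. nv y < r \<Longrightarrow> fps_sums_to nv f y 0"
  shows "f = 0"
proof (rule ccontr)
  assume "f \<noteq> 0"
  define m where "m = subdegree f"
  have m: "fps_nth f m \<noteq> 0" "\<And>k. k < m \<Longrightarrow> fps_nth f k = 0"
    using \<open>f \<noteq> 0\<close> by (auto simp: m_def)
  obtain B where B: "0 < B" "\<And>k. nv (fps_nth f k) * nv x ^ k \<le> B"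
    using bounded_of_tendsto_0[OF fps_sums_to_terms[OF conv]] by blast
  have x: "0 < nv x"
    using \<open>x \<noteq> 0\<close> by (simp add: nv_pos_iff)
  \<comment> \<open>The third bound is what makes the estimate
    \<open>B * (nv y / nv x) ^ Suc m\<close> of the remaining terms smaller than the term of degree
    \<open>m\<close> at \<open>y\<close>.\<close>
  define \<delta> where "\<delta> = min r (min (nv x) (nv (fps_nth f m) * nv x ^ Suc m / B))"
  have "0 < \<delta>"
    using m x B \<open>0 < r\<close> by (simp add: \<delta>_def nv_pos_iff)
  then obtain N where "nv \<pi> ^ N < \<delta>"
    using real_arch_pow_inv small by blast
  then obtain y where y: "0 < nv y" "nv y < \<delta>"
    using small by (metis nv_power zero_less_power)
  have "nv (0 - (\<Sum>k<Suc m. fps_nth f k * y ^ k)) \<le> B * (nv y / nv x) ^ Suc m"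
  proof (rule fps_sums_to_tail_le)
    show "fps_sums_to nv f y 0"
      using y by (intro zero) (simp add: \<delta>_def)
    fix k assume k: "Suc m \<le> k"
    have "nv (fps_nth f k) * nv y ^ k = (nv (fps_nth f k) * nv x ^ k) * (nv y / nv x) ^ k"
      using x by (simp add: power_divide)
    also have "\<dots> \<le> B * (nv y / nv x) ^ Suc m"
      using B y x k by (intro mult_mono power_decreasing) (auto simp: \<delta>_def nv_nonneg)
    finally show "nv (fps_nth f k) * nv y ^ k \<le> B * (nv y / nv x) ^ Suc m" .
  qed (use B in \<open>simp add: nv_nonneg\<close>)
  moreover have "(\<Sum>k<Suc m. fps_nth f k * y ^ k) = fps_nth f m * y ^ m"
    using m(2) by simp
  ultimately have "nv (fps_nth f m) * nv y ^ m \<le> B * (nv y / nv x) ^ Suc m"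
    by (simp add: nv_minus nv_mult nv_power)
  then have "nv (fps_nth f m) * nv x ^ Suc m * nv y ^ m \<le> B * nv y * nv y ^ m"
    using x by (simp add: power_divide field_simps)
  then have "nv (fps_nth f m) * nv x ^ Suc m \<le> B * nv y"
    using y(1) by (simp add: mult_le_cancel_right)
  moreover have "B * nv y < nv (fps_nth f m) * nv x ^ Suc m"
    using y(2) B by (simp add: \<delta>_def field_simps)
  ultimately show False
    by simp
qed

end

section \<open>Congruences between finite sums and products\<close>

context valued_field
begin

text \<open>Working on the disc \<open>nv y < 1\<close> with a quadratic error makes the class of these functions
  closed under products, so that the derivative \<open>c\<close> can be tracked by the product rule.\<close>

definition quadratic_approx :: "('a \<Rightarrow> 'a) \<Rightarrow> 'a \<Rightarrow> bool" where
  "quadratic_approx f c \<longleftrightarrow> nv (f 0) \<le> 1 \<and> nv c \<le> 1 \<and>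
     (\<forall>y. nv y < 1 \<longrightarrow> nv (f y - f 0 - c * y) \<le> nv y ^ 2)"

lemma nv_mult_le_1: "nv x \<le> 1 \<Longrightarrow> nv y \<le> 1 \<Longrightarrow> nv (x * y) \<le> 1"
  by (simp add: nv_mult mult_le_one nv_nonneg)

lemma nv_mult_le_left: "nv x \<le> 1 \<Longrightarrow> nv (x * y) \<le> nv y"
  by (simp add: nv_mult mult_left_le_one_le nv_nonneg)

lemma quadratic_approx_bound:
  assumes "quadratic_approx f c" "nv y < 1"
  shows "nv (f 0 + c * y) \<le> 1" "nv (f y) \<le> 1"
proof -
  have "nv (c * y) \<le> 1" "nv y ^ 2 \<le> 1"
    using assms nv_mult_le_1[of c y, OF _ less_imp_le] power_le_one[OF nv_nonneg[of y] less_imp_le, of 2]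
    by (simp_all only: quadratic_approx_def)
  then show *: "nv (f 0 + c * y) \<le> 1"
    using assms by (intro nv_add_le) (auto simp: quadratic_approx_def)
  have "nv ((f y - f 0 - c * y) + (f 0 + c * y)) \<le> 1"
    using assms \<open>nv y ^ 2 \<le> 1\<close> by (intro nv_add_le[OF _ *]) (auto simp: quadratic_approx_def intro: order_trans)
  then show "nv (f y) \<le> 1"
    by simp
qed

lemma quadratic_approx_const: "nv a \<le> 1 \<Longrightarrow> quadratic_approx (\<lambda>_. a) 0"
  by (simp add: quadratic_approx_def)

lemma quadratic_approx_translate: "nv a \<le> 1 \<Longrightarrow> quadratic_approx (\<lambda>y. a + y) 1"
  by (simp add: quadratic_approx_def nv_1)

text \<open>The remainder of 1/(a + y) after its linear part is exactly y^2 / (a^2 (a + y)), and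
  \<open>a + y\<close> is again a unit.\<close>

lemma quadratic_approx_inverse:
  assumes "nv a = 1"
  shows "quadratic_approx (\<lambda>y. inverse (a + y)) (- (inverse a ^ 2))"
  unfolding quadratic_approx_def
proof (intro conjI allI impI)
  fix y assume y: "nv y < 1"
  then have ay: "nv (a + y) = 1"
    using assms nv_add_eq_right[of y a] by (simp add: add.commute)
  then have "a \<noteq> 0" "a + y \<noteq> 0"
    using assms nv_0 by (metis zero_neq_one)+
  then have "inverse a - inverse (a + y) = inverse a * inverse (a + y) * y"
    using inverse_diff_inverse[of a "a + y"] by (simp add: mult_ac)
  moreover have "j - i - - (i ^ 2) * y = y ^ 2 * (i ^ 2 * j)" if eq: "i - j = i * j * y" for i j :: 'a
  proof -
    have "j - i - - (i ^ 2) * y = - (i - j) + i * i * y"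
      by (simp add: power2_eq_square)
    also have "\<dots> = (i - j) * (i * y)"
      by (subst eq) (simp add: algebra_simps)
    also have "\<dots> = y ^ 2 * (i ^ 2 * j)"
      unfolding eq by (simp add: power2_eq_square mult_ac)
    finally show ?thesis .
  qed
  ultimately have "inverse (a + y) - inverse (a + 0) - - (inverse a ^ 2) * y = y ^ 2 * (inverse a ^ 2 * inverse (a + y))"
    by (metis add_0_right)
  then show "nv (inverse (a + y) - inverse (a + 0) - - (inverse a ^ 2) * y) \<le> nv y ^ 2"
    by (simp add: nv_mult nv_power nv_inverse assms ay)
qed (simp_all add: nv_minus nv_inverse nv_power assms)

lemma quadratic_approx_mult:
  assumes f: "quadratic_approx f c" and g: "quadratic_approx g d"
  shows "quadratic_approx (\<lambda>y. f y * g y) (c * g 0 + f 0 * d)"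
  unfolding quadratic_approx_def
proof (intro conjI allI impI)
  show "nv (f 0 * g 0) \<le> 1" "nv (c * g 0 + f 0 * d) \<le> 1"
    using f g by (auto simp: quadratic_approx_def intro!: nv_add_le nv_mult_le_1)
  fix y assume y: "nv y < 1"
  have "f y * g y - f 0 * g 0 - (c * g 0 + f 0 * d) * y
      = (g y * (f y - f 0 - c * y) + (f 0 + c * y) * (g y - g 0 - d * y)) + (c * d) * (y * y)"
    by (simp add: algebra_simps)
  moreover have "nv (g y * (f y - f 0 - c * y)) \<le> nv y ^ 2"
    using nv_mult_le_left[OF quadratic_approx_bound(2)[OF g y], of "f y - f 0 - c * y"] f y
    by (meson order_trans quadratic_approx_def)
  moreover have "nv ((f 0 + c * y) * (g y - g 0 - d * y)) \<le> nv y ^ 2"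
    using nv_mult_le_left[OF quadratic_approx_bound(1)[OF f y], of "g y - g 0 - d * y"] g y
    by (meson order_trans quadratic_approx_def)
  moreover have "nv ((c * d) * (y * y)) \<le> nv y ^ 2"
    using nv_mult_le_left[of "c * d" "y * y"] nv_mult_le_1[of c d] f g
    by (simp add: quadratic_approx_def nv_mult power2_eq_square)
  ultimately show "nv (f y * g y - f 0 * g 0 - (c * g 0 + f 0 * d) * y) \<le> nv y ^ 2"
    by (simp add: nv_add_le)
qed

lemma quadratic_approx_scale:
  assumes "quadratic_approx f c" "nv a \<le> 1"
  shows "quadratic_approx (\<lambda>y. f (a * y)) (c * a)"
  unfolding quadratic_approx_def
proof (intro conjI allI impI)
  show "nv (f (a * 0)) \<le> 1" "nv (c * a) \<le> 1"
    using assms by (auto simp: quadratic_approx_def intro: nv_mult_le_1)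
  fix y assume y: "nv y < 1"
  have ay: "nv (a * y) \<le> nv y"
    by (rule nv_mult_le_left) (rule assms(2))
  then have "nv (f (a * y) - f 0 - c * (a * y)) \<le> nv (a * y) ^ 2"
    using assms(1) y by (auto simp: quadratic_approx_def)
  also have "\<dots> \<le> nv y ^ 2"
    using ay by (intro power_mono) (auto simp: nv_nonneg)
  finally show "nv (f (a * y) - f (a * 0) - c * a * y) \<le> nv y ^ 2"
    by (simp add: mult.assoc)
qed

lemma quadratic_approx_sum:
  assumes "\<And>i. i \<in> A \<Longrightarrow> quadratic_approx (f i) (c i)"
  shows "quadratic_approx (\<lambda>y. \<Sum>i\<in>A. f i y) (\<Sum>i\<in>A. c i)"
  unfolding quadratic_approx_def
proof (intro conjI allI impI)
  show "nv (\<Sum>i\<in>A. f i 0) \<le> 1" "nv (\<Sum>i\<in>A. c i) \<le> 1"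
    using assms by (auto simp: quadratic_approx_def intro!: nv_sum_le)
  fix y assume y: "nv y < 1"
  have "nv (\<Sum>i\<in>A. f i y - f i 0 - c i * y) \<le> nv y ^ 2"
    using assms y by (intro nv_sum_le) (auto simp: quadratic_approx_def)
  then show "nv ((\<Sum>i\<in>A. f i y) - (\<Sum>i\<in>A. f i 0) - (\<Sum>i\<in>A. c i) * y) \<le> nv y ^ 2"
    by (simp add: sum_subtractf sum_distrib_right)
qed

lemma quadratic_approx_prod:
  assumes "finite A" "\<And>i. i \<in> A \<Longrightarrow> \<exists>c. quadratic_approx (f i) c"
  shows "\<exists>c. quadratic_approx (\<lambda>y. \<Prod>i\<in>A. f i y) c"
  using assms
proof (induction A rule: finite_induct)
  case empty
  show ?case
    using quadratic_approx_const[of 1] nv_1 by auto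
next
  case (insert a A)
  then obtain c d where "quadratic_approx (f a) c" "quadratic_approx (\<lambda>y. \<Prod>i\<in>A. f i y) d"
    by (meson insertCI)
  from quadratic_approx_mult[OF this] show ?case
    using insert.hyps by auto
qed

lemma quadratic_approx_power:
  assumes "\<exists>c. quadratic_approx f c"
  shows "\<exists>c. quadratic_approx (\<lambda>y. f y ^ k) c"
  using quadratic_approx_prod[of "{..<k}" "\<lambda>_. f"] assms by simp

text \<open>The product rule adds up the slopes \<open>a * c\<close>. For \<open>m = p\<close> the
  linear coefficient thus contains the sum of all residues, a multiple of an odd
  \<open>p\<close>.\<close>

lemma quadratic_approx_prod_scale:
  assumes "quadratic_approx f c"
  shows "quadratic_approx (\<lambda>y. \<Prod>a<m. f (of_nat a * y)) (of_nat (\<Sum>a<m. a) * (c * f 0 ^ (m - 1)))"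
proof (induction m)
  case 0
  show ?case
    using quadratic_approx_const[of 1] nv_1 by simp
next
  case (Suc m)
  have "of_nat (\<Sum>a<m. a) * (c * f 0 ^ (m - 1)) * f 0 + (\<Prod>a<m. f (of_nat a * 0)) * (c * of_nat m)
      = of_nat (\<Sum>a<Suc m. a) * (c * f 0 ^ (Suc m - 1))"
    by (cases m) (simp_all add: algebra_simps)
  then show ?case
    using quadratic_approx_mult[OF Suc quadratic_approx_scale[OF assms nv_of_nat_le_1[of m]]] by simp
qed

lemma quadratic_approx_power_nat:
  assumes "quadratic_approx f c"
  shows "quadratic_approx (\<lambda>y. f y ^ m) (of_nat m * (c * f 0 ^ (m - 1)))"
proof (induction m)
  case 0
  show ?case
    using quadratic_approx_const[of 1] nv_1 by simp
next
  case (Suc m)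
  have "c * f 0 ^ m + f 0 * (of_nat m * (c * f 0 ^ (m - 1))) = of_nat (Suc m) * (c * f 0 ^ (Suc m - 1))"
    by (cases m) (simp_all add: algebra_simps)
  then show ?case
    using quadratic_approx_mult[OF assms Suc] by simp
qed

end

context padic_numbers
begin

lemma p_gt_1: "1 < p"
  using prime_p by (rule prime_gt_1_nat)

lemma odd_p: "p \<noteq> 2 \<Longrightarrow> odd p"
  using prime_p prime_odd_nat p_gt_1 by (metis One_nat_def Suc_lessI numeral_2_eq_2)

lemma nv_p: "nv (of_nat p) = 1 / real p"
  using nv_of_int[of "int p"] p_gt_1 prime_p by simp

lemma nv_p_power: "nv (of_nat p ^ n) = (1 / real p) ^ n"
  by (simp only: nv_power nv_p)

lemma nv_of_int_unit:
  assumes "\<not> int p dvd m"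
  shows "nv (of_int m) = 1"
proof -
  have "m \<noteq> 0"
    using assms by auto
  then show ?thesis
    using nv_of_int[of m] assms by (simp add: not_dvd_imp_multiplicity_0)
qed

lemma nv_of_nat_unit: "\<not> p dvd n \<Longrightarrow> nv (of_nat n) = 1"
  using nv_of_int_unit[of "int n"] by simp

lemma nv_of_nat_multiple: "p dvd n \<Longrightarrow> nv (of_nat n) \<le> 1 / real p"
  using nv_of_nat_dvd_le[of p n] by (simp add: nv_p)

lemma nv_of_int_multiple:
  assumes "int p dvd m"
  shows "nv (of_int m) \<le> 1 / real p"
proof -
  have "of_nat (nat \<bar>m\<bar>) = of_int m \<or> of_nat (nat \<bar>m\<bar>) = (- of_int m :: 'k)"
    by (cases "0 \<le> m") (auto simp: abs_if)
  then have "nv (of_int m) = nv (of_nat (nat \<bar>m\<bar>))"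
    by (metis nv_minus)
  moreover have "p dvd nat \<bar>m\<bar>"
    using assms by (metis dvd_abs_iff int_dvd_int_iff int_nat_eq abs_ge_zero)
  ultimately show ?thesis
    using nv_of_nat_multiple by metis
qed

lemma nv_cong:
  assumes "[a = b] (mod p)"
  shows "nv (of_nat a - of_nat b) \<le> 1 / real p"
proof -
  have "int p dvd int a - int b"
    using assms by (metis cong_iff_dvd_diff cong_int_iff)
  from nv_of_int_multiple[OF this] show ?thesis
    by simp
qed

lemma nv_not_cong:
  assumes "\<not> [a = b] (mod p)"
  shows "nv (of_nat a - of_nat b) = 1"
proof -
  have "\<not> int p dvd int a - int b"
    using assms by (metis cong_iff_dvd_diff cong_int_iff)
  from nv_of_int_unit[OF this] show ?thesis
    by simp
qed

lemma nv_inverse_power_cong: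
  assumes "[a = b] (mod p)" "\<not> p dvd a" 
  shows "nv (inverse (of_nat a) ^ k - inverse (of_nat b) ^ k) \<le> 1 / real p"
proof -
  have "\<not> p dvd b"
    using assms cong_dvd_iff by blast
  then have nv: "nv (of_nat a) = 1" "nv (of_nat b) = 1"
    using assms nv_of_nat_unit by auto
  then have "of_nat a \<noteq> (0 :: 'k)" "of_nat b \<noteq> (0 :: 'k)"
    by (metis nv_0 zero_neq_one)+
  then have "inverse (of_nat a) ^ k - inverse (of_nat b) ^ k
      = (of_nat (b ^ k) - of_nat (a ^ k)) * (inverse (of_nat a) ^ k * inverse (of_nat b) ^ k :: 'k)"
    by (simp add: field_simps)
  then have "nv (inverse (of_nat a) ^ k - inverse (of_nat b) ^ k) = nv (of_nat (b ^ k) - of_nat (a ^ k))"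
    by (simp add: nv_mult nv_power nv_inverse nv)
  also have "\<dots> \<le> 1 / real p"
    using assms(1) by (intro nv_cong cong_pow) (rule cong_sym)
  finally show ?thesis .
qed

section \<open>Sums and products over the residues prime to p below p^N\<close>

definition units_below :: "nat \<Rightarrow> nat set" where
  "units_below N = {j. j < p ^ N \<and> \<not> p dvd j}"

definition power_sum :: "nat \<Rightarrow> nat \<Rightarrow> 'k" where
  "power_sum N k = (\<Sum>j\<in>units_below N. inverse (of_nat j) ^ k)"

lemma finite_units_below [simp]: "finite (units_below N)"
  by (rule finite_subset[of _ "{..<p ^ N}"]) (auto simp: units_below_def)

lemma nv_units_below: "j \<in> units_below N \<Longrightarrow> nv (of_nat j) = 1"
  by (auto simp: units_below_def intro: nv_of_nat_unit)

text \<open>Splitting off the top base-p digit. \<open>1 \<le> N\<close> makes \<open>p\<close>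
  divide \<open>p ^ N\<close>, so adding \<open>a * p ^ N\<close> does not affect divisibility by
  \<open>p\<close>.\<close>

lemma bij_betw_units_below_Suc:
  assumes "1 \<le> N"
  shows "bij_betw (\<lambda>(j, a). j + a * p ^ N) (units_below N \<times> {..<p}) (units_below (Suc N))"
proof (rule bij_betw_byWitness[where f' = "\<lambda>j. (j mod p ^ N, j div p ^ N)"])
  have dvd: "p dvd p ^ N"
    using assms by (simp add: dvd_power)
  have pos: "0 < p ^ N"
    using p_gt_1 by simp
  show "\<forall>x\<in>units_below N \<times> {..<p}. ((case x of (j, a) \<Rightarrow> j + a * p ^ N) mod p ^ N,
      (case x of (j, a) \<Rightarrow> j + a * p ^ N) div p ^ N) = x"
    using pos by (auto simp: units_below_def)
  show "\<forall>j\<in>units_below (Suc N). (case (j mod p ^ N, j div p ^ N) of (j, a) \<Rightarrow> j + a * p ^ N) = j"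
    by (simp add: mod_mult_div_eq mult.commute mod_div_mult_eq)
  show "(\<lambda>(j, a). j + a * p ^ N) ` (units_below N \<times> {..<p}) \<subseteq> units_below (Suc N)"
  proof (clarsimp simp: units_below_def)
    fix j a assume *: "j < p ^ N" "\<not> p dvd j" "a < p"
    have "j + a * p ^ N < p ^ N + a * p ^ N"
      using * by simp
    also have "\<dots> = Suc a * p ^ N"
      by simp
    also have "\<dots> \<le> p * p ^ N"
      using * by (intro mult_right_mono) auto
    finally show "j + a * p ^ N < p * p ^ N \<and> \<not> p dvd j + a * p ^ N"
      using * dvd by (simp add: dvd_add_left_iff)
  qed
  show "(\<lambda>j. (j mod p ^ N, j div p ^ N)) ` units_below (Suc N) \<subseteq> units_below N \<times> {..<p}"
    using pos dvd by (auto simp: units_below_def dvd_mod_iff less_mult_imp_div_less)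
qed

text \<open>The sum is p(p - 1)/2, so oddness of \<open>p\<close> is essential; this cancels the
  linear terms when passing from \<open>p ^ N\<close> to \<open>p ^ Suc N\<close>.\<close>

lemma p_dvd_gauss_sum:
  assumes "p \<noteq> 2"
  shows "p dvd (\<Sum>a<p. a)"
proof -
  have "coprime p 2"
    using odd_p[OF assms] by simp
  have "(\<Sum>a<p. a) * 2 = p * (p - 1)"
    using gauss_sum_nat[of "p - 1"] p_gt_1 by (simp add: lessThan_Suc_atMost[symmetric] atLeast0AtMost)
  then have "p dvd (\<Sum>a<p. a) * 2"
    by simp
  then show ?thesis
    using \<open>coprime p 2\<close> by (simp add: coprime_dvd_mult_left_iff)
qed

text \<open>The gain of a factor \<open>p\<close> over \<open>nv h\<close>: the linear term has it
  because \<open>p\<close> divides \<open>m\<close>, the quadratic error because \<open>p\<close>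
  divides \<open>h\<close>.\<close>

lemma quadratic_approx_increment:
  assumes "quadratic_approx f (of_nat m * d)" "p dvd m" "nv d \<le> 1" "nv h \<le> 1 / real p"
  shows "nv (f h - f 0) \<le> nv h / real p"
proof -
  have "nv h < 1"
    using assms(4) p_gt_1 by (auto intro: le_less_trans)
  have "nv (f h - f 0 - of_nat m * d * h) \<le> nv h ^ 2"
    using assms(1) \<open>nv h < 1\<close> by (auto simp: quadratic_approx_def)
  also have "\<dots> \<le> nv h / real p"
    using mult_left_mono[OF assms(4) nv_nonneg[of h]] by (simp add: power2_eq_square)
  finally have 1: "nv (f h - f 0 - of_nat m * d * h) \<le> nv h / real p" .
  have "nv (of_nat m * d * h) = nv (of_nat m) * nv d * nv h"
    by (simp add: nv_mult)
  also have "\<dots> \<le> 1 / real p * 1 * nv h"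
    using nv_of_nat_multiple[OF assms(2)] assms(3) by (intro mult_mono) (auto simp: nv_nonneg)
  finally have 2: "nv (of_nat m * d * h) \<le> nv h / real p"
    by simp
  show ?thesis
    using nv_add_le[OF 1 2] by simp
qed

text \<open>Each unit \<open>j\<close> has the \<open>p\<close> lifts \<open>j + a * p ^ N\<close>.
  Summed over \<open>a\<close>, their linear terms add up to a multiple of \<open>p\<close>, so each
  \<open>j\<close> contributes an error divisible by one more power of \<open>p\<close> than
  \<open>p ^ N\<close>.\<close>

lemma power_sum_Suc:
  assumes "p \<noteq> 2" "1 \<le> N"
  shows "nv (power_sum (Suc N) k - of_nat p * power_sum N k) \<le> (1 / real p) ^ Suc N"
proof -
  let ?h = "of_nat p ^ N :: 'k"
  have h: "nv ?h \<le> 1 / real p"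
    unfolding nv_p_power using assms(2) p_gt_1 power_decreasing[of 1 N "1 / real p"] by simp
  have "power_sum (Suc N) k = (\<Sum>(j, a)\<in>units_below N \<times> {..<p}. inverse (of_nat (j + a * p ^ N)) ^ k)"
    unfolding power_sum_def
    by (subst sum.reindex_bij_betw[OF bij_betw_units_below_Suc[OF assms(2)], symmetric])
      (simp add: case_prod_unfold)
  also have "\<dots> = (\<Sum>j\<in>units_below N. \<Sum>a<p. inverse (of_nat j + of_nat a * ?h) ^ k)"
    by (simp add: sum.cartesian_product)
  finally have eq: "power_sum (Suc N) k - of_nat p * power_sum N k
      = (\<Sum>j\<in>units_below N. (\<Sum>a<p. inverse (of_nat j + of_nat a * ?h) ^ k) - of_nat p * inverse (of_nat j) ^ k)"
    by (simp add: power_sum_def sum_subtractf sum_distrib_left)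
  show ?thesis
    unfolding eq
  proof (rule nv_sum_le)
    fix j assume j: "j \<in> units_below N"
    let ?f = "\<lambda>y. inverse (of_nat j + y) ^ k"
    obtain c where c: "quadratic_approx ?f c"
      using quadratic_approx_power[of "\<lambda>y. inverse (of_nat j + y)" k]
        quadratic_approx_inverse[OF nv_units_below[OF j]] by blast
    have "quadratic_approx (\<lambda>y. \<Sum>a<p. ?f (of_nat a * y)) (\<Sum>a<p. c * of_nat a)"
      by (intro quadratic_approx_sum quadratic_approx_scale c nv_of_nat_le_1)
    then have "quadratic_approx (\<lambda>y. \<Sum>a<p. ?f (of_nat a * y)) (of_nat (\<Sum>a<p. a) * c)"
      by (simp add: sum_distrib_left mult.commute)
    from quadratic_approx_increment[OF this p_dvd_gauss_sum[OF assms(1)] _ h] c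
    have "nv ((\<Sum>a<p. ?f (of_nat a * ?h)) - of_nat p * inverse (of_nat j) ^ k) \<le> nv ?h / real p"
      by (simp add: quadratic_approx_def)
    then show "nv ((\<Sum>a<p. inverse (of_nat j + of_nat a * ?h) ^ k) - of_nat p * inverse (of_nat j) ^ k)
        \<le> (1 / real p) ^ Suc N"
      by (simp add: nv_p_power[simplified])
  qed (use p_gt_1 in simp)
qed

text \<open>After division by \<open>p ^ Suc N\<close> each step of the previous congruence changes
  the quotient by an integral element, and such changes do not accumulate.\<close>

lemma power_sum_scaled:
  assumes "p \<noteq> 2" "1 \<le> N"
  shows "nv (power_sum N k / of_nat p ^ N - power_sum 1 k / of_nat p) \<le> 1"
  using assms(2)
proof (induction N rule: nat_induct_at_least)
  case (Suc N)
  have p0: "of_nat p \<noteq> (0 :: 'k)"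
    using p_gt_1 by simp
  have "nv (power_sum (Suc N) k / of_nat p ^ Suc N - power_sum N k / of_nat p ^ N)
      = nv ((power_sum (Suc N) k - of_nat p * power_sum N k) / of_nat p ^ Suc N)"
    using p0 by (simp add: diff_divide_distrib)
  also have "\<dots> = nv (power_sum (Suc N) k - of_nat p * power_sum N k) / (1 / real p) ^ Suc N"
    by (simp only: nv_divide nv_p_power)
  also have "\<dots> \<le> 1"
    using power_sum_Suc[OF assms(1) Suc.hyps, of k] p_gt_1 by (subst divide_le_eq_1_pos) auto
  finally show ?case
    using Suc.IH nv_dist_trans by blast
qed (simp add: nv_nonneg)

text \<open>Let W_N be the product of the units below \<open>p ^ N\<close>. Grouping the lifts by
  their top digit \<open>a\<close> gives W_(N+1) = W_N^p modulo \<open>p ^ Suc N\<close>, and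
  raising W_N = -1 modulo \<open>p ^ N\<close> to the \<open>p\<close>-th power gains one factor
  \<open>p\<close>. Wilson's theorem starts the induction.\<close>

lemma unit_product_cong:
  assumes "p \<noteq> 2" "1 \<le> N"
  shows "nv ((\<Prod>j\<in>units_below N. of_nat j) + 1) \<le> (1 / real p) ^ N"
  using assms(2)
proof (induction N rule: nat_induct_at_least)
  case base
  have "units_below 1 = {1..p - 1}"
    using p_gt_1 by (auto simp: units_below_def Suc_le_eq dest: dvd_imp_le intro: Nat.gr0I)
  then have "(\<Prod>j\<in>units_below 1. of_nat j) = (of_int (fact (p - 1)) :: 'k)"
    by (simp add: fact_prod)
  then have "(\<Prod>j\<in>units_below 1. of_nat j) + 1 = (of_int (fact (p - 1) - (- 1)) :: 'k)"
    by simp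
  moreover have "int p dvd fact (p - 1) - (- 1)"
    using wilson_theorem[OF prime_p] by (simp only: cong_iff_dvd_diff)
  ultimately show ?case
    using nv_of_int_multiple by (metis power_one_right)
next
  case (Suc N)
  let ?h = "of_nat p ^ N :: 'k" and ?W = "\<lambda>N. \<Prod>j\<in>units_below N. of_nat j :: 'k"
  have small: "(1 / real p) ^ N \<le> 1 / real p"
    using Suc.hyps p_gt_1 power_decreasing[of 1 N "1 / real p"] by simp
  let ?f = "\<lambda>y. \<Prod>j\<in>units_below N. of_nat j + y"
  obtain c where c: "quadratic_approx ?f c"
    using quadratic_approx_prod[of "units_below N" "\<lambda>j y. of_nat j + y"]
      quadratic_approx_translate[OF nv_of_nat_le_1] by auto
  have "?W (Suc N) = (\<Prod>(j, a)\<in>units_below N \<times> {..<p}. of_nat (j + a * p ^ N))"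
    by (subst prod.reindex_bij_betw[OF bij_betw_units_below_Suc[OF Suc.hyps], symmetric])
      (simp add: case_prod_unfold)
  also have "\<dots> = (\<Prod>j\<in>units_below N. \<Prod>a<p. of_nat j + of_nat a * ?h)"
    by (simp add: prod.cartesian_product)
  also have "\<dots> = (\<Prod>a<p. ?f (of_nat a * ?h))"
    by (rule prod.swap)
  finally have W: "?W (Suc N) = (\<Prod>a<p. ?f (of_nat a * ?h))" .
  have "nv (c * ?f 0 ^ (p - 1)) \<le> 1"
    using c by (auto simp: quadratic_approx_def nv_power intro!: nv_mult_le_1 power_le_one nv_nonneg)
  from quadratic_approx_increment[OF quadratic_approx_prod_scale[OF c] p_dvd_gauss_sum[OF assms(1)] this, of ?h]
  have 1: "nv (?W (Suc N) - ?W N ^ p) \<le> (1 / real p) ^ Suc N"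
    using small unfolding W nv_p_power by simp
  have m1: "nv (- 1) \<le> 1"
    by (simp add: nv_minus nv_1)
  have IH: "nv (?W N + 1) \<le> (1 / real p) ^ N"
    by (rule Suc.IH)
  \<comment> \<open>The function is now (-1 + y)^p at y = W_N + 1; its linear coefficient is a
    multiple of its exponent \<open>p\<close>.\<close>
  have "nv (1 * (- 1 + 0) ^ (p - 1)) \<le> 1"
    by (simp add: nv_power nv_minus nv_1)
  from quadratic_approx_increment[OF quadratic_approx_power_nat[OF quadratic_approx_translate[OF m1], of p] _ this,
      of "?W N + 1"]
  have "nv (?W N ^ p - (- 1) ^ p) \<le> nv (?W N + 1) / real p"
    using order_trans[OF IH small] by simp
  also have "\<dots> \<le> (1 / real p) ^ N / real p"
    using IH by (intro divide_right_mono) auto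
  finally have 2: "nv (?W N ^ p - (- 1) ^ p) \<le> (1 / real p) ^ Suc N"
    by simp
  show ?case
    using nv_dist_trans[OF 1 2] odd_p[OF assms(1)] by simp
qed

text \<open>Powers of a primitive root turn the sum, modulo \<open>p\<close>, into a geometric sum
  with ratio \<open>q\<close>. If \<open>q\<close> is 1 modulo \<open>p\<close>, every term is 1 and
  the sum is \<open>p - 1\<close>; otherwise 1 - q is a unit while (1 - q) times the sum is 1 -
  q^(p-1), a multiple of \<open>p\<close>.\<close>

lemma power_sum_1:
  assumes "1 \<le> k"
  shows "(p - 1) dvd k \<Longrightarrow> nv (power_sum 1 k) = 1"
    and "\<not> (p - 1) dvd k \<Longrightarrow> nv (power_sum 1 k) \<le> 1 / real p"
proof -
  have U: "units_below 1 = totatives p"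
    using p_gt_1 prime_p
    by (auto simp: units_below_def totatives_def coprime_commute[of _ p] prime_imp_coprime
        intro: Nat.gr0I le_neq_implies_less dest: coprime_absorb_left)
  obtain g where g: "residue_primroot p g"
    using prime_primitive_root_exists[of p] prime_p p_gt_1 by auto
  then have cop: "coprime p g" and ordg: "ord p g = p - 1"
    using prime_p by (auto simp: residue_primroot_def totient_prime)
  have gu: "\<not> p dvd g"
    using cop p_gt_1 by (metis coprime_absorb_left nat_dvd_1_iff_1 less_irrefl)
  have gi: "\<not> p dvd g ^ i mod p" for i
    using gu prime_p by (simp add: dvd_mod_iff prime_dvd_power_iff) (metis prime_dvd_power)
  define q where "q = inverse (of_nat g :: 'k) ^ k"
  have q1: "nv q = 1"
    by (simp add: q_def nv_power nv_inverse nv_of_nat_unit[OF gu])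
  have "power_sum 1 k = (\<Sum>i<p - 1. inverse (of_nat (g ^ i mod p)) ^ k)"
    unfolding power_sum_def U
    using sum.reindex_bij_betw[OF residue_primroot_is_generator[OF p_gt_1 g], of "\<lambda>j. inverse (of_nat j :: 'k) ^ k"]
      prime_p by (simp add: totient_prime)
  then have "nv (power_sum 1 k - (\<Sum>i<p - 1. q ^ i))
      = nv (\<Sum>i<p - 1. inverse (of_nat (g ^ i mod p)) ^ k - inverse (of_nat (g ^ i)) ^ k)"
    by (simp add: sum_subtractf q_def mult.commute flip: power_mult power_inverse)
  also have "\<dots> \<le> 1 / real p"
    using gi by (intro nv_sum_le nv_inverse_power_cong) (auto simp: cong_def)
  finally have geo: "nv (power_sum 1 k - (\<Sum>i<p - 1. q ^ i)) \<le> 1 / real p" .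
  \<comment> \<open>This translates congruences for \<open>q\<close> into statements about the
    multiplicative order \<open>p - 1\<close> of the primitive root.\<close>
  have qcong: "nv (1 - q ^ m) = nv (of_nat (g ^ (k * m)) - of_nat 1)" for m
  proof -
    have "of_nat g \<noteq> (0 :: 'k)"
      using gu by (intro notI) auto
    then have "1 - q ^ m = (of_nat (g ^ (k * m)) - of_nat 1) * q ^ m"
      by (simp add: q_def field_simps power_mult)
    then show ?thesis
      by (simp only: nv_mult nv_power q1 power_one mult_1_right)
  qed
  have lt: "1 / real p < 1"
    using p_gt_1 by simp
  { assume dvd: "(p - 1) dvd k"
    then have "[g ^ (k * m) = 1] (mod p)" for m
      unfolding ord_divides ordg by simp
    then have "nv (1 - q ^ m) \<le> 1 / real p" for m
      unfolding qcong by (rule nv_cong)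
    then have "nv (\<Sum>i<p - 1. q ^ i - 1) \<le> 1 / real p"
      by (intro nv_sum_le) (simp_all add: nv_minus_commute)
    then have "nv ((\<Sum>i<p - 1. q ^ i) - of_nat (p - 1)) \<le> 1 / real p"
      by (simp add: sum_subtractf)
    from nv_dist_trans[OF geo this] have "nv (power_sum 1 k - of_nat (p - 1)) < 1"
      using lt by linarith
    moreover have "nv (of_nat (p - 1)) = 1"
      using p_gt_1 by (intro nv_of_nat_unit) (auto dest: dvd_imp_le)
    ultimately show "nv (power_sum 1 k) = 1"
      by (metis nv_eq_if_close) }
  { assume ndvd: "\<not> (p - 1) dvd k"
    have "\<not> [g ^ (k * 1) = 1] (mod p)"
      unfolding ord_divides ordg using ndvd by simp
    then have 1: "nv (1 - q ^ 1) = 1"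
      unfolding qcong by (rule nv_not_cong)
    have "[g ^ (k * (p - 1)) = 1] (mod p)"
      unfolding ord_divides ordg by simp
    then have 2: "nv (1 - q ^ (p - 1)) \<le> 1 / real p"
      unfolding qcong by (rule nv_cong)
    have "nv ((1 - q) * (\<Sum>i<p - 1. q ^ i)) \<le> 1 / real p"
      using 2 one_diff_power_eq[of q "p - 1"] by simp
    then have "nv (\<Sum>i<p - 1. q ^ i) \<le> 1 / real p"
      using 1 by (simp add: nv_mult)
    from nv_add_le[OF geo this] show "nv (power_sum 1 k) \<le> 1 / real p"
      by simp }
qed

end

section \<open>The logarithmic derivative of the \<open>p\<close>-adic Gamma function\<close>

context valued_field
begin

lemma nv_limit_fps_mult:
  assumes "\<And>i. (\<lambda>N. nv (fps_nth (u N) i - fps_nth f i)) \<longlonglongrightarrow> 0"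
    and "\<And>i. (\<lambda>N. nv (fps_nth (v N) i - fps_nth g i)) \<longlonglongrightarrow> 0"
  shows "(\<lambda>N. nv (fps_nth (u N * v N) i - fps_nth (f * g) i)) \<longlonglongrightarrow> 0"
  unfolding fps_mult_nth by (intro nv_limit_sum nv_limit_mult assms)

end

text \<open>The geometric expansion of 1/(c + X), for nonzero \<open>c\<close>.\<close>

definition inverse_X_plus :: "'a::field \<Rightarrow> 'a fps" where
  "inverse_X_plus c = Abs_fps (\<lambda>k. (- 1) ^ k * inverse c ^ Suc k)"

lemma X_plus_mult_inverse_X_plus:
  assumes "c \<noteq> 0"
  shows "(fps_const c + fps_X) * inverse_X_plus c = 1"
proof (rule fps_ext)
  fix n
  show "fps_nth ((fps_const c + fps_X) * inverse_X_plus c) n = fps_nth 1 n"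
    using assms by (cases n) (simp_all add: inverse_X_plus_def distrib_right)
qed

lemma fps_deriv_prod_X_plus:
  fixes c :: "'b \<Rightarrow> 'a::field"
  assumes "finite A" "\<And>j. j \<in> A \<Longrightarrow> c j \<noteq> 0"
  shows "fps_deriv (\<Prod>j\<in>A. fps_const (c j) + fps_X)
    = (\<Prod>j\<in>A. fps_const (c j) + fps_X) * (\<Sum>j\<in>A. inverse_X_plus (c j))"
  using assms
proof (induction A rule: finite_induct)
  case (insert a A)
  let ?P = "\<Prod>j\<in>A. fps_const (c j) + fps_X" and ?S = "\<Sum>j\<in>A. inverse_X_plus (c j)"
  have "fps_deriv (\<Prod>j\<in>insert a A. fps_const (c j) + fps_X) = ?P + (fps_const (c a) + fps_X) * (?P * ?S)"
    using insert by (simp add: algebra_simps)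
  also have "\<dots> = ?P * ((fps_const (c a) + fps_X) * inverse_X_plus (c a)) + (fps_const (c a) + fps_X) * (?P * ?S)"
    using insert.prems by (subst X_plus_mult_inverse_X_plus) auto
  finally show ?case
    using insert.hyps by (simp add: algebra_simps)
qed simp

context padic_numbers
begin

text \<open>The quotient of Gamma at x + p^N by Gamma at x, for |x| < 1. The sign is (-1)^(p^N),
  collected from all \<open>p ^ N\<close> steps of the functional equation with \<open>p\<close>
  odd.\<close>

definition shift_poly :: "nat \<Rightarrow> 'k poly" where
  "shift_poly N = - (\<Prod>j\<in>units_below N. [:of_nat j, 1:])"

lemma fps_of_shift_poly:
  "fps_of_poly (shift_poly N) = - (\<Prod>j\<in>units_below N. fps_const (of_nat j) + fps_X)"
  by (simp add: shift_poly_def fps_of_poly_uminus fps_of_poly_prod fps_of_poly_pCons)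

lemma morita_gamma_shift:
  assumes \<Gamma>: "is_morita_gamma nv \<Gamma>" and x: "nv x < 1"
  shows "\<Gamma> (x + of_nat m) = (\<Prod>j<m. if p dvd j then - 1 else - (x + of_nat j)) * \<Gamma> x"
proof (induction m)
  case (Suc m)
  have "\<Gamma> ((x + of_nat m) + 1) = (if p dvd m then - 1 else - (x + of_nat m)) * \<Gamma> (x + of_nat m)"
  proof (cases "p dvd m")
    case True
    then have "nv (of_nat m) < 1"
      using nv_of_nat_multiple[OF True] p_gt_1 by (auto intro: le_less_trans)
    then have "nv (x + of_nat m) < 1"
      using x nv_add[of x "of_nat m"] by auto
    then show ?thesis
      using True \<Gamma> by (simp add: is_morita_gamma_def)
  next
    case False
    then have "nv (x + of_nat m) = 1"
      using nv_add_eq_right[of x "of_nat m"] nv_of_nat_unit[OF False] x by simp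
    moreover have "\<Gamma> (y + 1) = - y * \<Gamma> y" if "nv y = 1" for y
      using \<Gamma> that unfolding is_morita_gamma_def by blast
    ultimately show ?thesis
      using False by (simp only: if_False)
  qed
  then show ?case
    using Suc by (simp add: add_ac mult_ac)
qed simp

lemma morita_gamma_shift_power:
  assumes "p \<noteq> 2" "is_morita_gamma nv \<Gamma>" "nv x < 1"
  shows "\<Gamma> (x + of_nat p ^ N) = poly (shift_poly N) x * \<Gamma> x"
proof -
  let ?P = "\<Prod>j\<in>units_below N. x + of_nat j"
  have "(\<Prod>j<p ^ N. if p dvd j then - 1 else - (x + of_nat j))
      = (\<Prod>j<p ^ N. - 1 * (if p dvd j then 1 else x + of_nat j))"
    by (intro prod.cong) auto
  also have "\<dots> = (- 1) ^ (p ^ N) * (\<Prod>j<p ^ N. if p dvd j then 1 else x + of_nat j)"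
    unfolding prod.distrib by simp
  also have "(\<Prod>j<p ^ N. if p dvd j then 1 else x + of_nat j) = ?P"
    by (rule prod.mono_neutral_cong_right) (auto simp: units_below_def)
  also have "(- 1) ^ (p ^ N) * ?P = - ?P"
    using odd_p[OF assms(1)] by simp
  also have "\<dots> = poly (shift_poly N) x"
    by (simp add: shift_poly_def poly_prod add.commute)
  finally show ?thesis
    using morita_gamma_shift[OF assms(2,3), of "p ^ N"] by simp
qed

lemma nv_p_pow_lim: "(\<lambda>N. nv (of_nat p ^ N)) \<longlonglongrightarrow> 0"
  unfolding nv_p_power using p_gt_1 by (intro LIMSEQ_realpow_zero) auto

text \<open>On a small closed disc both sides sum to the values of Gamma at shifted points, so the
  functional equation holds there pointwise; the identity theorem makes it an identity of power
  series. The shift \<open>p ^ N\<close> has to stay inside the disc, hence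
  \<open>N \<ge> M\<close>.\<close>

lemma taylor_shift_gamma:
  assumes "p \<noteq> 2" and \<Gamma>: "is_morita_gamma nv \<Gamma>" and F: "is_taylor_expansion_at_0 nv \<Gamma> F"
  obtains M where "(\<lambda>k. nv (fps_nth F k) * (1 / real p) ^ (M * k)) \<longlonglongrightarrow> 0"
    and "\<And>N. N \<ge> M \<Longrightarrow> taylor_shift (of_nat p ^ N) F = fps_of_poly (shift_poly N) * F"
proof -
  obtain r where r: "0 < r" "\<And>x. nv x \<le> 1 \<Longrightarrow> nv x < r \<Longrightarrow> fps_sums_to nv F x (\<Gamma> x)"
    using F by (auto simp: is_taylor_expansion_at_0_def valuation_ring_def)
  obtain M0 where M0: "(1 / real p) ^ M0 < r"
    using real_arch_pow_inv[OF r(1), of "1 / real p"] p_gt_1 by auto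
  \<comment> \<open>The successor forces the radius below 1 even when \<open>r\<close> is large, as
    the functional equation used here requires |x| < 1.\<close>
  define M where "M = Suc M0"
  define \<rho> where "\<rho> = (1 / real p) ^ M"
  have "\<rho> \<le> (1 / real p) ^ M0"
    unfolding \<rho>_def M_def using p_gt_1 by (intro power_decreasing) auto
  moreover have "\<rho> < 1" "0 < \<rho>"
    unfolding \<rho>_def M_def using p_gt_1 by (auto simp del: power_Suc intro: power_Suc_less_one)
  ultimately have \<rho>: "\<rho> < r" "\<rho> < 1" "0 < \<rho>"
    using M0 by auto
  have sums: "fps_sums_to nv F x (\<Gamma> x)" if "nv x \<le> \<rho>" for x
    using r(2)[of x] that \<rho> by auto
  have nvM: "nv (of_nat p ^ M) = \<rho>"
    by (simp add: nv_p_power \<rho>_def)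
  have terms: "(\<lambda>k. nv (fps_nth F k) * \<rho> ^ k) \<longlonglongrightarrow> 0"
    using fps_sums_to_terms[OF sums[of "of_nat p ^ M"]] nvM by simp
  show ?thesis
  proof
    show "(\<lambda>k. nv (fps_nth F k) * (1 / real p) ^ (M * k)) \<longlonglongrightarrow> 0"
      using terms by (simp add: \<rho>_def power_mult)
    fix N assume "M \<le> N"
    let ?h = "of_nat p ^ N :: 'k"
    have h: "nv ?h \<le> \<rho>"
      unfolding nv_p_power \<rho>_def using p_gt_1 \<open>M \<le> N\<close> by (intro power_decreasing) auto
    have 0: "fps_sums_to nv (taylor_shift ?h F - fps_of_poly (shift_poly N) * F) x 0" if x: "nv x \<le> \<rho>" for x
    proof -
      have "nv (?h + x) \<le> \<rho>"
        using h x by (rule nv_add_le)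
      then have "fps_sums_to nv (taylor_shift ?h F) x (\<Gamma> (?h + x))"
        using fps_sums_to_taylor_shift[OF terms h x] sums by blast
      moreover have "\<Gamma> (?h + x) = poly (shift_poly N) x * \<Gamma> x"
        using morita_gamma_shift_power[OF assms(1) \<Gamma>, of x N] x \<rho> by (simp add: add.commute)
      moreover have "fps_sums_to nv (fps_of_poly (shift_poly N) * F) x (poly (shift_poly N) x * \<Gamma> x)"
        by (intro fps_sums_to_mult fps_sums_to_poly sums x)
      ultimately show ?thesis
        using fps_sums_to_diff by fastforce
    qed
    have "taylor_shift ?h F - fps_of_poly (shift_poly N) * F = 0"
    proof (rule fps_eq_0_if_sums_to_0[OF 0])
      show "nv (of_nat p ^ M) \<le> \<rho>" "of_nat p ^ M \<noteq> (0 :: 'k)" "0 < nv (of_nat p)" "nv (of_nat p) < 1"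
        using nvM p_gt_1 by (auto simp: nv_p)
    qed (use \<rho> 0 in auto)
    then show "taylor_shift ?h F = fps_of_poly (shift_poly N) * F"
      by simp
  qed
qed

text \<open>With h = p^N, \<open>Q N * F\<close> is the difference quotient (F(x + h) - F(x)) / h.
  Its coefficients tend to those of F' because the Taylor remainder is of order h^2; multiplying by
  \<open>inverse F\<close> preserves coefficientwise limits.\<close>

lemma shift_poly_difference_quotient:
  assumes "p \<noteq> 2" and \<Gamma>: "is_morita_gamma nv \<Gamma>" and F: "is_taylor_expansion_at_0 nv \<Gamma> F"
    and F0: "fps_nth F 0 = 1"
  defines "Q \<equiv> \<lambda>N. fps_const (inverse (of_nat p ^ N)) * (fps_of_poly (shift_poly N) - 1)"
  shows "(\<lambda>N. nv (fps_nth (Q N) i - fps_nth (fps_deriv F * inverse F) i)) \<longlonglongrightarrow> 0"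
proof -
  obtain M where M: "(\<lambda>k. nv (fps_nth F k) * (1 / real p) ^ (M * k)) \<longlonglongrightarrow> 0"
      "\<And>N. N \<ge> M \<Longrightarrow> taylor_shift (of_nat p ^ N) F = fps_of_poly (shift_poly N) * F"
    using taylor_shift_gamma[OF assms(1-3)] by blast
  define \<rho> where "\<rho> = (1 / real p) ^ M"
  have \<rho>: "0 < \<rho>"
    using p_gt_1 by (simp add: \<rho>_def)
  have terms: "(\<lambda>k. nv (fps_nth F k) * \<rho> ^ k) \<longlonglongrightarrow> 0"
    using M(1) by (simp add: \<rho>_def power_mult)
  obtain B where B: "0 < B" "\<And>k. nv (fps_nth F k) * \<rho> ^ k \<le> B"
    using bounded_of_tendsto_0[OF terms] by blast
  have QF: "(\<lambda>N. nv (fps_nth (Q N * F) i - fps_nth (fps_deriv F) i)) \<longlonglongrightarrow> 0" for i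
  proof (rule Lim_null_comparison)
    show "(\<lambda>N. B / \<rho> ^ i / \<rho> ^ 2 * nv (of_nat p ^ N)) \<longlonglongrightarrow> 0"
      by (rule tendsto_mult_right_zero[OF nv_p_pow_lim])
    show "\<forall>\<^sub>F N in sequentially. norm (nv (fps_nth (Q N * F) i - fps_nth (fps_deriv F) i))
        \<le> B / \<rho> ^ i / \<rho> ^ 2 * nv (of_nat p ^ N)"
    proof (rule eventually_sequentiallyI[of M])
      fix N assume N: "M \<le> N"
      define h :: 'k where "h = of_nat p ^ N"
      have h0: "h \<noteq> 0" "0 < nv h"
        using p_gt_1 by (auto simp: h_def nv_pos_iff)
      have h: "nv h \<le> \<rho>"
        unfolding h_def nv_p_power \<rho>_def using p_gt_1 N by (intro power_decreasing) auto
      let ?H = "hasse_deriv i F"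
      have le: "nv (fps_nth ?H k) * nv h ^ k \<le> nv (fps_nth ?H k) * \<rho> ^ k" for k
        using h by (intro mult_left_mono power_mono nv_nonneg)
      have "fps_sums_to nv ?H h (fps_nth (taylor_shift h F) i)"
        unfolding taylor_shift_def fps_nth_Abs_fps
        by (rule fps_sums_to_value, rule Lim_null_comparison[OF _ hasse_deriv_terms[OF terms, of i]])
          (use le \<rho> in \<open>auto simp: nv_nonneg\<close>)
      \<comment> \<open>The terms of order 0 and 1 in \<open>h\<close> are split off. In the others
        \<open>(nv h / \<rho>) ^ k\<close> is at most the square, since
        \<open>nv h \<le> \<rho>\<close>.\<close>
      then have "nv (fps_nth (taylor_shift h F) i - (\<Sum>k<2. fps_nth ?H k * h ^ k)) \<le> B / \<rho> ^ i * (nv h / \<rho>) ^ 2"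
      proof (rule fps_sums_to_tail_le)
        fix k :: nat assume k: "2 \<le> k"
        have "nv (fps_nth ?H k) * \<rho> ^ k * \<rho> ^ i \<le> B"
          using \<rho> B by (intro hasse_deriv_term_le) auto
        then have "nv (fps_nth ?H k) * \<rho> ^ k \<le> B / \<rho> ^ i"
          using \<rho> by (simp add: pos_le_divide_eq)
        moreover have "(nv h / \<rho>) ^ k \<le> (nv h / \<rho>) ^ 2"
          using h \<rho> k by (intro power_decreasing) (auto simp: nv_nonneg)
        ultimately have "(nv (fps_nth ?H k) * \<rho> ^ k) * (nv h / \<rho>) ^ k \<le> B / \<rho> ^ i * (nv h / \<rho>) ^ 2"
          using \<rho> B by (intro mult_mono) (auto simp: nv_nonneg)
        then show "nv (fps_nth ?H k) * nv h ^ k \<le> B / \<rho> ^ i * (nv h / \<rho>) ^ 2"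
          using \<rho> by (simp add: power_divide)
      qed (use B \<rho> in auto)
      moreover have "(\<Sum>k<2. fps_nth ?H k * h ^ k) = fps_nth F i + h * fps_nth (fps_deriv F) i"
        by (simp add: hasse_deriv_def numeral_2_eq_2 mult_ac)
      moreover have "fps_nth (taylor_shift h F) i = fps_nth F i + h * fps_nth (Q N * F) i"
        using M(2)[OF N] h0 by (simp add: Q_def h_def[symmetric] mult.assoc left_diff_distrib mult.assoc[symmetric, of h])
      ultimately have "nv (h * (fps_nth (Q N * F) i - fps_nth (fps_deriv F) i)) \<le> B / \<rho> ^ i * (nv h / \<rho>) ^ 2"
        by (simp add: right_diff_distrib)
      also have "\<dots> = nv h * (B / \<rho> ^ i / \<rho> ^ 2 * nv h)"
        by (simp add: power2_eq_square)
      finally have "nv (fps_nth (Q N * F) i - fps_nth (fps_deriv F) i) \<le> B / \<rho> ^ i / \<rho> ^ 2 * nv h"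
        using mult_le_cancel_left_pos[OF h0(2)] unfolding nv_mult by blast
      then show "norm (nv (fps_nth (Q N * F) i - fps_nth (fps_deriv F) i))
          \<le> B / \<rho> ^ i / \<rho> ^ 2 * nv (of_nat p ^ N)"
        unfolding real_norm_def abs_of_nonneg[OF nv_nonneg] h_def .
    qed
  qed
  have "(\<lambda>N. nv (fps_nth ((Q N * F) * inverse F) i - fps_nth (fps_deriv F * inverse F) i)) \<longlonglongrightarrow> 0"
    by (rule nv_limit_fps_mult[OF QF]) simp
  moreover have "(Q N * F) * inverse F = Q N" for N
    using inverse_mult_eq_1'[of F] F0 by (simp add: mult.assoc)
  ultimately show ?thesis
    by simp
qed

text \<open>The coefficients of \<open>P'/P\<close> for \<open>P = shift_poly N\<close>, divided by the shift \<open>p ^ N\<close>; they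
  approximate those of the derivative of \<open>\<Gamma>'/\<Gamma>\<close>.\<close>

definition scaled_log_deriv :: "nat \<Rightarrow> 'k fps" where
  "scaled_log_deriv N = fps_const (inverse (of_nat p ^ N)) * (\<Sum>j\<in>units_below N. inverse_X_plus (of_nat j))"

lemma scaled_log_deriv_nth:
  "fps_nth (scaled_log_deriv N) k = (- 1) ^ k * (power_sum N (Suc k) / of_nat p ^ N)"
  by (simp add: scaled_log_deriv_def inverse_X_plus_def power_sum_def fps_sum_nth sum_distrib_left divide_inverse mult_ac)

lemma scaled_log_deriv_nth_close:
  assumes "p \<noteq> 2" "1 \<le> N"
  shows "nv (fps_nth (scaled_log_deriv N) k - (- 1) ^ k * (power_sum 1 (Suc k) / of_nat p)) \<le> 1"
  using power_sum_scaled[OF assms, of "Suc k"]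
  unfolding scaled_log_deriv_nth right_diff_distrib[symmetric]
  by (simp add: nv_mult nv_power nv_minus nv_1)

text \<open>Write P = 1 + h Q with h = p^N and let T be the series in question. Then Q' = P T, so T
  = Q' - h Q T. The coefficients of T stay bounded as N grows and those of Q converge, so the last
  term vanishes in the limit.\<close>

lemma scaled_log_deriv_tendsto:
  assumes "p \<noteq> 2"
    and lim: "\<And>i. (\<lambda>N. nv (fps_nth (fps_const (inverse (of_nat p ^ N)) * (fps_of_poly (shift_poly N) - 1)) i - fps_nth g i)) \<longlonglongrightarrow> 0"
  shows "(\<lambda>N. nv (fps_nth (scaled_log_deriv N) k - of_nat (Suc k) * fps_nth g (Suc k))) \<longlonglongrightarrow> 0"
proof -
  define Q where "Q N = fps_const (inverse (of_nat p ^ N)) * (fps_of_poly (shift_poly N) - 1)" for N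
  let ?T = "scaled_log_deriv"
  have p0: "of_nat p ^ N \<noteq> (0 :: 'k)" for N
    using p_gt_1 by simp
  have P: "fps_of_poly (shift_poly N) = 1 + fps_const (of_nat p ^ N) * Q N" for N
    using p0[of N] by (simp add: Q_def mult.assoc[symmetric])
  have "fps_deriv (fps_of_poly (shift_poly N)) = fps_of_poly (shift_poly N) * (\<Sum>j\<in>units_below N. inverse_X_plus (of_nat j))" for N
  proof -
    have "j \<in> units_below N \<Longrightarrow> of_nat j \<noteq> (0 :: 'k)" for j
      using nv_units_below nv_0 by (metis zero_neq_one)
    then show ?thesis
      unfolding fps_of_shift_poly fps_deriv_neg by (subst fps_deriv_prod_X_plus) auto
  qed
  then have "fps_deriv (Q N) = fps_of_poly (shift_poly N) * ?T N" for N
    by (simp add: Q_def scaled_log_deriv_def mult_ac)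
  then have T: "?T N = fps_deriv (Q N) + Q N * (fps_const (- (of_nat p ^ N)) * ?T N)" for N
    unfolding P by (simp add: algebra_simps flip: fps_const_neg)
  have small: "(\<lambda>N. nv (fps_nth (fps_const (- (of_nat p ^ N)) * ?T N) i - fps_nth 0 i)) \<longlonglongrightarrow> 0" for i
  proof (rule Lim_null_comparison)
    let ?C = "max 1 (nv ((- 1) ^ i * (power_sum 1 (Suc i) / of_nat p)))"
    show "(\<lambda>N. nv (of_nat p ^ N) * ?C) \<longlonglongrightarrow> 0"
      by (rule tendsto_mult_left_zero[OF nv_p_pow_lim])
    show "\<forall>\<^sub>F N in sequentially. norm (nv (fps_nth (fps_const (- (of_nat p ^ N)) * ?T N) i - fps_nth 0 i)) \<le> nv (of_nat p ^ N) * ?C"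
    proof (rule eventually_sequentiallyI[of 1])
      fix N :: nat assume "1 \<le> N"
      have "nv (fps_nth (?T N) i) \<le> ?C"
        using nv_add[of "fps_nth (?T N) i - (- 1) ^ i * (power_sum 1 (Suc i) / of_nat p)"
            "(- 1) ^ i * (power_sum 1 (Suc i) / of_nat p)"]
          scaled_log_deriv_nth_close[OF assms(1) \<open>1 \<le> N\<close>, of i] by (auto simp: max_def split: if_splits)
      then show "norm (nv (fps_nth (fps_const (- (of_nat p ^ N)) * ?T N) i - fps_nth 0 i)) \<le> nv (of_nat p ^ N) * ?C"
        by (simp add: nv_mult nv_minus nv_nonneg mult_left_mono)
    qed
  qed
  have "(\<lambda>N. nv (fps_nth (Q N * (fps_const (- (of_nat p ^ N)) * ?T N)) k - fps_nth (g * 0) k)) \<longlonglongrightarrow> 0"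
    using lim small by (intro nv_limit_fps_mult) (auto simp: Q_def)
  then have 1: "(\<lambda>N. nv (fps_nth (Q N * (fps_const (- (of_nat p ^ N)) * ?T N)) k - 0)) \<longlonglongrightarrow> 0"
    by simp
  have "(\<lambda>N. nv (of_nat (Suc k) * fps_nth (Q N) (Suc k) - of_nat (Suc k) * fps_nth g (Suc k))) \<longlonglongrightarrow> 0"
    by (rule nv_limit_mult[OF _ lim[of "Suc k", folded Q_def]]) simp
  then have 2: "(\<lambda>N. nv (fps_nth (fps_deriv (Q N)) k - of_nat (Suc k) * fps_nth g (Suc k))) \<longlonglongrightarrow> 0"
    by simp
  show ?thesis
    using nv_limit_add[OF 2 1] by (subst T) simp
qed

lemma log_deriv_gamma_coeffs:
  assumes "p \<noteq> 2" and \<Gamma>: "is_morita_gamma nv \<Gamma>" and F: "is_taylor_expansion_at_0 nv \<Gamma> F"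
  defines "g \<equiv> fps_deriv F * inverse F"
  shows "fps_nth F 0 = 1" and "nv (fps_nth g 0) \<le> 1"
    and "1 \<le> k \<Longrightarrow> (p - 1) dvd k \<Longrightarrow> nv (of_nat k * fps_nth g k) = real p"
    and "1 \<le> k \<Longrightarrow> \<not> (p - 1) dvd k \<Longrightarrow> nv (of_nat k * fps_nth g k) \<le> 1"
proof -
  obtain r where r: "0 < r" "\<And>x. nv x \<le> 1 \<Longrightarrow> nv x < r \<Longrightarrow> fps_sums_to nv F x (\<Gamma> x)"
    using F by (auto simp: is_taylor_expansion_at_0_def valuation_ring_def)
  have "fps_sums_to nv F 0 (\<Gamma> 0)"
    using r by simp
  then show F0: "fps_nth F 0 = 1"
    using fps_value_eqI fps_sums_to_0 \<Gamma> by (metis is_morita_gamma_def)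
  let ?Q = "\<lambda>N. fps_const (inverse (of_nat p ^ N)) * (fps_of_poly (shift_poly N) - 1)"
  have lim: "(\<lambda>N. nv (fps_nth (?Q N) i - fps_nth g i)) \<longlonglongrightarrow> 0" for i
    unfolding g_def by (rule shift_poly_difference_quotient[OF assms(1-3) F0])
  show "nv (fps_nth g 0) \<le> 1"
  proof (rule nv_limit_le[OF lim], rule eventually_sequentiallyI[of 1])
    fix N :: nat assume N: "1 \<le> N"
    have "fps_nth (?Q N) 0 = - (((\<Prod>j\<in>units_below N. of_nat j) + 1) / of_nat p ^ N)"
      by (simp add: shift_poly_def poly_prod divide_inverse mult.commute algebra_simps flip: poly_0_coeff_0)
    then have "nv (fps_nth (?Q N) 0) = nv ((\<Prod>j\<in>units_below N. of_nat j) + 1) / (1 / real p) ^ N"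
      by (simp only: nv_minus nv_divide nv_p_power)
    also have "\<dots> \<le> 1"
      using unit_product_cong[OF assms(1) N] p_gt_1 by (subst divide_le_eq_1_pos) auto
    finally show "nv (fps_nth (?Q N) 0) \<le> 1" .
  qed
  { assume "1 \<le> k"
    then obtain m where k: "k = Suc m"
      by (cases k) auto
    \<comment> \<open>The coefficient of degree \<open>m\<close> for \<open>N = 1\<close>. It is
      compared with \<open>k * g_k\<close>, which is the coefficient of degree
      \<open>m = k - 1\<close> of the derivative of \<open>g\<close>.\<close>
    let ?c = "(- 1) ^ m * (power_sum 1 k / of_nat p)"
    have nvc: "nv ?c = nv (power_sum 1 k) * real p"
      by (simp add: nv_mult nv_power nv_minus nv_1 nv_divide nv_p)
    have close: "nv (of_nat k * fps_nth g k - ?c) \<le> 1"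
    proof (rule nv_limit_le)
      show "(\<lambda>N. nv ((fps_nth (scaled_log_deriv N) m - ?c) - (of_nat k * fps_nth g k - ?c))) \<longlonglongrightarrow> 0"
        using scaled_log_deriv_tendsto[OF assms(1) lim, of m] by (simp add: k)
      show "\<forall>\<^sub>F N in sequentially. nv (fps_nth (scaled_log_deriv N) m - ?c) \<le> 1"
        using scaled_log_deriv_nth_close[OF assms(1), of _ m] unfolding k
        by (intro eventually_sequentiallyI[of 1])
    qed
    { assume "(p - 1) dvd k"
      then have "nv ?c = real p"
        using power_sum_1(1)[OF \<open>1 \<le> k\<close>] nvc by simp
      then show "nv (of_nat k * fps_nth g k) = real p"
        using nv_eq_if_close[of "of_nat k * fps_nth g k" ?c] close p_gt_1 by simp }
    { assume "\<not> (p - 1) dvd k"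
      then have "nv ?c \<le> 1"
        using power_sum_1(2)[OF \<open>1 \<le> k\<close>] p_gt_1 unfolding nvc by (simp add: field_simps)
      then show "nv (of_nat k * fps_nth g k) \<le> 1"
        using nv_add_le[OF close] by (metis diff_add_cancel) } }
qed

end

section \<open>Gauss norms of the logarithmic derivative\<close>

context padic_numbers
begin

definition omega :: real where
  "omega = (1 / real p) powr (1 / (real p - 1))"

text \<open>For \<open>n \<ge> 1\<close> this is the radius at which \<open>peak \<rho> n\<close>
  and \<open>peak \<rho> (Suc n)\<close> agree; \<open>crit_radius 0\<close> is where
  \<open>peak \<rho> 1\<close> equals \<open>1 / \<rho>\<close>.\<close>

definition crit_radius :: "nat \<Rightarrow> real" where
  "crit_radius n = (if n = 0 then (1 / real p) powr (1 / real p)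
     else omega powr (1 / (real p ^ (n - 1) * (real p - 1))))"

lemma omega_pos: "0 < omega"
  using p_gt_1 by (simp add: omega_def)

lemma omega_power: "omega ^ (p - 1) = 1 / real p"
proof -
  have "omega ^ (p - 1) = omega powr real (p - 1)"
    using omega_pos by (simp add: powr_realpow)
  also have "\<dots> = 1 / real p"
    using p_gt_1 by (simp add: omega_def powr_powr of_nat_diff)
  finally show ?thesis .
qed

lemma omega_less_1: "omega < 1"
proof (rule ccontr)
  assume "\<not> omega < 1"
  then have "1 \<le> omega ^ (p - 1)"
    by (intro one_le_power) auto
  then show False
    using omega_power p_gt_1 by simp
qed

lemma crit_radius_pos: "0 < crit_radius n"
  using p_gt_1 omega_pos by (simp add: crit_radius_def)

lemma crit_radius_0_power: "crit_radius 0 ^ p = 1 / real p"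
proof -
  have "crit_radius 0 ^ p = crit_radius 0 powr real p"
    using crit_radius_pos by (simp add: powr_realpow)
  also have "\<dots> = 1 / real p"
    using p_gt_1 by (simp add: crit_radius_def powr_powr)
  finally show ?thesis .
qed

lemma crit_radius_power:
  assumes "1 \<le> n"
  shows "crit_radius n ^ (p ^ (n - 1) * (p - 1) * (p - 1)) = 1 / real p"
proof -
  have "crit_radius n ^ (p ^ (n - 1) * (p - 1)) = crit_radius n powr real (p ^ (n - 1) * (p - 1))"
    using crit_radius_pos by (simp only: powr_realpow)
  also have "\<dots> = omega"
    using assms p_gt_1 omega_pos by (simp add: crit_radius_def powr_powr of_nat_diff)
  finally show ?thesis
    using omega_power by (simp only: power_mult)
qed

lemma crit_radius_less_1: "crit_radius n < 1"
proof (rule ccontr)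
  assume "\<not> crit_radius n < 1"
  then have "1 \<le> crit_radius n ^ m" for m
    by (intro one_le_power) auto
  moreover obtain m where "crit_radius n ^ m = 1 / real p"
    using crit_radius_0_power crit_radius_power[of n] by (cases "n = 0") auto
  ultimately have "1 \<le> 1 / real p"
    by metis
  then show False
    using p_gt_1 by simp
qed

lemma crit_radius_strict_mono:
  assumes "p \<noteq> 2"
  shows "crit_radius n < crit_radius (Suc n)"
proof -
  have p3: "3 \<le> p"
    using p_gt_1 assms by simp
  then obtain q where q: "p = q + 3"
    by (metis le_add_diff_inverse2)
  \<comment> \<open>\<open>E\<close> and \<open>D\<close> are the exponents at which
    \<open>crit_radius (Suc n)\<close> and \<open>crit_radius n\<close> become \<open>1 / p\<close>;
    the larger exponent belongs to the larger radius. For \<open>n = 0\<close> this needs p < (p -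
    1)^2, hence \<open>p \<ge> 3\<close>.\<close>
  define E where "E = p ^ n * (p - 1) * (p - 1)"
  define D where "D = (if n = 0 then p else p ^ (n - 1) * (p - 1) * (p - 1))"
  have "D < E"
  proof (cases n)
    case 0
    then show ?thesis
      unfolding D_def E_def q by (simp add: algebra_simps)
  next
    case (Suc m)
    then show ?thesis
      unfolding D_def E_def using p3 by (simp add: mult.assoc)
  qed
  then have "crit_radius n ^ E < crit_radius n ^ D"
    using crit_radius_pos crit_radius_less_1 by (intro power_strict_decreasing) auto
  also have "\<dots> = 1 / real p"
    unfolding D_def using crit_radius_0_power crit_radius_power[of n] by simp
  also have "\<dots> = crit_radius (Suc n) ^ E"
    unfolding E_def using crit_radius_power[of "Suc n"] by simp
  finally show ?thesis
    using crit_radius_pos[of "Suc n"] by (auto intro: power_less_imp_less_base)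
qed

lemma crit_radius_mono: "p \<noteq> 2 \<Longrightarrow> m \<le> n \<Longrightarrow> crit_radius m \<le> crit_radius n"
  by (rule lift_Suc_mono_le) (auto intro: less_imp_le crit_radius_strict_mono)

text \<open>For \<open>m \<ge> 1\<close>, the size on the circle of radius \<open>\<rho>\<close> of
  the term of \<open>g\<close> of degree \<open>p ^ (m - 1) * (p - 1)\<close>, the least degree
  whose coefficient has absolute value \<open>p ^ m\<close> by divisibility by
  \<open>p - 1\<close>.\<close>

definition peak :: "real \<Rightarrow> nat \<Rightarrow> real" where
  "peak \<rho> m = real p ^ m * \<rho> ^ (p ^ (m - 1) * (p - 1))"

lemma peak_nonneg: "0 \<le> \<rho> \<Longrightarrow> 0 \<le> peak \<rho> m"
  by (simp add: peak_def)

text \<open>The ratio of consecutive peaks is 1 exactly at \<open>crit_radius m\<close>. As these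
  radii increase with \<open>m\<close>, the peaks at a fixed \<open>\<rho>\<close> first rise and
  then fall.\<close>

lemma peak_Suc:
  assumes "1 \<le> m"
  shows "peak \<rho> (Suc m) = peak \<rho> m * (real p * \<rho> ^ (p ^ (m - 1) * (p - 1) * (p - 1)))"
proof -
  have "p ^ m * (p - 1) = p ^ (m - 1) * (p - 1) + p ^ (m - 1) * (p - 1) * (p - 1)"
  proof -
    obtain q where "p = Suc q"
      using p_gt_1 by (metis less_imp_Suc_add plus_1_eq_Suc)
    then show ?thesis
      using assms by (cases m) (simp_all add: algebra_simps)
  qed
  then show ?thesis
    by (simp add: peak_def power_add)
qed

lemma peak_decreasing:
  assumes "p \<noteq> 2" "0 \<le> \<rho>" "\<rho> \<le> crit_radius n" "1 \<le> n" "n \<le> m"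
  shows "peak \<rho> m \<le> peak \<rho> n"
  using assms(5)
proof (induction m rule: dec_induct)
  case (step m)
  let ?E = "p ^ (m - 1) * (p - 1) * (p - 1)"
  have "\<rho> \<le> crit_radius m"
    using assms(3) crit_radius_mono[OF assms(1) step.hyps(1)] by simp
  then have "\<rho> ^ ?E \<le> crit_radius m ^ ?E"
    using assms(2) by (rule power_mono)
  then have "real p * \<rho> ^ ?E \<le> real p * crit_radius m ^ ?E"
    by (rule mult_left_mono) simp
  also have "\<dots> = 1"
    using p_gt_1 step.hyps assms(4) by (subst crit_radius_power) auto
  finally have "real p * \<rho> ^ ?E \<le> 1" .
  then have "peak \<rho> (Suc m) \<le> peak \<rho> m"
    using peak_Suc[of m \<rho>] step.hyps assms(4) mult_left_mono[OF _ peak_nonneg[OF assms(2)]] by fastforce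
  then show ?case
    using step.IH by simp
qed simp

lemma peak_increasing:
  assumes "p \<noteq> 2" "crit_radius (n - 1) \<le> \<rho>" "1 \<le> m" "m \<le> n"
  shows "peak \<rho> m \<le> peak \<rho> n"
  using assms(4,2)
proof (induction n rule: dec_induct)
  case (step n)
  let ?E = "p ^ (n - 1) * (p - 1) * (p - 1)"
  have \<rho>: "crit_radius n \<le> \<rho>" "0 \<le> \<rho>"
    using step.prems crit_radius_pos[of n] by auto
  then have "crit_radius n ^ ?E \<le> \<rho> ^ ?E"
    by (intro power_mono) (auto intro: less_imp_le crit_radius_pos)
  then have "real p * crit_radius n ^ ?E \<le> real p * \<rho> ^ ?E"
    by (rule mult_left_mono) simp
  moreover have "real p * crit_radius n ^ ?E = 1"
    using p_gt_1 step.hyps assms(3) by (subst crit_radius_power) auto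
  ultimately have "1 \<le> real p * \<rho> ^ ?E"
    by simp
  then have "peak \<rho> n \<le> peak \<rho> (Suc n)"
    using peak_Suc[of n \<rho>] step.hyps assms(3) mult_left_mono[OF _ peak_nonneg[OF \<rho>(2)]] by fastforce
  moreover have "crit_radius (n - 1) \<le> \<rho>"
    using \<rho> crit_radius_mono[OF assms(1), of "n - 1" n] by simp
  ultimately show ?case
    using step.IH by simp
qed simp

lemma peak_1_crit_radius_0: "peak (crit_radius 0) 1 = 1 / crit_radius 0"
proof -
  have "crit_radius 0 * crit_radius 0 ^ (p - 1) = 1 / real p"
    using crit_radius_0_power p_gt_1 by (simp flip: power_Suc)
  then show ?thesis
    using crit_radius_pos[of 0] p_gt_1 by (simp add: peak_def field_simps)
qed

text \<open>Since the peaks rise up to index \<open>n\<close>, it suffices to look at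
  \<open>peak \<rho> 1 * \<rho> = p * \<rho> ^ p\<close>, which is 1 at
  \<open>crit_radius 0\<close>.\<close>

lemma peak_mult_ge_1:
  assumes "p \<noteq> 2" "1 \<le> n" "crit_radius (n - 1) \<le> \<rho>"
  shows "1 \<le> peak \<rho> n * \<rho>" and "crit_radius 0 < \<rho> \<Longrightarrow> 1 < peak \<rho> n * \<rho>"
proof -
  have \<rho>: "crit_radius 0 \<le> \<rho>"
    using crit_radius_mono[OF assms(1), of 0 "n - 1"] assms(3) by simp
  then have \<rho>0: "0 \<le> \<rho>"
    using crit_radius_pos[of 0] by simp
  have le: "real p * \<rho> ^ p \<le> peak \<rho> n * \<rho>"
  proof -
    have "real p * \<rho> ^ p = peak \<rho> 1 * \<rho>"
      using p_gt_1 by (simp add: peak_def flip: power_Suc2)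
    then show ?thesis
      using peak_increasing[OF assms(1,3) order_refl assms(2)] \<rho>0 by (simp add: mult_right_mono)
  qed
  have "crit_radius 0 ^ p \<le> \<rho> ^ p"
    using \<rho> crit_radius_pos[of 0] by (intro power_mono) auto
  then show "1 \<le> peak \<rho> n * \<rho>"
    using le p_gt_1 by (simp add: crit_radius_0_power field_simps)
  assume "crit_radius 0 < \<rho>"
  then have "crit_radius 0 ^ p < \<rho> ^ p"
    using crit_radius_pos[of 0] p_gt_1 by (intro power_strict_mono) auto
  then show "1 < peak \<rho> n * \<rho>"
    using le p_gt_1 by (simp add: crit_radius_0_power field_simps)
qed

lemma p_power_le: "k = p ^ v * m \<Longrightarrow> 1 \<le> m \<Longrightarrow> p ^ v \<le> k"
  by (metis mult_le_mono2 mult.right_neutral)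

lemma nat_p_decompose:
  assumes "k \<noteq> 0"
  obtains v m where "k = p ^ v * m" "\<not> p dvd m" "1 \<le> m" "nv (of_nat k) = (1 / real p) ^ v"
proof -
  obtain v m where m: "k = p ^ v * m" "\<not> p dvd m"
    using multiplicity_decompose'[of k p] assms p_gt_1 by (metis less_irrefl nat_dvd_1_iff_1)
  then have "nv (of_nat k) = (1 / real p) ^ v"
    using nv_of_nat_unit[OF m(2)] by (simp only: of_nat_mult of_nat_power nv_mult nv_p_power mult_1_right)
  moreover have "1 \<le> m"
    using m(2) by (cases m) auto
  ultimately show ?thesis
    using m that by blast
qed

end

locale gamma_log_deriv = padic_numbers +
  fixes g :: "'a fps"
  assumes p_neq_2: "p \<noteq> 2"
    and coeff_0: "nv (fps_nth g 0) \<le> 1"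
    and coeff_dvd: "1 \<le> k \<Longrightarrow> (p - 1) dvd k \<Longrightarrow> nv (of_nat k * fps_nth g k) = real p"
    and coeff_not_dvd: "1 \<le> k \<Longrightarrow> \<not> (p - 1) dvd k \<Longrightarrow> nv (of_nat k * fps_nth g k) \<le> 1"
begin

lemma coprime_p_minus_1: "coprime (p - 1) p"
  using coprime_diff_one_left_nat[of p] p_gt_1 by simp

text \<open>Dividing by \<open>k\<close> multiplies the known size of \<open>k * g_k\<close> by
  \<open>p ^ v\<close>. As \<open>p - 1\<close> is prime to \<open>p\<close>, it divides
  \<open>k\<close> only if it divides the part \<open>m\<close> prime to \<open>p\<close>.\<close>

lemma coeff_decompose:
  assumes "1 \<le> k"
  obtains v m where "k = p ^ v * m" "\<not> p dvd m" "1 \<le> m" "nv (of_nat k) = (1 / real p) ^ v"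
    "(p - 1) dvd m" "nv (fps_nth g k) = real p ^ (v + 1)"
  | v m where "k = p ^ v * m" "\<not> p dvd m" "1 \<le> m" "nv (of_nat k) = (1 / real p) ^ v"
    "nv (fps_nth g k) \<le> real p ^ v"
proof -
  obtain v m where k: "k = p ^ v * m" "\<not> p dvd m" "1 \<le> m" "nv (of_nat k) = (1 / real p) ^ v"
    using nat_p_decompose[of k] assms by auto
  have eq: "nv (of_nat k * fps_nth g k) = nv (fps_nth g k) / real p ^ v"
    by (simp add: nv_mult k(4) power_divide)
  have pos: "0 < real p ^ v"
    using p_gt_1 by simp
  show ?thesis
  proof (cases "(p - 1) dvd k")
    case True
    have "coprime (p - 1) (p ^ v)"
      using coprime_p_minus_1 by simp
    then have "(p - 1) dvd m"
      using True by (simp add: k(1) coprime_dvd_mult_right_iff)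
    moreover have "nv (fps_nth g k) = real p ^ (v + 1)"
      using coeff_dvd[OF assms True] pos unfolding eq by (simp add: field_simps)
    ultimately show ?thesis
      using that(1) k by blast
  next
    case False
    then show ?thesis
      using coeff_not_dvd[OF assms False] pos k that(2) unfolding eq by (simp add: field_simps)
  qed
qed

lemma coeff_le: "nv (fps_nth g k) \<le> real p * real (Suc k)"
proof (cases "k = 0")
  case True
  then show ?thesis
    using coeff_0 p_gt_1 by simp
next
  case False
  then have "1 \<le> k"
    by simp
  then show ?thesis
  proof (cases rule: coeff_decompose)
    case (1 v m)
    have "real (p ^ v) \<le> real (Suc k)"
      unfolding of_nat_le_iff using p_power_le[OF 1(1,3)] by simp
    from mult_left_mono[OF this, of "real p"] show ?thesis
      unfolding 1(6) by simp
  next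
    case (2 v m)
    have "real (p ^ v) \<le> real k"
      unfolding of_nat_le_iff by (rule p_power_le[OF 2(1,3)])
    then have "nv (fps_nth g k) \<le> real (Suc k)"
      using 2(5) unfolding of_nat_power of_nat_Suc by linarith
    also have "\<dots> \<le> real p * real (Suc k)"
      using p_gt_1 by (simp add: mult_le_cancel_right1)
    finally show ?thesis .
  qed
qed

lemma g_in_disc_functions: "g \<in> disc_functions nv 1"
  unfolding disc_functions_def
proof (intro CollectI allI impI)
  fix \<rho> :: real assume \<rho>: "0 \<le> \<rho> \<and> \<rho> < 1"
  have "(\<lambda>k. real p * (of_nat k * \<rho> ^ k + \<rho> ^ k)) \<longlonglongrightarrow> real p * (0 + 0)"
    using \<rho> by (intro tendsto_intros powser_times_n_limit_0 LIMSEQ_realpow_zero) auto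
  then have "(\<lambda>k. real p * (of_nat k * \<rho> ^ k + \<rho> ^ k)) \<longlonglongrightarrow> 0"
    by simp
  then show "(\<lambda>k. nv (fps_nth g k) * \<rho> ^ k) \<longlonglongrightarrow> 0"
  proof (rule Lim_null_comparison[rotated], intro always_eventually allI)
    fix k
    have "nv (fps_nth g k) * \<rho> ^ k \<le> real p * real (Suc k) * \<rho> ^ k"
      using \<rho> by (intro mult_right_mono coeff_le) auto
    then show "norm (nv (fps_nth g k) * \<rho> ^ k) \<le> real p * (of_nat k * \<rho> ^ k + \<rho> ^ k)"
      using \<rho> by (simp add: nv_nonneg algebra_simps)
  qed
qed

text \<open>If \<open>p - 1\<close> divides \<open>k\<close>, then k >= p^v (p - 1) and
  \<open>peak \<rho> (Suc v)\<close> dominates. Otherwise the coefficient is smaller by a factor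
  \<open>p\<close>, and \<open>peak \<rho> v\<close> dominates because p^(v-1) (p - 1) <= p^v <= k;
  only \<open>v = 0\<close> leaves no peak, but then the term is at most 1.\<close>

lemma coeff_term_le_peak:
  assumes "0 \<le> \<rho>" "\<rho> < 1"
  shows "nv (fps_nth g k) * \<rho> ^ k \<le> 1 \<or> (\<exists>m\<ge>1. nv (fps_nth g k) * \<rho> ^ k \<le> peak \<rho> m)"
proof (cases "k = 0")
  case False
  then have "1 \<le> k"
    by simp
  then show ?thesis
  proof (cases rule: coeff_decompose)
    case (1 v m)
    have "p - 1 \<le> m"
      using 1(3,5) by (auto dest: dvd_imp_le)
    then have "\<rho> ^ k \<le> \<rho> ^ (p ^ v * (p - 1))"
      unfolding 1(1) using assms by (intro power_decreasing) auto
    then have "nv (fps_nth g k) * \<rho> ^ k \<le> peak \<rho> (Suc v)"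
      using 1(6) by (simp add: peak_def mult_left_mono)
    then show ?thesis
      by (metis le_add1 plus_1_eq_Suc)
  next
    case (2 v m)
    show ?thesis
    proof (cases v)
      case 0
      then have "nv (fps_nth g k) * \<rho> ^ k \<le> 1"
        using 2(5) assms by (intro mult_le_one) (auto intro: power_le_one)
      then show ?thesis ..
    next
      case (Suc u)
      have "p ^ u * (p - 1) \<le> p ^ v * m"
        using 2(3) Suc mult_le_mono[of "p - 1" p 1 m] by (simp add: mult.assoc mult.left_commute)
      then have "\<rho> ^ k \<le> \<rho> ^ (p ^ (v - 1) * (p - 1))"
        unfolding 2(1) using assms Suc by (intro power_decreasing) auto
      then have "nv (fps_nth g k) * \<rho> ^ k \<le> peak \<rho> v"
        unfolding peak_def using 2(5) assms by (intro mult_mono) auto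
      then show ?thesis
        using Suc by auto
    qed
  qed
qed (use coeff_0 in simp)

lemma coeff_term_eq_peak:
  assumes "1 \<le> m"
  shows "nv (fps_nth g (p ^ (m - 1) * (p - 1))) * \<rho> ^ (p ^ (m - 1) * (p - 1)) = peak \<rho> m"
proof -
  let ?k = "p ^ (m - 1) * (p - 1)"
  have "nv (of_nat (p - 1)) = 1"
    using p_gt_1 by (intro nv_of_nat_unit) (auto dest: dvd_imp_le)
  then have "nv (of_nat ?k) = (1 / real p) ^ (m - 1)"
    by (simp only: of_nat_mult of_nat_power nv_mult nv_p_power mult_1_right)
  moreover have "nv (of_nat ?k * fps_nth g ?k) = real p"
    using p_gt_1 by (intro coeff_dvd) auto
  ultimately have "(1 / real p) ^ (m - 1) * nv (fps_nth g ?k) = real p"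
    unfolding nv_mult by metis
  moreover have "x = real p ^ m" if "(1 / real p) ^ (m - 1) * x = real p" for x
    using that assms p_gt_1 by (cases m) (simp_all add: power_divide field_simps)
  ultimately have "nv (fps_nth g ?k) = real p ^ m"
    by blast
  then show ?thesis
    by (simp add: peak_def)
qed

text \<open>Among the peaks the \<open>n\<close>-th is maximal on this interval, and it also beats
  the terms bounded by 1, because it is at least \<open>1 / \<rho>\<close>.\<close>

lemma coeff_term_le_max_peak:
  assumes "1 \<le> n" "crit_radius (n - 1) \<le> \<rho>" "\<rho> \<le> crit_radius n"
  shows "nv (fps_nth g k) * \<rho> ^ k \<le> peak \<rho> n"
proof -
  have \<rho>: "0 \<le> \<rho>" "\<rho> < 1"
    using assms crit_radius_pos[of "n - 1"] crit_radius_less_1[of n] by auto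
  have "1 \<le> peak \<rho> n * \<rho>"
    by (rule peak_mult_ge_1(1)[OF p_neq_2 assms(1,2)])
  also have "\<dots> \<le> peak \<rho> n"
    using \<rho> peak_nonneg[of \<rho> n] by (simp add: mult_left_le)
  finally have "1 \<le> peak \<rho> n" .
  moreover have "peak \<rho> m \<le> peak \<rho> n" if "1 \<le> m" for m
    using peak_decreasing[OF p_neq_2 \<rho>(1) assms(3,1)] peak_increasing[OF p_neq_2 assms(2) that]
    by (meson nle_le)
  ultimately show ?thesis
    using coeff_term_le_peak[OF \<rho>, of k] by (meson order_trans)
qed

lemma gauss_norm_eq_peak:
  assumes "1 \<le> n" "crit_radius (n - 1) \<le> \<rho>" "\<rho> \<le> crit_radius n"
  shows "gauss_norm nv \<rho> g = peak \<rho> n"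
  unfolding gauss_norm_def
proof (rule antisym)
  show "(SUP k. nv (fps_nth g k) * \<rho> ^ k) \<le> peak \<rho> n"
    using coeff_term_le_max_peak[OF assms] by (intro cSUP_least) auto
  have bdd: "bdd_above (range (\<lambda>k. nv (fps_nth g k) * \<rho> ^ k))"
    using coeff_term_le_max_peak[OF assms] by (intro bdd_aboveI2)
  show "peak \<rho> n \<le> (SUP k. nv (fps_nth g k) * \<rho> ^ k)"
    using cSUP_upper[OF UNIV_I bdd, of "p ^ (n - 1) * (p - 1)"]
    unfolding coeff_term_eq_peak[OF assms(1)] .
qed

text \<open>The terms grow with \<open>\<rho>\<close>, so the bound is the one at
  \<open>crit_radius 0\<close>. Its independence of \<open>\<rho>\<close> is the source of the
  constant radius.\<close>

lemma coeff_term_le_small: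
  assumes "0 \<le> \<rho>" "\<rho> \<le> crit_radius 0"
  shows "nv (fps_nth g k) * \<rho> ^ k \<le> 1 / crit_radius 0"
proof -
  have "nv (fps_nth g k) * \<rho> ^ k \<le> nv (fps_nth g k) * crit_radius 0 ^ k"
    using assms by (intro mult_left_mono power_mono nv_nonneg)
  also have "\<dots> \<le> peak (crit_radius 0) 1"
    using crit_radius_mono[OF p_neq_2, of 0 1] by (intro coeff_term_le_max_peak) auto
  finally show ?thesis
    using peak_1_crit_radius_0 by simp
qed

lemma gauss_norm_small:
  assumes "0 \<le> \<rho>" "\<rho> \<le> crit_radius 0"
  shows "ereal (gauss_norm nv \<rho> g) \<le> inverse (ereal \<rho>)"
proof (cases "\<rho> = 0")
  case False
  have "gauss_norm nv \<rho> g \<le> 1 / crit_radius 0"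
    unfolding gauss_norm_def by (intro cSUP_least coeff_term_le_small assms) auto
  also have "\<dots> \<le> 1 / \<rho>"
    using assms False by (simp add: frac_le)
  finally show ?thesis
    using False by (simp add: divide_inverse)
qed simp

end

section \<open>The radius of convergence of the Taylor series\<close>

context padic_numbers
begin

section \<open>Absolute values of factorials\<close>

lemma nv_fact_Suc: "nv (of_nat (fact (Suc n))) = nv (of_nat (Suc n)) * nv (of_nat (fact n))"
  by (simp only: fact_Suc of_nat_mult of_nat_id nv_mult)

text \<open>Only the \<open>n div p\<close> multiples of \<open>p\<close> matter in
  \<open>n!\<close>; removing one factor \<open>p\<close> from each leaves
  \<open>(n div p)!\<close>.\<close>

lemma nv_fact_div:
  "nv (of_nat (fact n)) = (1 / real p) ^ (n div p) * nv (of_nat (fact (n div p)))"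
proof (induction n)
  case (Suc n)
  show ?case
  proof (cases "p dvd Suc n")
    case True
    then have "Suc n div p = Suc (n div p)"
      by (simp add: div_Suc dvd_eq_mod_eq_0)
    moreover have "Suc n = p * (Suc n div p)"
      using True by simp
    ultimately have div: "Suc n div p = Suc (n div p)" "of_nat (Suc n) = (of_nat p * of_nat (Suc (n div p)) :: 'k)"
      by (simp_all only: of_nat_mult[symmetric])
    show ?thesis
      unfolding div(1) nv_fact_Suc div(2) nv_mult nv_p Suc by (simp del: of_nat_Suc)
  next
    case False
    then have "Suc n div p = n div p"
      by (simp add: div_Suc dvd_eq_mod_eq_0)
    then show ?thesis
      using Suc nv_of_nat_unit[OF False] by (simp only: nv_fact_Suc mult_1_left)
  qed
qed simp

lemma nv_fact_ge: "omega ^ n \<le> nv (of_nat (fact n))"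
proof (induction n rule: less_induct)
  case (less n)
  show ?case
  proof (cases "n = 0")
    case False
    define q where "q = n div p"
    have "q < n"
      unfolding q_def using False p_gt_1 by simp
    have "omega ^ n \<le> omega ^ (p * q)"
      unfolding q_def using omega_pos omega_less_1 by (intro power_decreasing) auto
    \<comment> \<open>The first summand is traded for powers of \<open>1 / p\<close> by
      \<open>omega_power\<close>; the second is left to the induction hypothesis.\<close>
    also have "p * q = (p - 1) * q + q"
      using p_gt_1 by (metis Suc_diff_1 add.commute mult_Suc order.strict_trans zero_less_one)
    also have "omega ^ \<dots> = (1 / real p) ^ q * omega ^ q"
      by (simp only: power_add power_mult omega_power)
    also have "\<dots> \<le> (1 / real p) ^ q * nv (of_nat (fact q))"
      using less[OF \<open>q < n\<close>] by (intro mult_left_mono) auto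
    also have "\<dots> = nv (of_nat (fact n))"
      unfolding q_def by (rule nv_fact_div[symmetric])
    finally show ?thesis .
  qed (simp add: nv_1)
qed

text \<open>At powers of \<open>p\<close> the lower bound \<open>nv_fact_ge\<close> is sharp up to
  one factor \<open>omega\<close>. This subsequence witnesses divergence on boundary
  circles.\<close>

lemma nv_fact_power: "nv (of_nat (fact (p ^ k))) * omega = omega ^ (p ^ k)"
proof (induction k)
  case (Suc k)
  have "p ^ Suc k = (p - 1) * p ^ k + p ^ k"
    using p_gt_1 by (simp add: algebra_simps)
  then have "omega ^ (p ^ Suc k) = (1 / real p) ^ (p ^ k) * omega ^ (p ^ k)"
    by (simp only: power_add power_mult omega_power)
  then show ?case
    using Suc nv_fact_div[of "p ^ Suc k"] p_gt_1 by (simp add: mult.assoc)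
qed (simp add: nv_1)

text \<open>In the norm of radius \<open>\<sigma>\<close> the power \<open>h ^ i\<close> has size at
  most \<open>omega ^ i\<close>, which is at most |i!|.\<close>

lemma exp_compose_bound:
  assumes h0: "fps_nth h 0 = 0" and h: "\<And>k. nv (fps_nth h k) * \<sigma> ^ k \<le> omega" and "0 \<le> \<sigma>"
  shows "nv (fps_nth (fps_exp 1 oo h) n) * \<sigma> ^ n \<le> 1"
proof (cases "\<sigma> ^ n = 0")
  case False
  then have pos: "0 < \<sigma> ^ n"
    using zero_le_power[OF assms(3), of n] by linarith
  have pow: "nv (fps_nth (h ^ i) n) * \<sigma> ^ n \<le> omega ^ i" for i n
  proof (induction i arbitrary: n)
    case 0
    then show ?case
      by (cases n) (auto simp: nv_1)
  next
    case (Suc i)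
    show ?case
    proof (cases "\<sigma> ^ n = 0")
      case True
      then show ?thesis
        using omega_pos by (simp only: mult_zero_right) simp
    next
      case False
      then have pos: "0 < \<sigma> ^ n"
        using zero_le_power[OF assms(3), of n] by linarith
      have "nv (fps_nth (h ^ Suc i) n) \<le> omega ^ Suc i / \<sigma> ^ n"
        unfolding power_Suc fps_mult_nth
      proof (rule nv_sum_le)
        fix j assume "j \<in> {0..n}"
        then have "nv (fps_nth h j * fps_nth (h ^ i) (n - j)) * \<sigma> ^ n
            = (nv (fps_nth h j) * \<sigma> ^ j) * (nv (fps_nth (h ^ i) (n - j)) * \<sigma> ^ (n - j))"
          by (simp add: nv_mult mult_ac flip: power_add)
        also have "\<dots> \<le> omega * omega ^ i"
          using assms(3) omega_pos by (intro mult_mono h Suc) (auto simp: nv_nonneg)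
        finally show "nv (fps_nth h j * fps_nth (h ^ i) (n - j)) \<le> omega * omega ^ i / \<sigma> ^ n"
          using pos by (simp add: field_simps)
      qed (use omega_pos pos in simp)
      then show ?thesis
        using pos by (simp add: field_simps)
    qed
  qed
  have "nv (fps_nth (fps_exp 1 oo h) n) \<le> 1 / \<sigma> ^ n"
    unfolding fps_compose_nth
  proof (rule nv_sum_le)
    fix i assume "i \<in> {0..n}"
    have "nv (fps_nth (fps_exp 1) i * fps_nth (h ^ i) n) * \<sigma> ^ n
        = nv (fps_nth (h ^ i) n) * \<sigma> ^ n / nv (of_nat (fact i))"
      by (simp add: nv_mult nv_divide nv_1)
    also have "\<dots> \<le> 1"
      using order_trans[OF pow nv_fact_ge, of i n] omega_pos nv_fact_ge[of i]
      by (subst divide_le_eq_1_pos) (auto intro: less_le_trans[OF zero_less_power])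
    finally show "nv (fps_nth (fps_exp 1) i * fps_nth (h ^ i) n) \<le> 1 / \<sigma> ^ n"
      using pos by (simp add: field_simps)
  qed (use pos in simp)
  then show ?thesis
    using pos by (simp add: field_simps)
qed (simp only: mult_zero_right)

lemma bernoulli_p: "1 + v * (p - 1) \<le> p ^ v"
proof (induction v)
  case (Suc v)
  obtain q where q: "p = Suc q"
    using p_gt_1 by (metis less_imp_Suc_add plus_1_eq_Suc)
  have "1 + Suc v * q \<le> Suc q * (1 + v * q)"
    by (simp add: algebra_simps)
  also have "\<dots> \<le> p * p ^ v"
    using Suc unfolding q by (intro mult_left_mono) auto
  finally show ?case
    by (simp add: q)
qed simp

text \<open>For \<open>v = 1\<close> the inequality fails, which reflects the exceptional term of
  degree \<open>p\<close> of the primitive.\<close>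

lemma bernoulli_p_strong:
  assumes "p \<noteq> 2" "2 \<le> v"
  shows "1 + (v + 1) * (p - 1) \<le> p ^ v"
  using assms(2)
proof (induction v rule: dec_induct)
  case base
  obtain q where q: "p = q + 3"
    using assms(1) p_gt_1 by (metis One_nat_def Suc_leI le_add_diff_inverse2 le_neq_implies_less numeral_3_eq_3 numeral_2_eq_2)
  show ?case
    unfolding q by (simp add: algebra_simps power2_eq_square)
next
  case (step v)
  obtain q where q: "p = Suc q"
    using p_gt_1 by (metis less_imp_Suc_add plus_1_eq_Suc)
  have "1 + (Suc v + 1) * q \<le> Suc q * (1 + (v + 1) * q)"
    by (simp add: algebra_simps)
  also have "\<dots> \<le> p * p ^ v"
    using step.IH unfolding q by (intro mult_left_mono) auto
  finally show ?case
    by (simp add: q)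
qed

end

context gamma_log_deriv
begin

text \<open>The primitive of \<open>g\<close> without its term of degree \<open>p\<close>, which alone determines the radius of
  convergence of its exponential.\<close>

definition log_rest :: "'a fps" where
  "log_rest = Abs_fps (\<lambda>k. if k = 0 \<or> k = p then 0 else fps_nth g (k - 1) / of_nat k)"

text \<open>With j = k - 1, let |g_j| be at most p^e and let p^b be the power of \<open>p\<close>
  dividing \<open>k\<close>. The condition to check is (e + b)(p - 1) <= j. It fails at k = p, where
  e = b = 1 and j = p - 1; in the other degrees from 2 on it holds because \<open>j\<close> and
  \<open>k\<close> are not both multiples of \<open>p\<close>.\<close>

lemma log_rest_bound: "nv (fps_nth log_rest k) * omega ^ k \<le> omega"
proof -
  consider "k = 0 \<or> k = p" | "k = 1" | "2 \<le> k" "k \<noteq> p"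
    by linarith
  then show ?thesis
  proof cases
    case 1
    then show ?thesis
      using omega_pos by (auto simp: log_rest_def)
  next
    case 2
    then show ?thesis
      using coeff_0 omega_pos p_gt_1 by (simp add: log_rest_def mult_left_le_one_le nv_nonneg)
  next
    case 3
    define j where "j = k - 1"
    have j: "1 \<le> j" "k = Suc j"
      using 3 by (auto simp: j_def)
    obtain b m where k: "k = p ^ b * m" "\<not> p dvd m" "1 \<le> m" "nv (of_nat k) = (1 / real p) ^ b"
      using nat_p_decompose[of k] 3 by auto
    have nvk: "nv (fps_nth log_rest k) = nv (fps_nth g j) * real p ^ b"
      using 3 by (simp add: log_rest_def j_def nv_divide k(4) power_divide)
    have kge: "p ^ b \<le> k"
      by (rule p_power_le[OF k(1,3)])
    text \<open>Since \<open>p = omega ^ -(p - 1)\<close>, the bound is an inequality between exponents.\<close>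
    have main: "nv (fps_nth log_rest k) * omega ^ k \<le> omega"
      if e: "nv (fps_nth g j) \<le> real p ^ e" "(e + b) * (p - 1) \<le> j" for e
    proof -
      have "nv (fps_nth log_rest k) * omega ^ k \<le> real p ^ (e + b) * omega ^ k"
        unfolding nvk power_add using e(1) omega_pos by (intro mult_right_mono) auto
      also have "\<dots> \<le> real p ^ (e + b) * (omega ^ ((e + b) * (p - 1)) * omega)"
      proof (intro mult_left_mono)
        have "omega ^ k \<le> omega ^ Suc ((e + b) * (p - 1))"
          unfolding j(2) using e(2) omega_pos omega_less_1 by (intro power_decreasing) auto
        then show "omega ^ k \<le> omega ^ ((e + b) * (p - 1)) * omega"
          by (simp add: mult.commute)
      qed simp
      also have "omega ^ ((e + b) * (p - 1)) = (1 / real p) ^ (e + b)"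
        by (metis mult.commute omega_power power_mult)
      also have "real p ^ (e + b) * ((1 / real p) ^ (e + b) * omega) = omega"
        using p_gt_1 by (simp add: power_divide)
      finally show ?thesis .
    qed
    \<comment> \<open>The consecutive integers \<open>j\<close> and \<open>k\<close> cannot both be
      divisible by \<open>p\<close>, so losses from the coefficient of \<open>g\<close> and from the
      division by \<open>k\<close> do not combine.\<close>
    have one_zero: "a = 0 \<or> b = 0" if "j = p ^ a * l" for a l
    proof (rule ccontr)
      assume "\<not> ?thesis"
      then have "p dvd j" "p dvd k"
        using that k(1) by (auto intro: dvd_mult2 dvd_power)
      then have "p dvd 1"
        unfolding j(2) by (metis add.commute dvd_add_right_iff plus_1_eq_Suc)
      then show False
        using p_gt_1 by simp
    qed
    from j(1) show ?thesis
    proof (cases rule: coeff_decompose)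
      case (1 a l)
      show ?thesis
      proof (rule main[of "a + 1"])
        show "(a + 1 + b) * (p - 1) \<le> j"
        proof (cases "b = 0")
          case True
          have "p - 1 \<le> l"
            using 1(3,5) by (auto dest: dvd_imp_le)
          moreover have "a + 1 \<le> p ^ a"
          proof -
            have "a * 1 \<le> a * (p - 1)"
              using p_gt_1 by (intro mult_le_mono2) simp
            then show ?thesis
              using bernoulli_p[of a] by linarith
          qed
          ultimately show ?thesis
            unfolding 1(1) True add_0_right using mult_le_mono by blast
        next
          case False
          then have "a = 0"
            using one_zero 1(1) by blast
          show ?thesis
          proof (cases "2 \<le> b")
            case True
            then show ?thesis
              using bernoulli_p_strong[OF p_neq_2 True] kge j(2) \<open>a = 0\<close> by simp
          next
            case F: False
            then have "b = 1"
              using False by simp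
            \<comment> \<open>This is where \<open>k \<noteq> p\<close> enters: the next multiple
              \<open>2 * p\<close> already leaves enough room.\<close>
            then have "2 \<le> m"
              using k(1,3) 3(2) by (cases "m = 1") auto
            then have "p * 2 \<le> k"
              using k(1) \<open>b = 1\<close> by simp
            then show ?thesis
              using \<open>a = 0\<close> \<open>b = 1\<close> j(2) by simp
          qed
        qed
      qed (use 1(6) in simp)
    next
      case (2 a l)
      show ?thesis
      proof (rule main[OF 2(5)])
        show "(a + b) * (p - 1) \<le> j"
        proof (cases "b = 0")
          case True
          have "p ^ a \<le> j"
            by (rule p_power_le[OF 2(1,3)])
          then show ?thesis
            using bernoulli_p[of a] True by simp
        next
          case False
          then have "a = 0"
            using one_zero 2(1) by blast
          then show ?thesis
            using bernoulli_p[of b] kge j(2) by simp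
        qed
      qed
    qed
  qed
qed

text \<open>Multiplying \<open>F\<close> by exp(-\<open>log_rest\<close>), which converges on the
  open disc of radius \<open>omega\<close>, leaves D = exp(c X^p). If \<open>F\<close> converged
  beyond \<open>R0 < omega\<close>, the terms of \<open>D\<close> at radius \<open>R0\<close> would
  tend to 0, but along the degrees \<open>p * p ^ k\<close> they all have size
  \<open>omega\<close>.\<close>

lemma taylor_radius_upper:
  assumes F0: "fps_nth F 0 = 1" and F: "fps_deriv F = g * F" and disc: "F \<in> disc_functions nv R"
  shows "R \<le> omega * crit_radius 0"
proof (rule ccontr)
  define R0 where "R0 = omega * crit_radius 0"
  assume "\<not> R \<le> omega * crit_radius 0"
  then have R: "R0 < R"
    by (simp add: R0_def)
  have R0: "0 < R0" "R0 < omega"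
    unfolding R0_def using omega_pos crit_radius_pos[of 0] crit_radius_less_1[of 0]
    by (auto simp: mult_less_cancel_left2)
  define E where "E = fps_exp 1 oo (- log_rest)"
  have rest0: "fps_nth (- log_rest) 0 = 0"
    by (simp add: log_rest_def)
  have E0: "fps_nth E 0 = 1"
    by (simp add: E_def)
  have E': "fps_deriv E = E * (- fps_deriv log_rest)"
    unfolding E_def by (subst fps_compose_deriv[OF rest0]) simp
  have Ebound: "nv (fps_nth E n) * omega ^ n \<le> 1" for n
    unfolding E_def using omega_pos log_rest_bound by (intro exp_compose_bound rest0) (auto simp: nv_minus)
  have "E \<in> disc_functions nv omega"
    unfolding disc_functions_def
  proof (intro CollectI allI impI)
    fix \<rho> assume \<rho>: "0 \<le> \<rho> \<and> \<rho> < omega"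
    then have "(\<lambda>n. (\<rho> / omega) ^ n) \<longlonglongrightarrow> 0"
      by (intro LIMSEQ_realpow_zero) auto
    then show "(\<lambda>n. nv (fps_nth E n) * \<rho> ^ n) \<longlonglongrightarrow> 0"
    proof (rule Lim_null_comparison[rotated], intro always_eventually allI)
      fix n
      have "nv (fps_nth E n) * \<rho> ^ n = (nv (fps_nth E n) * omega ^ n) * (\<rho> / omega) ^ n"
        using omega_pos by (simp add: power_divide)
      also have "\<dots> \<le> 1 * (\<rho> / omega) ^ n"
        using \<rho> by (intro mult_right_mono Ebound) auto
      finally show "norm (nv (fps_nth E n) * \<rho> ^ n) \<le> (\<rho> / omega) ^ n"
        using \<rho> by (simp add: nv_nonneg)
    qed
  qed
  define D where "D = F * E"
  define c where "c = fps_nth g (p - 1) / of_nat p"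
  have "D \<in> disc_functions nv (min R omega)"
    unfolding D_def using disc \<open>E \<in> _\<close> by (intro disc_functions_mult) (auto elim: disc_functions_mono)
  then have lim: "(\<lambda>n. nv (fps_nth D n) * R0 ^ n) \<longlonglongrightarrow> 0"
    using R R0 by (simp add: disc_functions_def)
  have D0: "fps_nth D 0 = 1"
    by (simp add: D_def F0 E0)
  have "fps_deriv D = (g - fps_deriv log_rest) * D"
    by (simp add: D_def F E' algebra_simps)
  also have "g - fps_deriv log_rest = fps_const (of_nat p * c) * fps_X ^ (p - 1)"
    by (rule fps_ext) (use p_gt_1 in \<open>auto simp: log_rest_def c_def fps_X_power_nth simp flip: of_nat_Suc\<close>)
  finally have D': "fps_deriv D = fps_const (of_nat p * c) * (fps_X ^ (p - 1) * D)"
    by (simp add: mult.assoc)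
  \<comment> \<open>The equation for \<open>D\<close> is solved by exp(c X^p); comparing degrees in
    steps of \<open>p\<close> gives its coefficients.\<close>
  have Dn: "fps_nth D (p * n) = c ^ n / of_nat (fact n)" for n
  proof (induction n)
    case (Suc n)
    have eq: "p * n + (p - 1) + 1 = p * Suc n"
      using p_gt_1 by simp
    have "of_nat (p * Suc n) * fps_nth D (p * Suc n) = fps_nth (fps_deriv D) (p * n + (p - 1))"
      unfolding eq[symmetric] by simp
    also have "\<dots> = of_nat p * c * fps_nth D (p * n)"
      unfolding D' using p_gt_1 by (simp add: fps_X_power_mult_nth)
    finally have "of_nat p * (of_nat (Suc n) * fps_nth D (p * Suc n)) = of_nat p * (c * fps_nth D (p * n))"
      by (simp only: of_nat_mult mult.assoc)
    then have "of_nat (Suc n) * fps_nth D (p * Suc n) = c * fps_nth D (p * n)"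
      using p_gt_1 by (subst (asm) mult_left_cancel) auto
    then have "fps_nth D (p * Suc n) = c * fps_nth D (p * n) / of_nat (Suc n)"
      by (simp only: nonzero_eq_divide_eq of_nat_neq_0 mult.commute not_False_eq_True)
    then show ?case
      unfolding Suc by (simp only: fact_Suc of_nat_mult of_nat_id power_Suc times_divide_eq_right
          divide_divide_eq_left mult.commute[of "of_nat (Suc n)"])
  qed (simp add: D0)
  have "nv (of_nat (p - 1)) = 1"
    using p_gt_1 by (intro nv_of_nat_unit) (auto dest: dvd_imp_le)
  then have "nv (fps_nth g (p - 1)) = real p"
    using coeff_dvd[of "p - 1"] p_gt_1 by (simp add: nv_mult)
  then have nvc: "nv c = real p ^ 2"
    by (simp add: c_def nv_divide nv_p power2_eq_square)
  \<comment> \<open>\<open>R0\<close> is the radius at which |c| R0^p = omega, so the term of degree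
    \<open>p * n\<close> has size omega^n / |n!|.\<close>
  have "R0 ^ p = omega * omega ^ (p - 1) * crit_radius 0 ^ p"
    using p_gt_1 by (simp add: R0_def power_mult_distrib flip: power_Suc)
  then have "real p ^ 2 * R0 ^ p = omega"
    using p_gt_1 unfolding omega_power crit_radius_0_power by (simp add: power2_eq_square)
  then have "nv (fps_nth D (p * n)) * R0 ^ (p * n) = omega ^ n / nv (of_nat (fact n))" for n
    unfolding Dn by (simp add: nv_divide nv_power nvc power_mult flip: power_mult_distrib)
  moreover have "omega ^ (p ^ k) / nv (of_nat (fact (p ^ k))) = omega" for k
  proof -
    have "nv (of_nat (fact (p ^ k))) \<noteq> 0"
      using nv_fact_ge[of "p ^ k"] omega_pos by (metis not_le zero_less_power)
    then show ?thesis
      by (simp add: nv_fact_power[symmetric])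
  qed
  ultimately have "nv (fps_nth D (p * p ^ k)) * R0 ^ (p * p ^ k) = omega" for k
    by simp
  moreover have "strict_mono (\<lambda>k. p * p ^ k)"
    using p_gt_1 by (intro strict_monoI) simp
  ultimately have "(\<lambda>k :: nat. omega) \<longlonglongrightarrow> 0"
    using LIMSEQ_subseq_LIMSEQ[OF lim, of "\<lambda>k. p * p ^ k"] by (simp add: comp_def)
  then show False
    using omega_pos by (simp add: LIMSEQ_const_iff)
qed

end

section \<open>Gauss points\<close>

context valued_field
begin

lemma finite_range_poly_terms: "finite (range (\<lambda>n. nv (fps_nth (fps_of_poly P) n) * \<rho> ^ n))"
proof (rule finite_subset)
  show "range (\<lambda>n. nv (fps_nth (fps_of_poly P) n) * \<rho> ^ n)
      \<subseteq> insert 0 ((\<lambda>n. nv (fps_nth (fps_of_poly P) n) * \<rho> ^ n) ` {..degree P})"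
  proof safe
    fix n
    assume "nv (fps_nth (fps_of_poly P) n) * \<rho> ^ n \<notin> (\<lambda>n. nv (fps_nth (fps_of_poly P) n) * \<rho> ^ n) ` {..degree P}"
    then have "\<not> n \<le> degree P"
      by blast
    then show "nv (fps_nth (fps_of_poly P) n) * \<rho> ^ n = 0"
      by (simp add: coeff_eq_0)
  qed
qed simp

lemma gauss_point_upper: "nv (Polynomial.coeff P n) * \<rho> ^ n \<le> gauss_point nv \<rho> P"
  using cSUP_upper[OF UNIV_I bdd_above_finite[OF finite_range_poly_terms], of P n \<rho>]
  by (simp add: gauss_point_def gauss_norm_def)

lemma gauss_point_least:
  assumes "\<And>n. nv (Polynomial.coeff P n) * \<rho> ^ n \<le> B"
  shows "gauss_point nv \<rho> P \<le> B"
  unfolding gauss_point_def gauss_norm_def using assms by (intro cSUP_least) auto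

lemma gauss_point_attained: "\<exists>n. gauss_point nv \<rho> P = nv (Polynomial.coeff P n) * \<rho> ^ n"
proof -
  let ?X = "range (\<lambda>n. nv (fps_nth (fps_of_poly P) n) * \<rho> ^ n)"
  have "gauss_point nv \<rho> P = Max ?X"
    unfolding gauss_point_def gauss_norm_def by (rule cSup_eq_Max[OF finite_range_poly_terms]) blast
  moreover have "Max ?X \<in> ?X"
    by (rule Max_in[OF finite_range_poly_terms]) blast
  ultimately have "gauss_point nv \<rho> P \<in> ?X"
    by simp
  then show ?thesis
    by auto
qed

lemma gauss_point_eqI:
  assumes "nv (Polynomial.coeff P n) * \<rho> ^ n = B" "\<And>n. nv (Polynomial.coeff P n) * \<rho> ^ n \<le> B"
  shows "gauss_point nv \<rho> P = B"
  using gauss_point_upper[of P n \<rho>] gauss_point_least[of P \<rho> B] assms by fastforce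

lemma gauss_point_nonneg: "0 \<le> gauss_point nv \<rho> P"
  using gauss_point_upper[of P 0 \<rho>] nv_nonneg[of "Polynomial.coeff P 0"] by simp

lemma gauss_point_least_index:
  obtains i where "gauss_point nv \<rho> P = nv (Polynomial.coeff P i) * \<rho> ^ i"
    "\<And>k. k < i \<Longrightarrow> nv (Polynomial.coeff P k) * \<rho> ^ k < gauss_point nv \<rho> P"
proof -
  let ?Q = "\<lambda>i. gauss_point nv \<rho> P = nv (Polynomial.coeff P i) * \<rho> ^ i"
  have "?Q (LEAST i. ?Q i)"
    using gauss_point_attained by (rule LeastI_ex)
  moreover have "nv (Polynomial.coeff P k) * \<rho> ^ k < gauss_point nv \<rho> P" if "k < (LEAST i. ?Q i)" for k
    using not_less_Least[OF that] gauss_point_upper[of P k \<rho>] by simp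
  ultimately show ?thesis
    by (rule that)
qed

text \<open>Gauss's lemma: for the least indices \<open>i\<close>, \<open>j\<close> at which the norms of \<open>P\<close> and \<open>Q\<close> are
  attained, exactly one summand of the coefficient of degree \<open>i + j\<close> has maximal value.\<close>

lemma gauss_point_mult:
  assumes "0 \<le> \<rho>"
  shows "gauss_point nv \<rho> (P * Q) = gauss_point nv \<rho> P * gauss_point nv \<rho> Q" (is "?l = ?A * ?B")
proof -
  have term_eq: "nv (Polynomial.coeff P i * Polynomial.coeff Q (n - i)) * \<rho> ^ n
      = (nv (Polynomial.coeff P i) * \<rho> ^ i) * (nv (Polynomial.coeff Q (n - i)) * \<rho> ^ (n - i))" if "i \<le> n" for i n
    using that by (simp add: nv_mult mult_ac flip: power_add)
  have term_le: "nv (Polynomial.coeff P i * Polynomial.coeff Q (n - i)) * \<rho> ^ n \<le> ?A * ?B" if "i \<le> n" for i n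
    unfolding term_eq[OF that] using assms
    by (intro mult_mono gauss_point_upper) (auto simp: nv_nonneg gauss_point_nonneg)
  have upper: "nv (Polynomial.coeff (P * Q) n) * \<rho> ^ n \<le> ?A * ?B" for n
  proof (cases "\<rho> ^ n = 0")
    case True
    then show ?thesis
      by (simp only: mult_zero_right mult_nonneg_nonneg gauss_point_nonneg)
  next
    case False
    then have pos: "0 < \<rho> ^ n"
      using zero_le_power[OF assms, of n] by linarith
    have "nv (Polynomial.coeff (P * Q) n) \<le> ?A * ?B / \<rho> ^ n"
      unfolding coeff_mult using term_le pos
      by (intro nv_sum_le) (auto simp: pos_le_divide_eq gauss_point_nonneg)
    then show ?thesis
      using pos by (simp add: pos_le_divide_eq)
  qed
  show ?thesis
  proof (cases "?A = 0 \<or> ?B = 0")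
    case True
    then have "?l \<le> 0"
      using upper by (intro gauss_point_least) auto
    then show ?thesis
      using True gauss_point_nonneg[of \<rho> "P * Q"] by auto
  next
    case False
    then have AB: "0 < ?A" "0 < ?B"
      using gauss_point_nonneg[of \<rho> P] gauss_point_nonneg[of \<rho> Q] by auto
    obtain i where i: "?A = nv (Polynomial.coeff P i) * \<rho> ^ i"
        "\<And>k. k < i \<Longrightarrow> nv (Polynomial.coeff P k) * \<rho> ^ k < ?A"
      using gauss_point_least_index[of \<rho> P] by blast
    obtain j where j: "?B = nv (Polynomial.coeff Q j) * \<rho> ^ j"
        "\<And>k. k < j \<Longrightarrow> nv (Polynomial.coeff Q k) * \<rho> ^ k < ?B"
      using gauss_point_least_index[of \<rho> Q] by blast
    let ?n = "i + j"
    have "\<rho> ^ i \<noteq> 0" "\<rho> ^ j \<noteq> 0"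
      using AB unfolding i(1) j(1) by (metis less_irrefl mult_zero_right)+
    then have "0 < \<rho> ^ i" "0 < \<rho> ^ j"
      using zero_le_power[OF assms, of i] zero_le_power[OF assms, of j] by linarith+
    then have pos: "0 < \<rho> ^ ?n"
      unfolding power_add by (rule mult_pos_pos)
    let ?f = "\<lambda>k. Polynomial.coeff P k * Polynomial.coeff Q (?n - k)"
    have main_mult: "nv (?f i) * \<rho> ^ ?n = ?A * ?B"
      using term_eq[of i ?n] i(1) j(1) by simp
    then have main: "nv (?f i) = ?A * ?B / \<rho> ^ ?n"
      using pos by (metis nonzero_mult_div_cancel_right order_less_irrefl)
    have "nv (sum ?f ({..?n} - {i})) < ?A * ?B / \<rho> ^ ?n"
    proof (rule nv_sum_less)
      fix k assume k: "k \<in> {..?n} - {i}"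
      then consider "k < i" | "k \<le> ?n" "?n - k < j"
        by fastforce
      then have "nv (?f k) * \<rho> ^ ?n < ?A * ?B"
      proof cases
        case 1
        have "nv (?f k) * \<rho> ^ ?n \<le> (nv (Polynomial.coeff P k) * \<rho> ^ k) * ?B"
          unfolding term_eq[OF less_imp_le[OF trans_less_add1[OF 1]]] using assms
          by (intro mult_left_mono gauss_point_upper) (simp add: nv_nonneg)
        also have "\<dots> < ?A * ?B"
          using i(2)[OF 1] AB by (intro mult_strict_right_mono)
        finally show ?thesis .
      next
        case 2
        have "nv (?f k) * \<rho> ^ ?n \<le> ?A * (nv (Polynomial.coeff Q (?n - k)) * \<rho> ^ (?n - k))"
          unfolding term_eq[OF 2(1)] using assms
          by (intro mult_right_mono gauss_point_upper) (simp add: nv_nonneg)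
        also have "\<dots> < ?A * ?B"
          using j(2)[OF 2(2)] AB by (intro mult_strict_left_mono)
        finally show ?thesis .
      qed
      then show "nv (?f k) < ?A * ?B / \<rho> ^ ?n"
        using pos by (simp add: pos_less_divide_eq)
    qed (use AB pos in simp)
    then have "nv (sum ?f ({..?n} - {i}) + ?f i) = ?A * ?B / \<rho> ^ ?n"
      using nv_add_eq_right main by metis
    moreover have "Polynomial.coeff (P * Q) ?n = sum ?f ({..?n} - {i}) + ?f i"
      unfolding coeff_mult by (simp add: sum.remove[of "{..?n}" i] add.commute)
    ultimately have "nv (Polynomial.coeff (P * Q) ?n) * \<rho> ^ ?n = ?A * ?B"
      using main main_mult by simp
    then show ?thesis
      using upper by (rule gauss_point_eqI)
  qed
qed

lemma gauss_point_X: "0 \<le> \<rho> \<Longrightarrow> gauss_point nv \<rho> [:0, 1:] = \<rho>"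
  by (rule gauss_point_eqI[where n = 1]) (auto simp: nv_1 coeff_pCons split: nat.split)

lemma gauss_point_in_open_unit_disc:
  assumes "0 \<le> \<rho>" "\<rho> < 1"
  shows "gauss_point nv \<rho> \<in> open_unit_disc nv"
  unfolding open_unit_disc_def
proof (intro CollectI conjI allI)
  show "gauss_point nv \<rho> [:a:] = nv a" for a
    by (rule gauss_point_eqI[where n = 0]) (auto simp: coeff_pCons nv_nonneg split: nat.split)
  show "gauss_point nv \<rho> (P + Q) \<le> max (gauss_point nv \<rho> P) (gauss_point nv \<rho> Q)" for P Q
  proof (rule gauss_point_least)
    fix n
    have "nv (Polynomial.coeff (P + Q) n) * \<rho> ^ n
        \<le> max (nv (Polynomial.coeff P n)) (nv (Polynomial.coeff Q n)) * \<rho> ^ n"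
      using assms by (intro mult_right_mono) (auto simp: nv_add)
    also have "\<dots> \<le> max (gauss_point nv \<rho> P) (gauss_point nv \<rho> Q)"
      using gauss_point_upper[of P n \<rho>] gauss_point_upper[of Q n \<rho>] by (auto simp: max_def)
    finally show "nv (Polynomial.coeff (P + Q) n) * \<rho> ^ n \<le> max (gauss_point nv \<rho> P) (gauss_point nv \<rho> Q)" .
  qed
qed (use assms in \<open>auto simp: gauss_point_nonneg gauss_point_mult gauss_point_X\<close>)

end

section \<open>Solutions of first order linear differential equations\<close>

text \<open>With \<open>e n = 1 / (n + 1)\<close>, these are the coefficients of the solution of \<open>y' = G * y\<close> with
  constant term \<open>1\<close>, where \<open>c\<close> are the coefficients of \<open>G\<close>. The factors \<open>e\<close> are a parameter so
  that the \<open>c i\<close> may themselves be power series.\<close>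

fun ode_coeff :: "(nat \<Rightarrow> 'a::comm_ring_1) \<Rightarrow> (nat \<Rightarrow> 'a) \<Rightarrow> nat \<Rightarrow> 'a" where
  "ode_coeff e c 0 = 1"
| "ode_coeff e c (Suc n) = e n * (\<Sum>i\<le>n. c i * ode_coeff e c (n - i))"

abbreviation inverse_Suc :: "nat \<Rightarrow> 'a::field" where
  "inverse_Suc n \<equiv> inverse (of_nat (Suc n))"

lemma ode_coeff_unique:
  fixes y G :: "'a::field fps"
  assumes "\<And>n. of_nat (Suc n) \<noteq> (0 :: 'a)" and y: "fps_deriv y = G * y"
  shows "fps_nth y n = fps_nth y 0 * ode_coeff inverse_Suc (fps_nth G) n"
proof (induction n rule: less_induct)
  case (less n)
  show ?case
  proof (cases n)
    case (Suc m)
    have "of_nat (Suc m) * fps_nth y (Suc m) = (\<Sum>i\<le>m. fps_nth G i * fps_nth y (m - i))"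
      using arg_cong[OF y, of "\<lambda>f. fps_nth f m"] by (simp add: fps_mult_nth atMost_atLeast0)
    also have "\<dots> = (\<Sum>i\<le>m. fps_nth G i * (fps_nth y 0 * ode_coeff inverse_Suc (fps_nth G) (m - i)))"
      using less Suc by (intro sum.cong refl) (metis diff_le_self less_Suc_eq_le)
    also have "\<dots> = fps_nth y 0 * (\<Sum>i\<le>m. fps_nth G i * ode_coeff inverse_Suc (fps_nth G) (m - i))"
      by (simp add: sum_distrib_left mult_ac)
    finally have "inverse (of_nat (Suc m)) * (of_nat (Suc m) * fps_nth y (Suc m))
        = fps_nth y 0 * (inverse (of_nat (Suc m)) * (\<Sum>i\<le>m. fps_nth G i * ode_coeff inverse_Suc (fps_nth G) (m - i)))"
      by (simp only: mult.left_commute)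
    then show ?thesis
      using assms(1)[of m] unfolding Suc mult.assoc[symmetric] by (simp del: of_nat_Suc)
  qed simp
qed

lemma ode_coeff_solution:
  fixes G :: "'a::field fps"
  assumes "\<And>n. of_nat (Suc n) \<noteq> (0 :: 'a)"
  shows "fps_deriv (Abs_fps (ode_coeff inverse_Suc (fps_nth G))) = G * Abs_fps (ode_coeff inverse_Suc (fps_nth G))"
proof (rule fps_ext)
  fix n
  have "of_nat (Suc n) * (inverse (of_nat (Suc n)) * s) = s" for s :: 'a
    using assms[of n] by (simp add: mult.assoc[symmetric] del: of_nat_Suc)
  then show "fps_nth (fps_deriv (Abs_fps (ode_coeff inverse_Suc (fps_nth G)))) n
      = fps_nth (G * Abs_fps (ode_coeff inverse_Suc (fps_nth G))) n"
    by (simp add: fps_mult_nth atMost_atLeast0 del: of_nat_Suc)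
qed

context valued_field
begin

text \<open>Multiplying by the factorial removes the division from the recurrence. The earlier
  coefficients then carry n! instead of (n - i)!, and the integer quotient of the two can only
  decrease the absolute value.\<close>

lemma ode_coeff_Suc_fact:
  fixes c :: "nat \<Rightarrow> 'a"
  assumes "of_nat (Suc n) \<noteq> (0 :: 'a)"
  shows "ode_coeff inverse_Suc c (Suc n) * of_nat (fact (Suc n))
    = (\<Sum>i\<le>n. c i * (ode_coeff inverse_Suc c (n - i) * of_nat (fact n)))"
proof -
  let ?S = "\<Sum>i\<le>n. c i * ode_coeff inverse_Suc c (n - i)"
  have "ode_coeff inverse_Suc c (Suc n) * of_nat (fact (Suc n))
      = (inverse (of_nat (Suc n)) * of_nat (Suc n)) * (?S * of_nat (fact n))"
    by (simp only: ode_coeff.simps fact_Suc of_nat_mult of_nat_id mult_ac)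
  also have "\<dots> = ?S * of_nat (fact n)"
    unfolding left_inverse[OF assms] mult_1_left ..
  also have "\<dots> = (\<Sum>i\<le>n. c i * (ode_coeff inverse_Suc c (n - i) * of_nat (fact n)))"
    by (simp only: sum_distrib_right mult.assoc)
  finally show ?thesis .
qed

lemma ode_term_le:
  assumes A: "0 < A" and "i \<le> n" and c: "nv c \<le> C" and u: "nv (u * of_nat (fact (n - i))) \<le> A ^ (n - i)"
  shows "nv (c * (u * of_nat (fact n))) \<le> C * A ^ (n - i)"
proof -
  have C: "0 \<le> C"
    using c nv_nonneg order_trans by blast
  have "nv (u * of_nat (fact n)) \<le> nv (u * of_nat (fact (n - i)))"
    unfolding nv_mult using fact_dvd[of "n - i" n] by (intro mult_left_mono nv_of_nat_dvd_le nv_nonneg) auto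
  then have "nv (u * of_nat (fact n)) \<le> A ^ (n - i)"
    using u by simp
  then show ?thesis
    unfolding nv_mult[of c] using c C by (intro mult_mono) (auto simp: nv_nonneg)
qed

lemma ode_coeff_le:
  assumes "\<And>n. of_nat (Suc n) \<noteq> (0 :: 'a)" and A: "0 < A" and c: "\<And>i. nv (c i) \<le> A ^ Suc i"
  shows "nv (ode_coeff inverse_Suc c n * of_nat (fact n)) \<le> A ^ n"
proof (induction n rule: less_induct)
  case (less n)
  show ?case
  proof (cases n)
    case 0
    then show ?thesis
      by (simp add: nv_1)
  next
    case (Suc m)
    show ?thesis
      unfolding Suc ode_coeff_Suc_fact[OF assms(1)]
    proof (rule nv_sum_le)
      fix i assume "i \<in> {..m}"
      then have "nv (c i * (ode_coeff inverse_Suc c (m - i) * of_nat (fact m))) \<le> A ^ Suc i * A ^ (m - i)"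
        using less[of "m - i"] Suc by (intro ode_term_le A c) auto
      also have "A ^ Suc i * A ^ (m - i) = A ^ Suc m"
        using \<open>i \<in> {..m}\<close> by (simp flip: power_add)
      finally show "nv (c i * (ode_coeff inverse_Suc c (m - i) * of_nat (fact m))) \<le> A ^ Suc m" .
    qed (use A in simp)
  qed
qed

text \<open>The summand \<open>i = 0\<close> has size exactly \<open>A * A ^ m\<close>; all others
  are strictly smaller, so by the ultrametric inequality no cancellation occurs.\<close>

lemma ode_coeff_eq:
  assumes "\<And>n. of_nat (Suc n) \<noteq> (0 :: 'a)" and A: "0 < A"
    and c0: "nv (c 0) = A" and c: "\<And>i. 1 \<le> i \<Longrightarrow> nv (c i) < A ^ Suc i"
  shows "nv (ode_coeff inverse_Suc c n * of_nat (fact n)) = A ^ n"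
proof (induction n)
  case 0
  then show ?case
    by (simp add: nv_1)
next
  case (Suc m)
  have "nv (c i) \<le> A ^ Suc i" for i
    using c0 c[of i] by (cases i) auto
  note le = ode_coeff_le[OF assms(1) A this]
  let ?f = "\<lambda>i. c i * (ode_coeff inverse_Suc c (m - i) * of_nat (fact m))"
  have 0: "nv (?f 0) = A ^ Suc m"
    using Suc by (simp add: nv_mult[of "c 0"] c0)
  have "nv (sum ?f ({..m} - {0})) < A ^ Suc m"
  proof (rule nv_sum_less)
    fix i assume i: "i \<in> {..m} - {0}"
    then have "nv (?f i) \<le> nv (c i) * A ^ (m - i)"
      by (intro ode_term_le A le) auto
    also have "\<dots> < A ^ Suc i * A ^ (m - i)"
      using c[of i] i A by (intro mult_strict_right_mono) auto
    also have "A ^ Suc i * A ^ (m - i) = A ^ Suc m"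
      using i by (simp flip: power_add)
    finally show "nv (?f i) < A ^ Suc m" .
  qed (use A in simp)
  then have "nv (sum ?f ({..m} - {0})) < nv (?f 0)"
    unfolding 0 .
  from nv_add_eq_right[OF this] have "nv (sum ?f ({..m} - {0}) + ?f 0) = A ^ Suc m"
    unfolding 0 .
  moreover have "sum ?f {..m} = sum ?f ({..m} - {0}) + ?f 0"
    by (simp add: sum.remove[of "{..m}" 0] add.commute)
  ultimately show ?case
    unfolding ode_coeff_Suc_fact[OF assms(1)] by simp
qed

end

context complete_valued_field
begin

text \<open>The solution at \<open>t\<close> with constant term 1, a power series in T - t; every
  other formal solution at \<open>t\<close> is a multiple of it in characteristic 0.\<close>

definition local_solution :: "'a \<Rightarrow> 'a fps \<Rightarrow> 'a fps" where
  "local_solution t g = Abs_fps (ode_coeff inverse_Suc (fps_nth (taylor_shift t g)))"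

lemma fps_deriv_eq_hasse_deriv: "fps_deriv f = hasse_deriv 1 f"
  by (rule fps_ext) (simp add: hasse_deriv_def)

lemma disc_functions_shift_sums:
  assumes g: "g \<in> disc_functions nv R" and t: "nv t < R" and s: "nv s < R"
  shows "fps_sums_to nv (taylor_shift t g) s (fps_value nv g (t + s))"
proof -
  let ?\<rho> = "max (nv t) (nv s)"
  have "(\<lambda>k. nv (fps_nth g k) * ?\<rho> ^ k) \<longlonglongrightarrow> 0"
    using g t s by (auto simp: disc_functions_def le_max_iff_disj nv_nonneg)
  moreover have "nv (t + s) < R"
    using nv_add[of t s] t s by auto
  then have "fps_sums_to nv g (t + s) (fps_value nv g (t + s))"
    by (rule disc_functions_sums[OF g])
  ultimately show ?thesis
    by (intro fps_sums_to_taylor_shift[where \<rho> = ?\<rho>]) auto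
qed

lemma trivial_on_disc_local_solution:
  assumes char: "\<And>n. of_nat (Suc n) \<noteq> (0 :: 'a)" and g: "g \<in> disc_functions nv 1" and t: "nv t < 1"
    and R: "R \<le> 1" and y: "local_solution t g \<in> disc_functions nv R"
  shows "trivial_on_disc nv g t R"
  unfolding trivial_on_disc_def
proof (intro bexI[OF _ y] conjI allI impI)
  let ?y = "local_solution t g"
  have "fps_nth ?y 0 = 1"
    by (simp add: local_solution_def)
  then show "?y \<noteq> 0"
    by auto
  fix z assume z: "nv (z - t) < R"
  have "fps_deriv ?y = taylor_shift t g * ?y"
    unfolding local_solution_def by (rule ode_coeff_solution[OF char])
  moreover have "fps_sums_to nv (taylor_shift t g) (z - t) (fps_value nv g z)"
    using disc_functions_shift_sums[OF g t, of "z - t"] z R by simp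
  ultimately show "fps_value nv (fps_deriv ?y) (z - t) = fps_value nv g z * fps_value nv ?y (z - t)"
    using fps_value_eqI fps_sums_to_mult disc_functions_sums[OF y z] by metis
qed

text \<open>\<open>trivial_on_disc\<close> states the equation pointwise. The identity theorem turns
  it into a formal equation, whose solutions are determined by their constant term; that of a
  nonzero \<open>y\<close> is nonzero, so \<open>y\<close> and \<open>local_solution\<close>
  converge alike.\<close>

lemma local_solution_if_trivial_on_disc:
  assumes char: "\<And>n. of_nat (Suc n) \<noteq> (0 :: 'a)" and g: "g \<in> disc_functions nv 1" and t: "nv t < 1"
    and \<pi>: "0 < nv \<pi>" "nv \<pi> < 1" and R: "0 < R" and triv: "trivial_on_disc nv g t R"
  shows "local_solution t g \<in> disc_functions nv R"
proof -
  obtain y where y: "y \<in> disc_functions nv R" "y \<noteq> 0"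
    and eq: "\<And>z. nv (z - t) < R \<Longrightarrow>
      fps_value nv (fps_deriv y) (z - t) = fps_value nv g z * fps_value nv y (z - t)"
    using triv unfolding trivial_on_disc_def by blast
  have y': "fps_deriv y \<in> disc_functions nv R"
    unfolding fps_deriv_eq_hasse_deriv by (rule disc_functions_hasse_deriv[OF y(1)])
  have zero: "fps_sums_to nv (fps_deriv y - taylor_shift t g * y) s 0" if s: "nv s < min R 1" for s
  proof -
    have "fps_sums_to nv (fps_deriv y) s (fps_value nv (fps_deriv y) s)"
      using s by (intro disc_functions_sums[OF y']) auto
    moreover have "fps_sums_to nv (taylor_shift t g * y) s (fps_value nv g (t + s) * fps_value nv y s)"
      using s t by (intro fps_sums_to_mult disc_functions_shift_sums[OF g] disc_functions_sums[OF y(1)]) auto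
    ultimately show ?thesis
      using fps_sums_to_diff eq[of "t + s"] s by fastforce
  qed
  obtain m where m: "nv \<pi> ^ m < min R 1"
    using real_arch_pow_inv[of "min R 1" "nv \<pi>"] R \<pi> by auto
  have "\<pi> ^ m \<noteq> 0"
    using \<pi>(1) by (simp add: nv_pos_iff)
  have "fps_deriv y - taylor_shift t g * y = 0"
  proof (rule fps_eq_0_if_sums_to_0[OF zero \<open>\<pi> ^ m \<noteq> 0\<close> \<pi> _ zero])
    show "nv (\<pi> ^ m) < min R 1" "0 < min R 1"
      using m R by (simp_all add: nv_power)
  qed
  then have y_ode: "fps_deriv y = taylor_shift t g * y"
    by simp
  have nth: "fps_nth y n = fps_nth y 0 * fps_nth (local_solution t g) n" for n
    unfolding local_solution_def fps_nth_Abs_fps by (rule ode_coeff_unique[OF char y_ode])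
  have "y = 0" if "fps_nth y 0 = 0"
  proof (rule fps_ext)
    show "fps_nth y n = fps_nth 0 n" for n
      using nth[of n] that by simp
  qed
  then have "fps_nth y 0 \<noteq> 0"
    using y(2) by blast
  then have "nv (fps_nth (local_solution t g) n) * \<rho> ^ n = inverse (nv (fps_nth y 0)) * (nv (fps_nth y n) * \<rho> ^ n)" for n \<rho>
    by (simp add: nth[of n] nv_mult nv_eq_0_iff)
  note eq = this
  show ?thesis
    unfolding disc_functions_def
  proof (intro CollectI allI impI)
    fix \<rho> :: real assume "0 \<le> \<rho> \<and> \<rho> < R"
    then show "(\<lambda>n. nv (fps_nth (local_solution t g) n) * \<rho> ^ n) \<longlonglongrightarrow> 0"
      unfolding eq using y(1) by (intro tendsto_mult_right_zero) (simp add: disc_functions_def)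
  qed
qed

text \<open>Reduces the radius to the convergence of one series. The required inclusion in the unit
  disc follows from \<open>nv t < 1\<close> and \<open>R \<le> 1\<close> by the ultrametric
  inequality.\<close>

lemma solution_radius_eqI:
  assumes char: "\<And>n. of_nat (Suc n) \<noteq> (0 :: 'a)" and g: "g \<in> disc_functions nv 1" and t: "nv t < 1"
    and \<pi>: "0 < nv \<pi>" "nv \<pi> < 1" and R: "0 < R" "R \<le> 1"
    and conv: "local_solution t g \<in> disc_functions nv R"
    and div: "\<And>R'. local_solution t g \<in> disc_functions nv R' \<Longrightarrow> R' \<le> R"
  shows "solution_radius nv g t = R"
  unfolding solution_radius_def
proof (rule Greatest_equality)
  have "nv z < 1" if "nv (z - t) < R" for z
    using that nv_add[of "z - t" t] t R by auto
  then show "0 < R \<and> {z. nv (z - t) < R} \<subseteq> {z. nv z < 1} \<and> trivial_on_disc nv g t R"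
    using trivial_on_disc_local_solution[OF char g t R(2) conv] R by auto
next
  fix R' assume "0 < R' \<and> {z. nv (z - t) < R'} \<subseteq> {z. nv z < 1} \<and> trivial_on_disc nv g t R'"
  then show "R' \<le> R"
    using local_solution_if_trivial_on_disc[OF char g t \<pi>] div by blast
qed

end

section \<open>Radii at the Gauss points\<close>

context big_field_extension
begin

lemma embedding_add: "\<iota> (a + b) = \<iota> a + \<iota> b" and embedding_mult: "\<iota> (a * b) = \<iota> a * \<iota> b"
  and embedding_1: "\<iota> 1 = 1"
  using embedding by (auto simp: field_embedding_def)

lemma embedding_0: "\<iota> 0 = 0"
  using embedding_add[of 0 0] by (metis add_0_right add_left_cancel)

lemma embedding_sum: "\<iota> (sum f A) = (\<Sum>i\<in>A. \<iota> (f i))"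
  by (induction A rule: infinite_finite_induct) (auto simp: embedding_0 embedding_add)

lemma embedding_of_nat: "\<iota> (of_nat n) = of_nat n"
  by (induction n) (auto simp: embedding_0 embedding_add embedding_1)

lemma embedding_inverse: "\<iota> (inverse a) = inverse (\<iota> a)"
proof (cases "a = 0")
  case False
  then have "\<iota> a * \<iota> (inverse a) = 1"
    by (metis embedding_1 embedding_mult right_inverse)
  then show ?thesis
    by (metis inverse_unique)
qed (simp add: embedding_0)

lemma nv_of_nat_ext: "nvW (of_nat n) = nv (of_nat n)"
  using isometric[of "of_nat n"] by (simp add: embedding_of_nat)

lemma base_change_nth: "fps_nth (base_change \<iota> f) n = \<iota> (fps_nth f n)"
  by (simp add: base_change_def)

lemma base_change_add: "base_change \<iota> (f + g) = base_change \<iota> f + base_change \<iota> g"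
  by (rule fps_ext) (simp add: base_change_nth embedding_add)

lemma base_change_mult: "base_change \<iota> (f * g) = base_change \<iota> f * base_change \<iota> g"
  by (rule fps_ext) (simp add: base_change_nth embedding_sum embedding_mult fps_mult_nth)

lemma base_change_const: "base_change \<iota> (fps_const a) = fps_const (\<iota> a)"
  by (rule fps_ext) (simp add: base_change_nth embedding_0)

lemma base_change_hasse_deriv: "base_change \<iota> (hasse_deriv i f) = hasse_deriv i (base_change \<iota> f)"
  by (rule fps_ext) (simp add: base_change_nth hasse_deriv_def embedding_mult embedding_of_nat)

lemma base_change_disc_functions: "base_change \<iota> f \<in> disc_functions nvW R \<longleftrightarrow> f \<in> disc_functions nv R"
  by (simp add: disc_functions_def base_change_nth isometric)

lemma base_change_sums:
  "f \<in> disc_functions nv R \<Longrightarrow> nvW t < R \<Longrightarrow> fps_sums_to nvW (base_change \<iota> f) t (fps_value nvW (base_change \<iota> f) t)"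
  by (rule disc_functions_sums) (auto simp: base_change_disc_functions)

lemma lies_above_gauss_point:
  assumes "lies_above nvW \<iota> t (gauss_point nv \<rho>)" "0 \<le> \<rho>"
  shows "nvW t = \<rho>" and "nvW (poly (map_poly \<iota> P) t) = gauss_point nv \<rho> P"
proof -
  show eq: "nvW (poly (map_poly \<iota> P) t) = gauss_point nv \<rho> P" for P
    using assms(1) unfolding lies_above_def by (metis (no_types, lifting))
  have "poly (map_poly \<iota> [:0, 1:]) t = t"
    by (simp add: map_poly_pCons embedding_0 embedding_1)
  then show "nvW t = \<rho>"
    using eq[of "[:0, 1:]"] base.gauss_point_X[OF assms(2)] by simp
qed

text \<open>The Gauss point only speaks of polynomials. Truncating \<open>f\<close> changes the
  value at \<open>t\<close> by at most half of \<open>?\<delta>\<close>, while the truncation has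
  absolute value at least \<open>?\<delta>\<close> there, so both values have the same size.\<close>

lemma value_at_gauss_point_ge:
  assumes above: "lies_above nvW \<iota> t (gauss_point nv \<rho>)" and \<rho>: "0 \<le> \<rho>" "\<rho> < 1"
    and f: "f \<in> disc_functions nv 1"
  shows "nv (fps_nth f k) * \<rho> ^ k \<le> nvW (fps_value nvW (base_change \<iota> f) t)" (is "?\<delta> \<le> nvW ?v")
proof (cases "?\<delta> = 0")
  case False
  have t: "nvW t = \<rho>"
    by (rule lies_above_gauss_point(1)[OF above \<rho>(1)])
  have "0 \<le> ?\<delta>"
    using \<rho> by (intro mult_nonneg_nonneg base.nv_nonneg zero_le_power)
  then have \<delta>: "0 < ?\<delta>"
    using False by linarith
  have "(\<lambda>n. nv (fps_nth f n) * \<rho> ^ n) \<longlonglongrightarrow> 0"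
    using f \<rho> by (simp add: disc_functions_def)
  from order_tendstoD(2)[OF this half_gt_zero[OF \<delta>]]
  obtain n0 where n0: "\<And>n. n0 \<le> n \<Longrightarrow> nv (fps_nth f n) * \<rho> ^ n < ?\<delta> / 2"
    unfolding eventually_sequentially by blast
  \<comment> \<open>Large enough for the tail to be small and for the coefficient of degree
    \<open>k\<close> to survive the truncation.\<close>
  define n where "n = max n0 (Suc k)"
  define P where "P = (\<Sum>j<n. Polynomial.monom (fps_nth f j) j)"
  have P: "Polynomial.coeff P j = (if j < n then fps_nth f j else 0)" for j
    by (auto simp: P_def coeff_sum coeff_monom if_distrib cong: if_cong)
  have "fps_sums_to nvW (base_change \<iota> f - fps_of_poly (map_poly \<iota> P)) t (?v - poly (map_poly \<iota> P) t)"
    using \<rho> t by (intro fps_sums_to_diff fps_sums_to_poly base_change_sums[OF f]) auto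
  then have "nvW (?v - poly (map_poly \<iota> P) t) \<le> ?\<delta> / 2"
  proof (rule fps_sums_to_le)
    fix j
    show "nvW (fps_nth (base_change \<iota> f - fps_of_poly (map_poly \<iota> P)) j) * nvW t ^ j \<le> ?\<delta> / 2"
    proof (cases "j < n")
      case False
      then have "n0 \<le> j"
        by (simp add: n_def)
      from less_imp_le[OF n0[OF this]] show ?thesis
        using False by (simp add: isometric t base_change_nth coeff_map_poly embedding_0 P)
    qed (use \<delta> in \<open>simp add: base_change_nth coeff_map_poly embedding_0 P\<close>)
  qed
  moreover have "k < n"
    by (simp add: n_def less_max_iff_disj)
  then have ge: "?\<delta> \<le> nvW (poly (map_poly \<iota> P) t)"
    unfolding lies_above_gauss_point(2)[OF above \<rho>(1)]
    using base.gauss_point_upper[of P k \<rho>] P[of k] \<open>k < n\<close> by simp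
  ultimately have "nvW ?v = nvW (poly (map_poly \<iota> P) t)"
    using \<delta> by (intro nv_eq_if_close) linarith
  then show ?thesis
    using ge by simp
qed (metis nv_nonneg)

lemma taylor_shift_base_change:
  "fps_nth (taylor_shift t (base_change \<iota> f)) i = fps_value nvW (base_change \<iota> (hasse_deriv i f)) t"
  by (simp add: taylor_shift_def base_change_hasse_deriv)

text \<open>The coefficients of a local solution are power series over the base field evaluated at \<open>t\<close>;
  at a Gauss point their values therefore dominate those at the centre of the disc.\<close>

lemma local_solution_ge_center:
  assumes char: "\<And>n. of_nat (Suc n) \<noteq> (0 :: 'k)"
    and above: "lies_above nvW \<iota> t (gauss_point nv \<rho>)" and \<rho>: "0 \<le> \<rho>" "\<rho> < 1"
    and g: "g \<in> disc_functions nv 1" and F: "fps_deriv F = g * F" "fps_nth F 0 = 1"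
  shows "nv (fps_nth F n) \<le> nvW (fps_nth (local_solution t (base_change \<iota> g)) n)"
proof -
  \<comment> \<open>The solution coefficients for a variable centre: \<open>Y n\<close> is a power
    series in the centre, with value the \<open>n\<close>-th coefficient of the local solution at
    \<open>t\<close>, and constant term that of \<open>F\<close>.\<close>
  define Y where "Y = ode_coeff (\<lambda>n. fps_const (inverse_Suc n)) (\<lambda>i. hasse_deriv i g)"
  have Y_0: "Y 0 = 1" and Y_Suc: "Y (Suc m) = fps_const (inverse_Suc m) * (\<Sum>i\<le>m. hasse_deriv i g * Y (m - i))" for m
    by (simp_all add: Y_def)
  have t: "nvW t < 1"
    using lies_above_gauss_point(1)[OF above \<rho>(1)] \<rho> by simp
  have const: "fps_const a \<in> disc_functions nv 1" for a
    unfolding disc_functions_def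
  proof (intro CollectI allI impI)
    fix \<rho> :: real
    show "(\<lambda>n. nv (fps_nth (fps_const a) n) * \<rho> ^ n) \<longlonglongrightarrow> 0"
      by (rule tendsto_eventually, rule eventually_sequentiallyI[of 1]) simp
  qed
  have sum_disc: "(\<And>i. i \<in> A \<Longrightarrow> f i \<in> disc_functions nv 1) \<Longrightarrow> sum f A \<in> disc_functions nv 1"
    for f :: "nat \<Rightarrow> 'k fps" and A
    by (induction A rule: infinite_finite_induct) (use const[of 0] in \<open>auto intro: base.disc_functions_add\<close>)
  have Y_disc: "Y n \<in> disc_functions nv 1" for n
  proof (induction n rule: less_induct)
    case (less n)
    show ?case
    proof (cases n)
      case 0
      then show ?thesis
        using const[of 1] by (simp add: Y_0)
    next
      case (Suc m)
      then have "Y (m - i) \<in> disc_functions nv 1" for i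
        using less[of "m - i"] by simp
      then show ?thesis
        unfolding Suc Y_Suc by (intro base.disc_functions_mult const sum_disc base.disc_functions_hasse_deriv g)
    qed
  qed
  let ?ev = "\<lambda>f. fps_value nvW (base_change \<iota> f) t"
  have ev_mult: "?ev (f * h) = ?ev f * ?ev h" if "f \<in> disc_functions nv 1" "h \<in> disc_functions nv 1" for f h
    unfolding base_change_mult by (intro fps_value_eqI fps_sums_to_mult base_change_sums[OF _ t] that)
  have ev_const: "?ev (fps_const a) = \<iota> a" for a
    using fps_value_eqI[OF fps_sums_to_poly, of "[:\<iota> a:]" t]
    by (simp add: base_change_const fps_of_poly_const)
  have ev_sum: "?ev (sum f A) = (\<Sum>i\<in>A. ?ev (f i))" if "\<And>i. i \<in> A \<Longrightarrow> f i \<in> disc_functions nv 1"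
    for f :: "nat \<Rightarrow> 'k fps" and A
    using that
  proof (induction A rule: infinite_finite_induct)
    case (insert a A)
    then have "?ev (f a + sum f A) = ?ev (f a) + ?ev (sum f A)"
      unfolding base_change_add
      by (intro fps_value_eqI fps_sums_to_add base_change_sums[OF _ t] sum_disc) auto
    then show ?case
      using insert by simp
  qed (use ev_const[of 0] embedding_0 in auto)
  have ev_Y: "?ev (Y n) = fps_nth (local_solution t (base_change \<iota> g)) n" for n
  proof (induction n rule: less_induct)
    case (less n)
    show ?case
    proof (cases n)
      case 0
      then show ?thesis
        using ev_const[of 1] by (simp add: Y_0 local_solution_def embedding_1)
    next
      case (Suc m)
      note disc = base.disc_functions_hasse_deriv[OF g] Y_disc
      have "?ev (Y (Suc m)) = ?ev (fps_const (inverse_Suc m)) * ?ev (\<Sum>i\<le>m. hasse_deriv i g * Y (m - i))"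
        unfolding Y_Suc by (intro ev_mult const sum_disc base.disc_functions_mult disc)
      also have "?ev (\<Sum>i\<le>m. hasse_deriv i g * Y (m - i)) = (\<Sum>i\<le>m. ?ev (hasse_deriv i g * Y (m - i)))"
        by (intro ev_sum base.disc_functions_mult disc)
      also have "\<dots> = (\<Sum>i\<le>m. ?ev (hasse_deriv i g) * fps_nth (local_solution t (base_change \<iota> g)) (m - i))"
        using less Suc by (intro sum.cong refl) (simp add: ev_mult[OF disc] del: fps_nth_Abs_fps)
      also have "?ev (fps_const (inverse_Suc m)) = inverse_Suc m"
        by (simp only: ev_const embedding_inverse embedding_of_nat)
      finally show ?thesis
        unfolding Suc by (simp add: local_solution_def taylor_shift_base_change del: of_nat_Suc)
    qed
  qed
  have "fps_nth (Y n) 0 = ode_coeff inverse_Suc (fps_nth g) n" for n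
  proof (induction n rule: less_induct)
    case (less n)
    then show ?case
      by (cases n) (simp_all add: Y_0 Y_Suc fps_sum_nth hasse_deriv_def)
  qed
  then have "fps_nth F n = fps_nth (Y n) 0"
    using ode_coeff_unique[OF char F(1), of n] unfolding F(2) by simp
  then show ?thesis
    using value_at_gauss_point_ge[OF above \<rho> Y_disc, of n 0] ev_Y[of n] by simp
qed

end

locale padic_disc = K: gamma_log_deriv nv p g + big_field_extension nv nvW \<iota>
  for nv :: "'k::field_char_0 \<Rightarrow> real" and p :: nat and g :: "'k fps"
    and nvW :: "'w::alg_closed_field \<Rightarrow> real" and \<iota> :: "'k \<Rightarrow> 'w"
begin

lemma char_ext: "of_nat (Suc n) \<noteq> (0 :: 'w)"
  using nv_of_nat_ext[of "Suc n"] K.nv_eq_0_iff[of "of_nat (Suc n)"] nv_0 by (metis of_nat_neq_0)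

lemma nv_fact_ext_ge: "K.omega ^ n \<le> nvW (of_nat (fact n))"
  unfolding nv_of_nat_ext by (rule K.nv_fact_ge)

lemma nv_fact_ext_pos: "0 < nvW (of_nat (fact n))"
  using nv_fact_ext_ge[of n] K.omega_pos by (meson less_le_trans zero_less_power)

lemma fps_bound_in_disc_functions:
  assumes A: "0 < A" and y: "\<And>n. nvW (fps_nth y n * of_nat (fact n)) \<le> A ^ n"
  shows "y \<in> disc_functions nvW (K.omega / A)"
  unfolding disc_functions_def
proof (intro CollectI allI impI)
  fix \<sigma> assume \<sigma>: "0 \<le> \<sigma> \<and> \<sigma> < K.omega / A"
  have "(\<lambda>n. (A * \<sigma> / K.omega) ^ n) \<longlonglongrightarrow> 0"
    using \<sigma> A K.omega_pos by (intro LIMSEQ_realpow_zero) (auto simp: field_simps)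
  then show "(\<lambda>n. nvW (fps_nth y n) * \<sigma> ^ n) \<longlonglongrightarrow> 0"
  proof (rule Lim_null_comparison[rotated], intro always_eventually allI)
    fix n
    have "nvW (fps_nth y n) * K.omega ^ n \<le> nvW (fps_nth y n) * nvW (of_nat (fact n))"
      by (intro mult_left_mono nv_fact_ext_ge nv_nonneg)
    also have "\<dots> \<le> A ^ n"
      using y[of n] by (simp only: nv_mult)
    finally have "nvW (fps_nth y n) \<le> (A / K.omega) ^ n"
      using K.omega_pos by (simp add: power_divide pos_le_divide_eq)
    then have "nvW (fps_nth y n) * \<sigma> ^ n \<le> (A / K.omega) ^ n * \<sigma> ^ n"
      using \<sigma> by (intro mult_right_mono) auto
    then show "norm (nvW (fps_nth y n) * \<sigma> ^ n) \<le> (A * \<sigma> / K.omega) ^ n"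
      using \<sigma> by (simp add: nv_nonneg flip: power_mult_distrib)
  qed
qed

text \<open>At radius omega / A the term of degree n has size omega^n / |n!|, which is the constant
  \<open>omega\<close> whenever n is a power of \<open>p\<close>.\<close>

lemma fps_eq_disc_functions_le:
  assumes A: "0 < A" and y: "\<And>n. nvW (fps_nth y n * of_nat (fact n)) = A ^ n"
    and disc: "y \<in> disc_functions nvW R"
  shows "R \<le> K.omega / A"
proof (rule ccontr)
  assume "\<not> R \<le> K.omega / A"
  moreover have "0 \<le> K.omega / A"
    using A K.omega_pos by simp
  ultimately have lim: "(\<lambda>n. nvW (fps_nth y n) * (K.omega / A) ^ n) \<longlonglongrightarrow> 0"
    using disc by (simp add: disc_functions_def)
  have "nvW (fps_nth y (p ^ k)) * (K.omega / A) ^ (p ^ k) = K.omega" for k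
  proof -
    let ?f = "nvW (of_nat (fact (p ^ k)))"
    have "nvW (fps_nth y (p ^ k)) * (K.omega / A) ^ (p ^ k) * ?f
        = (nvW (fps_nth y (p ^ k)) * ?f) * (K.omega / A) ^ (p ^ k)"
      by (simp only: mult_ac)
    also have "\<dots> = A ^ (p ^ k) * (K.omega / A) ^ (p ^ k)"
      using y[of "p ^ k"] by (simp only: nv_mult)
    also have "\<dots> = K.omega ^ (p ^ k)"
      using A by (simp add: power_divide)
    also have "\<dots> = K.omega * ?f"
      unfolding nv_of_nat_ext K.nv_fact_power[symmetric] by (rule mult.commute)
    finally show ?thesis
      using nv_fact_ext_pos[of "p ^ k"] by (metis less_irrefl mult_right_cancel)
  qed
  moreover have "strict_mono (\<lambda>k. p ^ k)"
    using K.p_gt_1 by (intro strict_monoI) simp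
  ultimately have "(\<lambda>k :: nat. K.omega) \<longlonglongrightarrow> 0"
    using LIMSEQ_subseq_LIMSEQ[OF lim, of "\<lambda>k. p ^ k"] by (simp add: comp_def)
  then show False
    using K.omega_pos by (simp add: LIMSEQ_const_iff)
qed

lemma taylor_coeff_le:
  assumes t: "nvW t \<le> \<sigma>" and \<sigma>: "0 < \<sigma>" "\<sigma> < 1" and B: "\<And>k. nv (fps_nth g k) * \<sigma> ^ k \<le> B"
  shows "nvW (fps_nth (taylor_shift t (base_change \<iota> g)) i) \<le> B / \<sigma> ^ i"
proof -
  have "(\<lambda>k. nvW (fps_nth (base_change \<iota> g) k) * \<sigma> ^ k) \<longlonglongrightarrow> 0"
    using K.g_in_disc_functions \<sigma> by (simp add: disc_functions_def base_change_nth isometric)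
  then have "nvW (fps_nth (taylor_shift t (base_change \<iota> g)) i) * \<sigma> ^ i \<le> B"
    using t by (rule taylor_shift_le) (simp add: base_change_nth isometric B)
  then show ?thesis
    using \<sigma> by (simp add: pos_le_divide_eq)
qed

lemma nv_p_ext: "0 < nvW (of_nat p)" "nvW (of_nat p) < 1"
  using K.p_gt_1 unfolding nv_of_nat_ext K.nv_p by auto

lemma base_change_g: "base_change \<iota> g \<in> disc_functions nvW 1"
  using K.g_in_disc_functions by (simp add: base_change_disc_functions)

lemma radius_large:
  assumes n: "1 \<le> n" and \<rho>: "K.crit_radius (n - 1) \<le> \<rho>" "\<rho> \<le> K.crit_radius n" "K.crit_radius 0 < \<rho>"
    and above: "lies_above nvW \<iota> t (gauss_point nv \<rho>)"
  shows "solution_radius nvW (base_change \<iota> g) t = K.omega / K.peak \<rho> n"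
proof -
  have \<rho>01: "0 < \<rho>" "\<rho> < 1"
    using \<rho> K.crit_radius_pos[of 0] K.crit_radius_less_1[of n] by auto
  have t: "nvW t = \<rho>"
    using lies_above_gauss_point(1)[OF above] \<rho>01 by simp
  define A where "A = K.peak \<rho> n"
  have A\<rho>: "1 < A * \<rho>"
    unfolding A_def by (rule K.peak_mult_ge_1(2)[OF K.p_neq_2 n \<rho>(1,3)])
  have A: "1 < A"
    using A\<rho> \<rho>01 K.peak_nonneg[of \<rho> n] unfolding A_def[symmetric]
    by (metis less_le_trans less_imp_le mult_left_le)
  let ?c = "fps_nth (taylor_shift t (base_change \<iota> g))"
  have le: "nvW (?c i) \<le> A / \<rho> ^ i" for i
    unfolding A_def using t \<rho>01 K.coeff_term_le_max_peak[OF n \<rho>(1,2)] by (intro taylor_coeff_le) auto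
  have c0: "nvW (?c 0) = A"
  proof (rule antisym)
    show "nvW (?c 0) \<le> A"
      using le[of 0] by simp
    \<comment> \<open>One term suffices: the degree \<open>p ^ (n - 1) * (p - 1)\<close> attains the
      Gauss norm.\<close>
    show "A \<le> nvW (?c 0)"
      using value_at_gauss_point_ge[OF above less_imp_le[OF \<rho>01(1)] \<rho>01(2) K.g_in_disc_functions,
          of "p ^ (n - 1) * (p - 1)"]
      unfolding A_def K.coeff_term_eq_peak[OF n] taylor_shift_base_change by simp
  qed
  have c: "nvW (?c i) < A ^ Suc i" if "1 \<le> i" for i
  proof -
    have "1 < (A * \<rho>) ^ i"
      using A\<rho> that by (intro one_less_power) auto
    then have "A / \<rho> ^ i < A ^ Suc i"
      using \<rho>01 A by (simp add: power_mult_distrib pos_divide_less_eq)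
    then show ?thesis
      using le[of i] by simp
  qed
  have eq: "nvW (fps_nth (local_solution t (base_change \<iota> g)) k * of_nat (fact k)) = A ^ k" for k
    unfolding local_solution_def fps_nth_Abs_fps
    by (rule ode_coeff_eq[OF char_ext _ c0 c]) (use A in simp)
  show ?thesis
    unfolding A_def[symmetric]
  proof (rule solution_radius_eqI[OF char_ext base_change_g _ nv_p_ext])
    show "nvW t < 1" "0 < K.omega / A"
      using t \<rho>01 A K.omega_pos by auto
    show "K.omega / A \<le> 1"
      using A K.omega_less_1 by simp
    show "local_solution t (base_change \<iota> g) \<in> disc_functions nvW (K.omega / A)"
      using A eq by (intro fps_bound_in_disc_functions) auto
    show "local_solution t (base_change \<iota> g) \<in> disc_functions nvW R' \<Longrightarrow> R' \<le> K.omega / A" for R'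
      using A eq by (intro fps_eq_disc_functions_le) auto
  qed
qed

text \<open>The coefficient bounds give convergence at least up to
  \<open>omega * crit_radius 0\<close>; a larger disc at \<open>t\<close> would yield one for
  \<open>F\<close> at the centre.\<close>

lemma radius_small:
  assumes F: "fps_deriv F = g * F" "fps_nth F 0 = 1"
    and \<rho>: "0 \<le> \<rho>" "\<rho> \<le> K.crit_radius 0"
    and above: "lies_above nvW \<iota> t (gauss_point nv \<rho>)"
  shows "solution_radius nvW (base_change \<iota> g) t = K.omega * K.crit_radius 0"
proof -
  let ?r = "K.crit_radius 0"
  have r: "0 < ?r" "?r < 1"
    by (rule K.crit_radius_pos K.crit_radius_less_1)+
  have t: "nvW t = \<rho>"
    using lies_above_gauss_point(1)[OF above] \<rho> by simp
  \<comment> \<open>Cauchy's estimates are taken at radius \<open>?r\<close>, not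
    \<open>\<rho>\<close>: there the terms of \<open>g\<close> are bounded by \<open>1 / ?r\<close>,
    so the \<open>i\<close>-th coefficient is at most \<open>A ^ Suc i\<close>.\<close>
  define A where "A = 1 / ?r"
  have A: "0 < A" "K.omega / A = K.omega * ?r"
    using r by (auto simp: A_def)
  let ?c = "fps_nth (taylor_shift t (base_change \<iota> g))"
  have c: "nvW (?c i) \<le> A ^ Suc i" for i
  proof -
    have "nvW (?c i) \<le> 1 / ?r / ?r ^ i"
      using t \<rho> r K.coeff_term_le_small[of ?r] by (intro taylor_coeff_le) auto
    then show ?thesis
      by (simp add: A_def power_divide)
  qed
  have le: "nvW (fps_nth (local_solution t (base_change \<iota> g)) k * of_nat (fact k)) \<le> A ^ k" for k
    unfolding local_solution_def fps_nth_Abs_fps by (rule ode_coeff_le[OF char_ext A(1) c])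
  show ?thesis
  proof (rule solution_radius_eqI[OF char_ext base_change_g _ nv_p_ext])
    show "nvW t < 1" "0 < K.omega * ?r"
      using t \<rho> r K.omega_pos by auto
    show "K.omega * ?r \<le> 1"
      using r K.omega_less_1 K.omega_pos by (intro mult_le_one) auto
    show "local_solution t (base_change \<iota> g) \<in> disc_functions nvW (K.omega * ?r)"
      using fps_bound_in_disc_functions[OF A(1) le] A(2) by simp
    fix R' assume R': "local_solution t (base_change \<iota> g) \<in> disc_functions nvW R'"
    \<comment> \<open>The coefficients at \<open>t\<close> dominate those at 0, so convergence
      carries over to the centre with the same radius.\<close>
    have "F \<in> disc_functions nv R'"
      unfolding disc_functions_def
    proof (intro CollectI allI impI)
      fix \<sigma> assume \<sigma>: "0 \<le> \<sigma> \<and> \<sigma> < R'"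
      then have "(\<lambda>k. nvW (fps_nth (local_solution t (base_change \<iota> g)) k) * \<sigma> ^ k) \<longlonglongrightarrow> 0"
        using R' by (simp add: disc_functions_def)
      then show "(\<lambda>k. nv (fps_nth F k) * \<sigma> ^ k) \<longlonglongrightarrow> 0"
      proof (rule Lim_null_comparison[rotated], intro always_eventually allI)
        fix k
        have "nv (fps_nth F k) \<le> nvW (fps_nth (local_solution t (base_change \<iota> g)) k)"
          using \<rho> r by (intro local_solution_ge_center[OF of_nat_neq_0 above _ _ K.g_in_disc_functions F]) auto
        then show "norm (nv (fps_nth F k) * \<sigma> ^ k)
            \<le> nvW (fps_nth (local_solution t (base_change \<iota> g)) k) * \<sigma> ^ k"
          using \<sigma> by (simp add: K.nv_nonneg mult_right_mono)
      qed
    qed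
    then show "R' \<le> K.omega * ?r"
      by (rule K.taylor_radius_upper[OF F(2,1)])
  qed
qed

end

theorem theorem4:
  fixes p :: nat
    and nv :: "'k::field_char_0 \<Rightarrow> real"
    and nvW :: "'w::alg_closed_field \<Rightarrow> real"
    and \<iota> :: "'k \<Rightarrow> 'w"
    and t :: "('k poly \<Rightarrow> real) \<Rightarrow> 'w"
    and \<Gamma> :: "'k \<Rightarrow> 'k" and \<Gamma>0 :: "'k fps"
    and \<omega> :: real and r :: "nat \<Rightarrow> real"
  assumes "prime p" and "p \<noteq> 2"
    and "padic_numbers nv p"
    and "is_morita_gamma nv \<Gamma>" and "is_taylor_expansion_at_0 nv \<Gamma> \<Gamma>0"
    and "big_field_extension nv nvW \<iota>"
    and "\<And>x. x \<in> open_unit_disc nv \<Longrightarrow> lies_above nvW \<iota> (t x) x"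
    and \<omega>: "\<omega> = nv (of_nat p) powr (1 / (real p - 1))"
    and r_0: "r 0 = nv (of_nat p) powr (1 / real p)"
    and r_n: "\<And>n. n \<ge> 1 \<Longrightarrow> r n = \<omega> powr (1 / (real p ^ (n - 1) * (real p - 1)))"
  shows "\<exists>g0 \<in> disc_functions nv 1.
     fps_deriv \<Gamma>0 = g0 * \<Gamma>0 \<and>
     (\<forall>\<rho>. 0 \<le> \<rho> \<and> \<rho> \<le> r 0 \<longrightarrow>
        solution_radius nvW (base_change \<iota> g0) (t (gauss_point nv \<rho>))
          = \<omega> * nv (of_nat p) powr (1 / real p)) \<and>
     (\<forall>n \<ge> 1. \<forall>\<rho>. r (n - 1) \<le> \<rho> \<and> \<rho> \<le> r n \<longrightarrow>
        solution_radius nvW (base_change \<iota> g0) (t (gauss_point nv \<rho>))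
          = \<omega> * nv (of_nat p) ^ n / \<rho> ^ (p ^ (n - 1) * (p - 1))) \<and>
     (\<forall>\<rho>. 0 \<le> \<rho> \<and> \<rho> \<le> r 0 \<longrightarrow> ereal (gauss_norm nv \<rho> g0) \<le> inverse (ereal \<rho>)) \<and>
     (\<forall>n \<ge> 1. \<forall>\<rho>. r (n - 1) \<le> \<rho> \<and> \<rho> \<le> r n \<longrightarrow>
        gauss_norm nv \<rho> g0 = \<rho> ^ (p ^ (n - 1) * (p - 1)) / nv (of_nat p) ^ n)"
proof -
  define g where "g = fps_deriv \<Gamma>0 * inverse \<Gamma>0"
  note coeffs = padic_numbers.log_deriv_gamma_coeffs[OF assms(3,2,4,5), folded g_def]
  interpret padic_disc nv p g nvW \<iota>
  proof (intro padic_disc.intro gamma_log_deriv.intro gamma_log_deriv_axioms.intro)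
    show "padic_numbers nv p" "p \<noteq> 2" "big_field_extension nv nvW \<iota>"
      by fact+
  qed (use coeffs in blast)+
  have F: "fps_deriv \<Gamma>0 = g * \<Gamma>0" "fps_nth \<Gamma>0 0 = 1"
    using coeffs(1) inverse_mult_eq_1[of \<Gamma>0] by (simp_all add: g_def mult.assoc)
  have \<omega>_eq: "\<omega> = K.omega"
    by (simp add: \<omega> K.omega_def K.nv_p)
  have r_eq: "r n = K.crit_radius n" for n
    using r_n[of n] by (cases "n = 0") (auto simp: r_0 K.crit_radius_def K.nv_p \<omega>_eq)
  have above: "lies_above nvW \<iota> (t (gauss_point nv \<rho>)) (gauss_point nv \<rho>)"
    if "0 \<le> \<rho>" "\<rho> \<le> K.crit_radius n" for \<rho> n
    using that K.crit_radius_less_1[of n]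
    by (intro assms(7) K.gauss_point_in_open_unit_disc) auto
  have r0_eq: "nv (of_nat p) powr (1 / real p) = K.crit_radius 0"
    using r_0 r_eq[of 0] by simp
  have peak_eq: "K.peak \<rho> n = \<rho> ^ (p ^ (n - 1) * (p - 1)) / nv (of_nat p) ^ n" for \<rho> n
    by (simp add: K.peak_def K.nv_p power_divide)
  have small: "solution_radius nvW (base_change \<iota> g) (t (gauss_point nv \<rho>)) = K.omega * K.crit_radius 0"
    if "0 \<le> \<rho>" "\<rho> \<le> K.crit_radius 0" for \<rho>
    by (rule radius_small[OF F that above[OF that]])
  have large: "solution_radius nvW (base_change \<iota> g) (t (gauss_point nv \<rho>)) = K.omega / K.peak \<rho> n"
    if n: "1 \<le> n" and \<rho>: "K.crit_radius (n - 1) \<le> \<rho>" "\<rho> \<le> K.crit_radius n" for \<rho> n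
  proof -
    have r0: "K.crit_radius 0 \<le> \<rho>"
      using K.crit_radius_mono[OF assms(2), of 0 "n - 1"] \<rho> by simp
    have "0 \<le> \<rho>"
      using r0 K.crit_radius_pos[of 0] by linarith
    show ?thesis
    \<comment> \<open>At the first break point \<open>peak \<rho> 1 * \<rho>\<close> is only equal
      to 1 and strict dominance is lost. Strict growth of the radii forces \<open>n = 1\<close>
      there, and the formula agrees with the one for small radii.\<close>
    proof (cases "\<rho> = K.crit_radius 0")
      case True
      have "n = 1"
      proof (rule ccontr)
        assume "n \<noteq> 1"
        then have "Suc 0 \<le> n - 1"
          using n by linarith
        then have "K.crit_radius (Suc 0) \<le> \<rho>"
          using K.crit_radius_mono[OF assms(2)] \<rho>(1) order_trans by blast
        then show False
          using K.crit_radius_strict_mono[OF assms(2), of 0] True by simp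
      qed
      then show ?thesis
        using small[OF \<open>0 \<le> \<rho>\<close>] True K.peak_1_crit_radius_0 by simp
    next
      case False
      then show ?thesis
        using radius_large[OF n \<rho> _ above[OF \<open>0 \<le> \<rho>\<close> \<rho>(2)]] r0 by simp
    qed
  qed
  show ?thesis
  proof (intro bexI[of _ g] conjI allI impI)
    show "g \<in> disc_functions nv 1"
      by (rule K.g_in_disc_functions)
    show "fps_deriv \<Gamma>0 = g * \<Gamma>0"
      by (rule F(1))
  next
    fix \<rho> assume "0 \<le> \<rho> \<and> \<rho> \<le> r 0"
    then show "solution_radius nvW (base_change \<iota> g) (t (gauss_point nv \<rho>)) = \<omega> * nv (of_nat p) powr (1 / real p)"
      unfolding r0_eq \<omega>_eq r_eq using small by blast
  next
    fix n \<rho> assume "1 \<le> n" "r (n - 1) \<le> \<rho> \<and> \<rho> \<le> r n"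
    then show "solution_radius nvW (base_change \<iota> g) (t (gauss_point nv \<rho>))
        = \<omega> * nv (of_nat p) ^ n / \<rho> ^ (p ^ (n - 1) * (p - 1))"
      unfolding \<omega>_eq r_eq using large peak_eq by simp
  next
    fix \<rho> assume "0 \<le> \<rho> \<and> \<rho> \<le> r 0"
    then show "ereal (gauss_norm nv \<rho> g) \<le> inverse (ereal \<rho>)"
      unfolding r_eq using K.gauss_norm_small by blast
  next
    fix n \<rho> assume "1 \<le> n" "r (n - 1) \<le> \<rho> \<and> \<rho> \<le> r n"
    then show "gauss_norm nv \<rho> g = \<rho> ^ (p ^ (n - 1) * (p - 1)) / nv (of_nat p) ^ n"
      unfolding r_eq peak_eq[symmetric] using K.gauss_norm_eq_peak by blast
  qed
qed

end
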